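(* Let $f_1$ and $f_2$ be two post-critically finite monic polynomials on $\mathbb{C}$ of the same degree $d\ge2$, and let $F$ be their formal mating (a branched covering of a topological sphere). Then the iterated monodromy group of $F$ is generated by two subgroups which are isomorphic to the iterated monodromy groups of $f_1$ and $f_2$ respectively.
   Context: Formal mating: let $\mathbb{C}_1,\mathbb{C}_2$ be two copies of $\mathbb{C}$, with $f_i$ acting on $\mathbb{C}_i$. Compactify each by a circle at infinity: $\widetilde{\mathbb{C}_i}=\mathbb{C}_i\cup\{\infty\cdot e^{2i\pi\theta}: \theta\in\mathbb{R}/\mathbb{Z}\}$, and extend $f_i$ continuously by $\infty\cdot e^{2i\pi\theta}\mapsto\infty\cdot e^{2i\pi d\theta}$. Glue $\widetilde{\mathbb{C}_1}$ and $\widetilde{\mathbb{C}_2}$ by identifying $\infty\cdot e^{2i\pi\theta}\in\widetilde{\mathbb{C}_1}$ with $\infty\cdot e^{-2i\pi\theta}\in\widetilde{\mathbb{C}_2}$. The result is a topological sphere $S$, and the maps $f_1,f_2$ together define a degree $d$ branched covering $F:S\to S$ whose restrictions to the hemispheres $\mathbb{C}_1$ and $\mathbb{C}_2$ are $f_1$ and $f_2$; $F$ is the formal mating of $f_1$ and $f_2$. It is post-critically finite if $f_1,f_2$ are. Partial self-coverings: for a polynomial $f_i$, let $P_{f_i}\subset\mathbb{C}$ be its post-critical set (the union over $n\ge1$ of the images under $f_i^n$ of the critical points in $\mathbb{C}$); post-critically finite means $P_{f_i}$ is finite. The associated partial self-covering is $f_i:\mathbb{C}\setminus f_i^{-1}(P_{f_i})\to\mathbb{C}\setminus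 P_{f_i}$. For $F$, with post-critical set $P_F$ (the union over $n\ge1$ of the images under $F^n$ of the critical points), it is $F:S\setminus F^{-1}(P_F)\to S\setminus P_F$. Iterated monodromy group: for a covering $p:\mathcal{M}_1\to\mathcal{M}$ of degree $d\ge2$ with $\mathcal{M}$ path connected and locally path connected and $\mathcal{M}_1\subseteq\mathcal{M}$, and $t\in\mathcal{M}$, the group $\pi_1(\mathcal{M},t)$ acts on each $p^{-n}(t)$, $n\ge0$, by letting $[\gamma]x$ be the terminal point of the $p^n$-lift of $\gamma$ starting at $x$. Then $\mathrm{IMG}(p,t)=\pi_1(\mathcal{M},t)/K$, where $K$ is the set of $[\gamma]$ with $[\gamma]x=x$ for all $n\ge0$ and all $x\in p^{-n}(t)$. Up to group isomorphism it does not depend on $t$. The iterated monodromy group of $f_i$ or $F$ means that of the associated partial self-covering. *)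

theory Defs
  imports
    "HOL-Analysis.Analysis"
    "HOL-Computational_Algebra.Polynomial"
    "HOL-Algebra.Generated_Groups"
begin

section \<open>Fundamental groups\<close>

definition loops_at :: "'a::topological_space set \<Rightarrow> 'a \<Rightarrow> (real \<Rightarrow> 'a) set" where
  "loops_at M t = {\<gamma>. path \<gamma> \<and> path_image \<gamma> \<subseteq> M \<and> pathstart \<gamma> = t \<and> pathfinish \<gamma> = t}"

definition loop_class :: "'a::topological_space set \<Rightarrow> (real \<Rightarrow> 'a) \<Rightarrow> (real \<Rightarrow> 'a) set" where
  "loop_class M \<gamma> = {\<delta>. homotopic_paths M \<gamma> \<delta>}"

text \<open>In a product \<open>[\<alpha>][\<beta>]\<close> the loop \<open>\<beta>\<close> is traversed first; with this order the monodromy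
  action below is a left action.\<close>

definition fundamental_group ::
    "'a::topological_space set \<Rightarrow> 'a \<Rightarrow> (real \<Rightarrow> 'a) set monoid" where
  "fundamental_group M t =
     \<lparr>carrier = loop_class M ` loops_at M t,
      mult = (\<lambda>A B. \<Union>\<alpha>\<in>A. \<Union>\<beta>\<in>B. loop_class M (\<beta> +++ \<alpha>)),
      one = loop_class M (\<lambda>_. t)\<rparr>"

section \<open>Iterated monodromy groups\<close>

text \<open>Throughout, \<open>p\<close> restricted to \<open>M1 \<subseteq> M\<close> is a covering of \<open>M\<close>; its values off \<open>M1\<close> are
  irrelevant. \<open>iter_dom p M1 M n\<close> is the domain of the \<open>n\<close>-th iterate of this partial map.\<close>

primrec iter_dom :: "('a \<Rightarrow> 'a) \<Rightarrow> 'a set \<Rightarrow> 'a set \<Rightarrow> nat \<Rightarrow> 'a set" where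
  "iter_dom p M1 M 0 = M"
| "iter_dom p M1 M (Suc n) = {x \<in> M1. p x \<in> iter_dom p M1 M n}"

definition iter_fiber :: "('a \<Rightarrow> 'a) \<Rightarrow> 'a set \<Rightarrow> 'a set \<Rightarrow> nat \<Rightarrow> 'a \<Rightarrow> 'a set" where
  "iter_fiber p M1 M n t = {x \<in> iter_dom p M1 M n. (p ^^ n) x = t}"

definition is_iter_lift ::
    "('a::topological_space \<Rightarrow> 'a) \<Rightarrow> 'a set \<Rightarrow> 'a set \<Rightarrow> nat \<Rightarrow> (real \<Rightarrow> 'a) \<Rightarrow> (real \<Rightarrow> 'a) \<Rightarrow> bool" where
  "is_iter_lift p M1 M n \<gamma> g \<longleftrightarrow>
     path g \<and> path_image g \<subseteq> iter_dom p M1 M n \<and> (\<forall>s\<in>{0..1}. (p ^^ n) (g s) = \<gamma> s)"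

text \<open>For a covering the lift of \<open>\<gamma>\<close> from \<open>x\<close> exists, is unique on \<open>{0..1}\<close>, and its endpoint
  depends only on the homotopy class \<open>A\<close> of \<open>\<gamma>\<close>, so the definite description is proper.\<close>

definition monodromy_act ::
    "('a::topological_space \<Rightarrow> 'a) \<Rightarrow> 'a set \<Rightarrow> 'a set \<Rightarrow> nat \<Rightarrow> (real \<Rightarrow> 'a) set \<Rightarrow> 'a \<Rightarrow> 'a" where
  "monodromy_act p M1 M n A x =
     (THE y. \<exists>\<gamma>\<in>A. \<exists>g. is_iter_lift p M1 M n \<gamma> g \<and> pathstart g = x \<and> pathfinish g = y)"

definition monodromy_kernel ::
    "('a::topological_space \<Rightarrow> 'a) \<Rightarrow> 'a set \<Rightarrow> 'a set \<Rightarrow> 'a \<Rightarrow> (real \<Rightarrow> 'a) set set" where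
  "monodromy_kernel p M1 M t =
     {A \<in> carrier (fundamental_group M t).
        \<forall>n. \<forall>x \<in> iter_fiber p M1 M n t. monodromy_act p M1 M n A x = x}"

definition IMG ::
    "('a::topological_space \<Rightarrow> 'a) \<Rightarrow> 'a set \<Rightarrow> 'a set \<Rightarrow> 'a \<Rightarrow> (real \<Rightarrow> 'a) set set monoid" where
  "IMG p M1 M t = fundamental_group M t Mod monodromy_kernel p M1 M t"

section \<open>Post-critical sets\<close>

definition forward_orbit :: "('a \<Rightarrow> 'a) \<Rightarrow> 'a set \<Rightarrow> 'a set" where
  "forward_orbit F C = (\<Union>n\<in>{1..}. (F ^^ n) ` C)"

definition poly_post_critical :: "complex poly \<Rightarrow> complex set" where
  "poly_post_critical f = forward_orbit (poly f) {z. poly (pderiv f) z = 0}"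

text \<open>The critical points of a branched covering, i.e. the points of local degree at least 2, are
  the points at which it is not a local homeomorphism.\<close>

definition local_homeo_at :: "('a::topological_space \<Rightarrow> 'a) \<Rightarrow> 'a \<Rightarrow> bool" where
  "local_homeo_at F x \<longleftrightarrow> (\<exists>U V g. open U \<and> x \<in> U \<and> open V \<and> homeomorphism U V F g)"

definition branched_post_critical :: "('a::topological_space \<Rightarrow> 'a) \<Rightarrow> 'a set" where
  "branched_post_critical F = forward_orbit F {x. \<not> local_homeo_at F x}"

definition IMG_poly :: "complex poly \<Rightarrow> complex \<Rightarrow> (real \<Rightarrow> complex) set set monoid" where
  "IMG_poly f t =
     IMG (poly f) (UNIV - poly f -` poly_post_critical f) (UNIV - poly_post_critical f) t"

definition IMG_branched ::
    "('a::topological_space \<Rightarrow> 'a) \<Rightarrow> 'a \<Rightarrow> (real \<Rightarrow> 'a) set set monoid" where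
  "IMG_branched F t =
     IMG F (UNIV - F -` branched_post_critical F) (UNIV - branched_post_critical F) t"

section \<open>The plane compactified by a circle at infinity\<close>

text \<open>The angle \<open>\<theta> \<in> \<real>/\<int>\<close> is represented by the unit complex number \<open>exp (2 * pi * \<i> * \<theta>)\<close>, so
  multiplication of angles by \<open>d\<close> is \<open>u \<mapsto> u ^ d\<close> and negation is conjugation.\<close>

typedef circle = "sphere (0::complex) 1"
  by (rule exI[of _ 1]) simp

setup_lifting type_definition_circle

lift_definition circle_power :: "circle \<Rightarrow> nat \<Rightarrow> circle" is "\<lambda>u d. u ^ d"
  by (simp add: norm_power)

lift_definition circle_cnj :: "circle \<Rightarrow> circle" is cnj
  by simp

lemma circle_cnj_cnj [simp]: "circle_cnj (circle_cnj u) = u"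
  by transfer simp

lemma circle_cnj_power: "circle_cnj (circle_power u d) = circle_power (circle_cnj u) d"
  by transfer simp

datatype closed_plane = Pt complex | AtInfty circle

text \<open>The topology is the one of the closed unit disk, the plane being identified with the open
  disk by a radial homeomorphism and \<open>\<infinity> \<cdot> u\<close> with the boundary point \<open>u\<close>.\<close>

primrec disk_coord :: "closed_plane \<Rightarrow> complex" where
  "disk_coord (Pt z) = z / of_real (1 + norm z)"
| "disk_coord (AtInfty u) = Rep_circle u"

instantiation closed_plane :: topological_space
begin

definition open_closed_plane :: "closed_plane set \<Rightarrow> bool" where
  "open_closed_plane U \<longleftrightarrow> (\<exists>V. open V \<and> U = disk_coord -` V)"

instance
proof
  show "open (UNIV :: closed_plane set)"
    unfolding open_closed_plane_def by (rule exI[of _ UNIV]) simp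
next
  fix S T :: "closed_plane set"
  assume "open S" "open T"
  then obtain V W where "open V" "S = disk_coord -` V" "open W" "T = disk_coord -` W"
    unfolding open_closed_plane_def by blast
  then show "open (S \<inter> T)"
    unfolding open_closed_plane_def by (intro exI[of _ "V \<inter> W"]) auto
next
  fix K :: "closed_plane set set"
  assume "\<forall>S\<in>K. open S"
  then obtain V where V: "\<And>S. S \<in> K \<Longrightarrow> open (V S) \<and> S = disk_coord -` V S"
    unfolding open_closed_plane_def by metis
  have "\<Union>K = disk_coord -` (\<Union>(V ` K))"
    using V by blast
  then show "open (\<Union>K)"
    unfolding open_closed_plane_def using V by (intro exI[of _ "\<Union>(V ` K)"]) auto
qed

end

primrec extend_poly :: "nat \<Rightarrow> complex poly \<Rightarrow> closed_plane \<Rightarrow> closed_plane" where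
  "extend_poly d f (Pt z) = Pt (poly f z)"
| "extend_poly d f (AtInfty u) = AtInfty (circle_power u d)"

section \<open>The formal mating\<close>

definition glued :: "closed_plane + closed_plane \<Rightarrow> closed_plane + closed_plane \<Rightarrow> bool" where
  "glued x y \<longleftrightarrow> x = y
     \<or> (\<exists>u. x = Inl (AtInfty u) \<and> y = Inr (AtInfty (circle_cnj u)))
     \<or> (\<exists>u. y = Inl (AtInfty u) \<and> x = Inr (AtInfty (circle_cnj u)))"

lemma equivp_glued: "equivp glued"
proof (rule equivpI)
  show "reflp glued"
    by (simp add: reflp_def glued_def)
  show "symp glued"
    unfolding symp_def glued_def by blast
  have inj: "u = v" if "circle_cnj u = circle_cnj v" for u v
    using that by (metis circle_cnj_cnj)
  show "transp glued"
    unfolding transp_def glued_def by (auto dest: inj)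
qed

quotient_type mating_sphere = "closed_plane + closed_plane" / glued
  by (rule equivp_glued)

text \<open>The quotient topology of the disjoint union of the two closed planes.\<close>

instantiation mating_sphere :: topological_space
begin

definition open_mating_sphere :: "mating_sphere set \<Rightarrow> bool" where
  "open_mating_sphere U \<longleftrightarrow>
     open {x. abs_mating_sphere (Inl x) \<in> U} \<and> open {x. abs_mating_sphere (Inr x) \<in> U}"

instance
proof
  show "open (UNIV :: mating_sphere set)"
    by (simp add: open_mating_sphere_def)
next
  fix S T :: "mating_sphere set"
  assume "open S" "open T"
  then show "open (S \<inter> T)"
    by (auto simp: open_mating_sphere_def Collect_conj_eq intro: open_Int)
next
  fix K :: "mating_sphere set set"
  assume K: "\<forall>S\<in>K. open S"
  have eq: "{x. abs_mating_sphere (i x) \<in> \<Union>K} = (\<Union>S\<in>K. {x. abs_mating_sphere (i x) \<in> S})"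
    for i :: "closed_plane \<Rightarrow> closed_plane + closed_plane"
    by blast
  show "open (\<Union>K)"
    unfolding open_mating_sphere_def eq using K by (auto simp: open_mating_sphere_def)
qed

end

text \<open>The parameter \<open>d\<close> is the common degree of the two polynomials; it is a separate argument
  because the two extensions agree on the glued circle only when they use the same power.\<close>

lift_definition formal_mating ::
    "nat \<Rightarrow> complex poly \<Rightarrow> complex poly \<Rightarrow> mating_sphere \<Rightarrow> mating_sphere"
  is "\<lambda>d f1 f2. map_sum (extend_poly d f1) (extend_poly d f2)"
  by (auto simp: glued_def circle_cnj_power)

end

theory Submission
  imports
    Defs
    "HOL-Complex_Analysis.Complex_Analysis"
    "HOL-Computational_Algebra.Fundamental_Theorem_Algebra"
begin

text \<open>
  Write \<open>P\<^sub>i\<close> for the post-critical set of the \<open>i\<close>-th polynomial, \<open>P\<^sub>F\<close> for that of the mating \<open>F\<close>,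
  and \<open>M\<close> for the mating sphere without \<open>P\<^sub>F\<close>. There are three ingredients.

  \<^item> \<open>F\<close> is a local homeomorphism at every point of the equator (\<open>local_homeo_circle\<close>). A monic
    polynomial is injective on a convex neighbourhood of each direction at infinity, because there
    its derivative, divided by the \<open>(d - 1)\<close>-st power of that direction, has positive real part;
    so \<open>F\<close> is locally injective at the equator, and invariance of domain applies in the charts of
    the sphere. Hence \<open>P\<^sub>F\<close> is the union of the copies of \<open>P\<^sub>1\<close> and \<open>P\<^sub>2\<close> in the two open
    hemispheres (\<open>PF_eq\<close>). Since the sphere is compact, \<open>F\<close> is a covering of \<open>M\<close>, so paths
    and homotopies of paths lift through all iterates (\<open>path_lifting_F\<close>).

  \<^item> Each open hemisphere is completely invariant under \<open>F\<close>, which acts on it as the polynomial.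
    The fibre of an iterate of \<open>F\<close> over a point of the hemisphere therefore is the fibre of the
    iterate of the polynomial, and the lifts of a path in the hemisphere agree. So a loop of the
    punctured plane acts trivially for the polynomial if and only if it acts trivially for \<open>F\<close>, and
    the group of the polynomial embeds into that of \<open>F\<close>, after the base points are joined by a
    path (\<open>IMG_part_embeds\<close>).

  \<^item> The part of \<open>M\<close> above a parallel slightly below the equator and the punctured lower
    hemisphere are open, path connected, cover \<open>M\<close>, and meet in an annulus. By the easy half of the
    theorem of Seifert and van Kampen the loops inside one of them generate
    (\<open>subgroup_IMG_eq_carrier\<close>). A loop in the first set is homotopic to one in the upper
    hemisphere, by a radial retraction (\<open>collar_loop_homotopic\<close>).

  Equalities in iterated monodromy groups are proved by comparing the actions on the fibres
  (\<open>img_class_eq_iff\<close>). Transport of fibres along paths is strictly functorial under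
  concatenation, so no homotopies between rebracketed paths are needed.
\<close>

section \<open>The fundamental group\<close>

lemma comp_linepath_0_1: "p \<circ> linepath 0 (1::real) = p"
  by (simp add: linepath_def fun_eq_iff)

text \<open>The paths below take values in an arbitrary topological space, where line segments are not
  available; the homotopies are images of homotopies of paths in the unit interval.\<close>

lemma homotopic_paths_join_const:
  assumes "path p" "path_image p \<subseteq> S" "pathfinish p = x"
  shows "homotopic_paths S (p +++ (\<lambda>_. x)) p"
proof -
  have "homotopic_paths {0..1::real} (linepath 0 1 +++ linepath 1 1) (linepath 0 1)"
    by (rule homotopic_paths_rid') (auto simp: path_image_linepath closed_segment_eq_real_ivl)
  then have "homotopic_paths S (p \<circ> (linepath 0 1 +++ linepath 1 1)) (p \<circ> linepath 0 1)"
    by (rule homotopic_paths_continuous_image) (use assms in \<open>auto simp: path_def path_image_def\<close>)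
  moreover have "p \<circ> linepath 1 1 = (\<lambda>_. x)"
    using assms(3) by (simp add: linepath_def fun_eq_iff pathfinish_def)
  ultimately show ?thesis
    by (simp add: path_compose_join comp_linepath_0_1)
qed

lemma homotopic_paths_join_reversepath:
  assumes "path p" "path_image p \<subseteq> S" "pathstart p = x"
  shows "homotopic_paths S (p +++ reversepath p) (\<lambda>_. x)"
proof -
  have "homotopic_paths {0..1::real} (linepath 0 1 +++ reversepath (linepath 0 1)) (linepath 0 0)"
    using homotopic_paths_rinv[of "linepath 0 1" "{0..1::real}"]
    by (auto simp: path_image_linepath closed_segment_eq_real_ivl)
  then have "homotopic_paths S (p \<circ> (linepath 0 1 +++ linepath 1 0)) (p \<circ> linepath 0 0)"
    by (intro homotopic_paths_continuous_image[of "{0..1}"])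
       (use assms in \<open>auto simp: path_def path_image_def\<close>)
  moreover have "p \<circ> linepath 0 0 = (\<lambda>_. x)" "p \<circ> linepath 1 0 = reversepath p"
    using assms(3) by (simp_all add: linepath_def fun_eq_iff pathstart_def reversepath_def)
  ultimately show ?thesis
    by (simp add: path_compose_join comp_linepath_0_1)
qed

lemma loops_atD:
  assumes "\<gamma> \<in> loops_at M t"
  shows "path \<gamma>" "path_image \<gamma> \<subseteq> M" "pathstart \<gamma> = t" "pathfinish \<gamma> = t"
  using assms by (auto simp: loops_at_def)

lemma loops_at_join: "\<alpha> \<in> loops_at M t \<Longrightarrow> \<beta> \<in> loops_at M t \<Longrightarrow> \<alpha> +++ \<beta> \<in> loops_at M t"
  by (auto simp: loops_at_def path_image_join)

lemma loops_at_reversepath: "\<alpha> \<in> loops_at M t \<Longrightarrow> reversepath \<alpha> \<in> loops_at M t"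
  by (auto simp: loops_at_def)

lemma loops_at_const: "t \<in> M \<Longrightarrow> (\<lambda>_. t) \<in> loops_at M t"
  by (auto simp: loops_at_def path_def path_image_def pathstart_def pathfinish_def)

lemma homotopic_paths_loops_at:
  assumes "homotopic_paths M \<alpha> \<beta>" "\<alpha> \<in> loops_at M t"
  shows "\<beta> \<in> loops_at M t"
  using homotopic_paths_imp_path[OF assms(1)] homotopic_paths_imp_subset[OF assms(1)]
    homotopic_paths_imp_pathstart[OF assms(1)] homotopic_paths_imp_pathfinish[OF assms(1)] assms(2)
  by (simp add: loops_at_def)

lemma loop_class_eq_iff:
  assumes "\<gamma> \<in> loops_at M t"
  shows "loop_class M \<gamma> = loop_class M \<delta> \<longleftrightarrow> homotopic_paths M \<gamma> \<delta>"
proof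
  assume "loop_class M \<gamma> = loop_class M \<delta>"
  moreover have "\<gamma> \<in> loop_class M \<gamma>"
    using assms by (auto simp: loop_class_def loops_at_def)
  ultimately show "homotopic_paths M \<gamma> \<delta>"
    by (auto simp: loop_class_def homotopic_paths_sym)
next
  assume "homotopic_paths M \<gamma> \<delta>"
  then show "loop_class M \<gamma> = loop_class M \<delta>"
    unfolding loop_class_def using homotopic_paths_sym homotopic_paths_trans by blast
qed

lemma carrier_fundamental_group [simp]:
  "carrier (fundamental_group M t) = loop_class M ` loops_at M t"
  by (simp add: fundamental_group_def)

lemma one_fundamental_group: "\<one>\<^bsub>fundamental_group M t\<^esub> = loop_class M (\<lambda>_. t)"
  by (simp add: fundamental_group_def)

lemma mult_fundamental_group:
  assumes "\<alpha> \<in> loops_at M t" "\<beta> \<in> loops_at M t"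
  shows "loop_class M \<alpha> \<otimes>\<^bsub>fundamental_group M t\<^esub> loop_class M \<beta> = loop_class M (\<beta> +++ \<alpha>)"
proof -
  have "loop_class M (\<beta>' +++ \<alpha>') = loop_class M (\<beta> +++ \<alpha>)"
    if "\<alpha>' \<in> loop_class M \<alpha>" "\<beta>' \<in> loop_class M \<beta>" for \<alpha>' \<beta>'
  proof -
    have "homotopic_paths M (\<beta> +++ \<alpha>) (\<beta>' +++ \<alpha>')"
      using that assms by (intro homotopic_paths_join) (auto simp: loop_class_def loops_at_def)
    then show ?thesis
      using assms loop_class_eq_iff loops_at_join by metis
  qed
  moreover have "\<alpha> \<in> loop_class M \<alpha>" "\<beta> \<in> loop_class M \<beta>"
    using assms by (auto simp: loop_class_def loops_at_def)
  ultimately have "(\<Union>\<alpha>'\<in>loop_class M \<alpha>. \<Union>\<beta>'\<in>loop_class M \<beta>. loop_class M (\<beta>' +++ \<alpha>'))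
      = loop_class M (\<beta> +++ \<alpha>)"
    by (metis (no_types, lifting) SUP_eq_const empty_iff)
  then show ?thesis
    by (simp add: fundamental_group_def)
qed

lemma group_fundamental_group:
  assumes "t \<in> M"
  shows "group (fundamental_group M t)"
proof (rule groupI, goal_cases)
  case (1 x y)
  then show ?case
    by (auto simp: mult_fundamental_group loops_at_join)
next
  case 2
  then show ?case
    using assms by (auto simp: one_fundamental_group loops_at_const)
next
  case (3 x y z)
  then obtain a b c where abc: "x = loop_class M a" "y = loop_class M b" "z = loop_class M c"
    "a \<in> loops_at M t" "b \<in> loops_at M t" "c \<in> loops_at M t"
    by auto
  have "homotopic_paths M (c +++ (b +++ a)) ((c +++ b) +++ a)"
    using abc by (intro homotopic_paths_assoc) (auto simp: loops_at_def)
  then show ?case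
    using abc loop_class_eq_iff[OF loops_at_join, of c M t "b +++ a"]
    by (simp add: mult_fundamental_group loops_at_join)
next
  case (4 x)
  then obtain a where a: "x = loop_class M a" "a \<in> loops_at M t"
    by auto
  have "homotopic_paths M (a +++ (\<lambda>_. t)) a"
    using a by (intro homotopic_paths_join_const) (auto simp: loops_at_def)
  then show ?case
    using a loop_class_eq_iff[OF loops_at_join, of a M t "\<lambda>_. t"] loops_at_const[OF assms]
    by (simp add: mult_fundamental_group one_fundamental_group)
next
  case (5 x)
  then obtain a where a: "x = loop_class M a" "a \<in> loops_at M t"
    by auto
  have "homotopic_paths M (a +++ reversepath a) (\<lambda>_. t)"
    using a by (intro homotopic_paths_join_reversepath) (auto simp: loops_at_def)
  then have "loop_class M (reversepath a) \<otimes>\<^bsub>fundamental_group M t\<^esub> x = \<one>\<^bsub>fundamental_group M t\<^esub>"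
    using a loop_class_eq_iff[OF loops_at_join, of a M t "reversepath a"] loops_at_reversepath[OF a(2)]
    by (simp add: mult_fundamental_group one_fundamental_group)
  then show ?case
    using a loops_at_reversepath[OF a(2)] by auto
qed

section \<open>Monodromy of systems with path lifting\<close>

text \<open>A partial map \<open>p\<close> from \<open>M1\<close> to \<open>M\<close>, all of whose iterates have path lifting, with the end point
  of a lift depending only on its initial point and on the homotopy class of the path.\<close>

locale path_lifting =
  fixes p :: "'a::topological_space \<Rightarrow> 'a" and M1 M :: "'a set"
  assumes lift_exists:
      "\<And>\<gamma> n x. \<lbrakk>path \<gamma>; path_image \<gamma> \<subseteq> M; x \<in> iter_fiber p M1 M n (pathstart \<gamma>)\<rbrakk>
        \<Longrightarrow> \<exists>g. is_iter_lift p M1 M n \<gamma> g \<and> pathstart g = x"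
    and lift_end_unique:
      "\<And>\<gamma> \<gamma>' n g g'. \<lbrakk>homotopic_paths M \<gamma> \<gamma>'; is_iter_lift p M1 M n \<gamma> g; is_iter_lift p M1 M n \<gamma>' g';
         pathstart g = pathstart g'\<rbrakk> \<Longrightarrow> pathfinish g = pathfinish g'"
begin

abbreviation "fib \<equiv> iter_fiber p M1 M"
abbreviation "lift \<equiv> is_iter_lift p M1 M"
abbreviation "pi1 \<equiv> fundamental_group M"
abbreviation "ker \<equiv> monodromy_kernel p M1 M"

text \<open>The end point of the lift of \<open>\<gamma>\<close> under the \<open>n\<close>-th iterate that starts at \<open>x\<close>; the path
  \<open>\<gamma>\<close> need not be closed.\<close>

definition transport :: "nat \<Rightarrow> (real \<Rightarrow> 'a) \<Rightarrow> 'a \<Rightarrow> 'a" where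
  "transport n \<gamma> x = (SOME y. \<exists>g. lift n \<gamma> g \<and> pathstart g = x \<and> pathfinish g = y)"

lemma transport_eqI:
  assumes "path \<gamma>" "path_image \<gamma> \<subseteq> M" "lift n \<gamma> g" "pathstart g = x" "pathfinish g = y"
  shows "transport n \<gamma> x = y"
  unfolding transport_def
proof (rule some_equality)
  show "\<exists>g. lift n \<gamma> g \<and> pathstart g = x \<and> pathfinish g = y"
    using assms by blast
  have "homotopic_paths M \<gamma> \<gamma>"
    using assms by simp
  then show "z = y" if "\<exists>g. lift n \<gamma> g \<and> pathstart g = x \<and> pathfinish g = z" for z
    using that assms lift_end_unique by metis
qed

lemma transport_lift:
  assumes "path \<gamma>" "path_image \<gamma> \<subseteq> M" "x \<in> fib n (pathstart \<gamma>)"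
  obtains g where "lift n \<gamma> g" "pathstart g = x" "pathfinish g = transport n \<gamma> x"
  using assms lift_exists transport_eqI by metis

lemma transport_in_fiber:
  assumes "path \<gamma>" "path_image \<gamma> \<subseteq> M" "x \<in> fib n (pathstart \<gamma>)"
  shows "transport n \<gamma> x \<in> fib n (pathfinish \<gamma>)"
proof -
  obtain g where "lift n \<gamma> g" "pathfinish g = transport n \<gamma> x"
    using transport_lift assms by metis
  then have "pathfinish g \<in> iter_dom p M1 M n" "(p ^^ n) (pathfinish g) = pathfinish \<gamma>"
    "pathfinish g = transport n \<gamma> x"
    unfolding is_iter_lift_def using pathfinish_in_path_image[of g]
    by (auto simp: pathfinish_def simp del: pathfinish_in_path_image dest: bspec[of _ _ 1])
  then show ?thesis
    by (simp add: iter_fiber_def)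
qed

lemma transport_homotopic:
  assumes "homotopic_paths M \<gamma> \<delta>" "x \<in> fib n (pathstart \<gamma>)"
  shows "transport n \<gamma> x = transport n \<delta> x"
proof -
  note h = homotopic_paths_imp_path[OF assms(1)] homotopic_paths_imp_subset[OF assms(1)]
    homotopic_paths_imp_pathstart[OF assms(1)]
  obtain g where g: "lift n \<gamma> g" "pathstart g = x" "pathfinish g = transport n \<gamma> x"
    using transport_lift[of \<gamma> x n] assms(2) h by blast
  obtain g' where g': "lift n \<delta> g'" "pathstart g' = x" "pathfinish g' = transport n \<delta> x"
    using transport_lift[of \<delta> x n] assms(2) h by auto
  show ?thesis
    using lift_end_unique[OF assms(1) g(1) g'(1)] g g' by simp
qed

lemma lift_join:
  assumes "lift n \<gamma> g" "lift n \<delta> h" "pathfinish g = pathstart h"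
  shows "lift n (\<gamma> +++ \<delta>) (g +++ h)"
proof -
  have "(p ^^ n) ((g +++ h) s) = (\<gamma> +++ \<delta>) s" if "s \<in> {0..1}" for s
    using assms that by (auto simp: is_iter_lift_def joinpaths_def)
  moreover have "path (g +++ h)" "path_image (g +++ h) \<subseteq> iter_dom p M1 M n"
    using assms by (auto simp: is_iter_lift_def path_image_join)
  ultimately show ?thesis
    by (simp add: is_iter_lift_def)
qed

lemma transport_join:
  assumes "path \<gamma>" "path_image \<gamma> \<subseteq> M" "path \<delta>" "path_image \<delta> \<subseteq> M" "pathfinish \<gamma> = pathstart \<delta>"
    and "x \<in> fib n (pathstart \<gamma>)"
  shows "transport n (\<gamma> +++ \<delta>) x = transport n \<delta> (transport n \<gamma> x)"
proof -
  obtain g where g: "lift n \<gamma> g" "pathstart g = x" "pathfinish g = transport n \<gamma> x"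
    using transport_lift[of \<gamma> x n] assms by blast
  have "transport n \<gamma> x \<in> fib n (pathstart \<delta>)"
    using transport_in_fiber[OF assms(1,2,6)] assms(5) by simp
  then obtain h where h: "lift n \<delta> h" "pathstart h = transport n \<gamma> x"
    "pathfinish h = transport n \<delta> (transport n \<gamma> x)"
    using transport_lift[of \<delta> _ n] assms by blast
  show ?thesis
    using assms lift_join[OF g(1) h(1)] g h
    by (intro transport_eqI[where g = "g +++ h"]) (auto simp: path_image_join)
qed

lemma transport_reversepath:
  assumes "path \<gamma>" "path_image \<gamma> \<subseteq> M" "x \<in> fib n (pathstart \<gamma>)"
  shows "transport n (reversepath \<gamma>) (transport n \<gamma> x) = x"
proof -
  obtain g where g: "lift n \<gamma> g" "pathstart g = x" "pathfinish g = transport n \<gamma> x"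
    using transport_lift[of \<gamma> x n] assms by blast
  have "lift n (reversepath \<gamma>) (reversepath g)"
    using g(1) unfolding is_iter_lift_def path_reversepath path_image_reversepath
    by (simp add: reversepath_def)
  then show ?thesis
    using assms g by (intro transport_eqI[where g = "reversepath g"]) auto
qed

lemma transport_const:
  assumes "t \<in> M" "x \<in> fib n t"
  shows "transport n (\<lambda>_. t) x = x"
proof -
  have "lift n (\<lambda>_. t) (\<lambda>_. x)"
    using assms by (auto simp: is_iter_lift_def iter_fiber_def path_def path_image_def)
  then show ?thesis
    using assms
    by (intro transport_eqI[where g = "\<lambda>_. x"])
       (auto simp: path_def path_image_def pathstart_def pathfinish_def)
qed

lemma monodromy_act_loop_class:
  assumes "\<gamma> \<in> loops_at M t" "x \<in> fib n t"
  shows "monodromy_act p M1 M n (loop_class M \<gamma>) x = transport n \<gamma> x"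
  unfolding monodromy_act_def
proof (rule the_equality)
  note \<gamma> = loops_atD[OF assms(1)]
  obtain g where "lift n \<gamma> g" "pathstart g = x" "pathfinish g = transport n \<gamma> x"
    using transport_lift[of \<gamma> x n] \<gamma> assms by blast
  moreover have "\<gamma> \<in> loop_class M \<gamma>"
    using \<gamma> by (simp add: loop_class_def)
  ultimately show "\<exists>\<gamma>'\<in>loop_class M \<gamma>. \<exists>g. lift n \<gamma>' g \<and> pathstart g = x \<and> pathfinish g = transport n \<gamma> x"
    by blast
  fix y
  assume "\<exists>\<gamma>'\<in>loop_class M \<gamma>. \<exists>g. lift n \<gamma>' g \<and> pathstart g = x \<and> pathfinish g = y"
  then obtain \<gamma>' g where g: "homotopic_paths M \<gamma> \<gamma>'" "lift n \<gamma>' g" "pathstart g = x" "pathfinish g = y"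
    by (auto simp: loop_class_def)
  have "transport n \<gamma>' x = y"
    using g homotopic_paths_imp_path homotopic_paths_imp_subset by (intro transport_eqI) blast+
  then show "y = transport n \<gamma> x"
    using transport_homotopic[OF g(1)] assms \<gamma> by simp
qed

lemma loop_class_in_kernel_iff:
  assumes "\<gamma> \<in> loops_at M t"
  shows "loop_class M \<gamma> \<in> ker t \<longleftrightarrow> (\<forall>n. \<forall>x\<in>fib n t. transport n \<gamma> x = x)"
  using assms monodromy_act_loop_class[OF assms] by (auto simp: monodromy_kernel_def)

lemma inv_fundamental_group:
  assumes "\<gamma> \<in> loops_at M t"
  shows "inv\<^bsub>pi1 t\<^esub> (loop_class M \<gamma>) = loop_class M (reversepath \<gamma>)"
proof -
  have "t \<in> M"
    using loops_atD[OF assms] pathstart_in_path_image by blast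
  then interpret group "pi1 t"
    by (rule group_fundamental_group)
  have "homotopic_paths M (\<gamma> +++ reversepath \<gamma>) (\<lambda>_. t)"
    using loops_atD[OF assms] by (intro homotopic_paths_join_reversepath)
  then have "loop_class M (reversepath \<gamma>) \<otimes>\<^bsub>pi1 t\<^esub> loop_class M \<gamma> = \<one>\<^bsub>pi1 t\<^esub>"
    using assms loop_class_eq_iff[OF loops_at_join, of \<gamma> M t "reversepath \<gamma>"] loops_at_reversepath[OF assms]
    by (simp add: mult_fundamental_group one_fundamental_group)
  then show ?thesis
    using assms loops_at_reversepath[OF assms] by (intro inv_equality) auto
qed

lemma transport_loop_in_fiber:
  "\<gamma> \<in> loops_at M t \<Longrightarrow> x \<in> fib n t \<Longrightarrow> transport n \<gamma> x \<in> fib n t"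
  using transport_in_fiber[of \<gamma> x n] by (simp add: loops_atD)

lemma transport_join_loops:
  "\<gamma> \<in> loops_at M t \<Longrightarrow> \<delta> \<in> loops_at M t \<Longrightarrow> x \<in> fib n t
    \<Longrightarrow> transport n (\<gamma> +++ \<delta>) x = transport n \<delta> (transport n \<gamma> x)"
  using transport_join[of \<gamma> \<delta> x n] by (simp add: loops_atD)

lemma transport_reversepath_loop:
  assumes "\<gamma> \<in> loops_at M t" "x \<in> fib n t"
  shows "transport n (reversepath \<gamma>) (transport n \<gamma> x) = x"
    "transport n \<gamma> (transport n (reversepath \<gamma>) x) = x"
  using transport_reversepath[of \<gamma> x n] transport_reversepath[of "reversepath \<gamma>" x n] assms
  by (simp_all add: loops_atD)

text \<open>A conjugate of a loop that acts trivially acts trivially, by functoriality of transport.\<close>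

lemma kernel_normal:
  assumes "t \<in> M"
  shows "ker t \<lhd> pi1 t"
proof -
  interpret group "pi1 t"
    using assms by (rule group_fundamental_group)
  have rep: "\<exists>\<gamma>\<in>loops_at M t. A = loop_class M \<gamma>" if "A \<in> ker t" for A
    using that by (auto simp: monodromy_kernel_def)
  have sub: "subgroup (ker t) (pi1 t)"
  proof (rule subgroupI)
    show "ker t \<subseteq> carrier (pi1 t)"
      by (auto simp: monodromy_kernel_def)
    have "loop_class M (\<lambda>_. t) \<in> ker t"
      using assms by (simp add: loop_class_in_kernel_iff loops_at_const transport_const)
    then show "ker t \<noteq> {}"
      by blast
  next
    fix A assume "A \<in> ker t"
    then obtain \<gamma> where \<gamma>: "\<gamma> \<in> loops_at M t" "A = loop_class M \<gamma>" "\<forall>n. \<forall>x\<in>fib n t. transport n \<gamma> x = x"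
      using rep loop_class_in_kernel_iff by blast
    then show "inv\<^bsub>pi1 t\<^esub> A \<in> ker t"
      using loop_class_in_kernel_iff[OF loops_at_reversepath[OF \<gamma>(1)]] transport_reversepath_loop(1)[OF \<gamma>(1)]
      by (auto simp: inv_fundamental_group)
  next
    fix A B assume "A \<in> ker t" "B \<in> ker t"
    then obtain \<gamma> \<delta> where \<gamma>: "\<gamma> \<in> loops_at M t" "A = loop_class M \<gamma>" "\<forall>n. \<forall>x\<in>fib n t. transport n \<gamma> x = x"
      and \<delta>: "\<delta> \<in> loops_at M t" "B = loop_class M \<delta>" "\<forall>n. \<forall>x\<in>fib n t. transport n \<delta> x = x"
      using rep loop_class_in_kernel_iff by metis
    then show "A \<otimes>\<^bsub>pi1 t\<^esub> B \<in> ker t"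
      using loop_class_in_kernel_iff[OF loops_at_join[OF \<delta>(1) \<gamma>(1)]] transport_join_loops
      by (auto simp: mult_fundamental_group)
  qed
  show ?thesis
  proof (rule normal_invI[OF sub])
    fix X A assume "X \<in> carrier (pi1 t)" "A \<in> ker t"
    then obtain \<gamma> \<delta> where \<gamma>: "\<gamma> \<in> loops_at M t" "A = loop_class M \<gamma>" "\<forall>n. \<forall>x\<in>fib n t. transport n \<gamma> x = x"
      and \<delta>: "\<delta> \<in> loops_at M t" "X = loop_class M \<delta>"
      using rep loop_class_in_kernel_iff by (auto; metis)
    let ?e = "reversepath \<delta> +++ (\<gamma> +++ \<delta>)"
    note [simp] = \<gamma>(1) \<delta>(1) loops_at_reversepath loops_at_join
    have "transport n ?e x = x" if x: "x \<in> fib n t" for n x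
      using x \<gamma>(3)
      by (simp add: transport_join_loops[of _ t] transport_loop_in_fiber[of _ t]
          transport_reversepath_loop[of _ t])
    then show "X \<otimes>\<^bsub>pi1 t\<^esub> A \<otimes>\<^bsub>pi1 t\<^esub> inv\<^bsub>pi1 t\<^esub> X \<in> ker t"
      using loop_class_in_kernel_iff[of ?e t]
      by (simp add: \<gamma>(2) \<delta>(2) mult_fundamental_group inv_fundamental_group)
  qed
qed

text \<open>The element of the iterated monodromy group that a loop represents. Two loops represent the
  same element exactly when they act in the same way on all fibres (\<open>img_class_eq_iff\<close>).\<close>

definition img_class :: "'a \<Rightarrow> (real \<Rightarrow> 'a) \<Rightarrow> (real \<Rightarrow> 'a) set set" where
  "img_class t \<gamma> = ker t #>\<^bsub>pi1 t\<^esub> loop_class M \<gamma>"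

lemma carrier_IMG: "carrier (IMG p M1 M t) = img_class t ` loops_at M t"
  by (auto simp: IMG_def carrier_FactGroup img_class_def)

lemma group_IMG: "t \<in> M \<Longrightarrow> group (IMG p M1 M t)"
  unfolding IMG_def using kernel_normal normal.factorgroup_is_group by blast

lemma mult_img_class:
  assumes "\<alpha> \<in> loops_at M t" "\<beta> \<in> loops_at M t"
  shows "img_class t \<alpha> \<otimes>\<^bsub>IMG p M1 M t\<^esub> img_class t \<beta> = img_class t (\<beta> +++ \<alpha>)"
proof -
  have "t \<in> M"
    using loops_atD[OF assms(1)] pathstart_in_path_image by blast
  then interpret normal "ker t" "pi1 t"
    by (rule kernel_normal)
  show ?thesis
    using assms by (simp add: IMG_def img_class_def rcos_sum mult_fundamental_group)
qed

lemma img_class_eq_iff: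
  assumes "\<alpha> \<in> loops_at M t" "\<beta> \<in> loops_at M t"
  shows "img_class t \<alpha> = img_class t \<beta> \<longleftrightarrow> (\<forall>n. \<forall>x\<in>fib n t. transport n \<alpha> x = transport n \<beta> x)"
proof -
  have "t \<in> M"
    using loops_atD[OF assms(1)] pathstart_in_path_image by blast
  then interpret normal "ker t" "pi1 t"
    by (rule kernel_normal)
  note [simp] = assms loops_at_reversepath loops_at_join
  have "img_class t \<alpha> = img_class t \<beta> \<longleftrightarrow> loop_class M \<alpha> \<otimes>\<^bsub>pi1 t\<^esub> inv\<^bsub>pi1 t\<^esub> loop_class M \<beta> \<in> ker t"
  proof
    assume "img_class t \<alpha> = img_class t \<beta>"
    then have "loop_class M \<alpha> \<in> ker t #>\<^bsub>pi1 t\<^esub> loop_class M \<beta>"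
      unfolding img_class_def using rcos_self[of "loop_class M \<alpha>" "ker t"] subgroup_axioms by auto
    then show "loop_class M \<alpha> \<otimes>\<^bsub>pi1 t\<^esub> inv\<^bsub>pi1 t\<^esub> loop_class M \<beta> \<in> ker t"
      using rcos_module_imp[OF is_group, of "loop_class M \<beta>" "loop_class M \<alpha>"] by simp
  next
    assume "loop_class M \<alpha> \<otimes>\<^bsub>pi1 t\<^esub> inv\<^bsub>pi1 t\<^esub> loop_class M \<beta> \<in> ker t"
    then have "loop_class M \<alpha> \<in> ker t #>\<^bsub>pi1 t\<^esub> loop_class M \<beta>"
      using rcos_module_rev[OF is_group, of "loop_class M \<beta>" "loop_class M \<alpha>"] by simp
    then show "img_class t \<alpha> = img_class t \<beta>"
      unfolding img_class_def using repr_independence[of "loop_class M \<alpha>" "ker t" "loop_class M \<beta>"] subgroup_axioms by simp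
  qed
  also have "\<dots> \<longleftrightarrow> (\<forall>n. \<forall>x\<in>fib n t. transport n (reversepath \<beta> +++ \<alpha>) x = x)"
    by (simp add: inv_fundamental_group mult_fundamental_group loop_class_in_kernel_iff)
  also have "\<dots> \<longleftrightarrow> (\<forall>n. \<forall>x\<in>fib n t. transport n \<alpha> (transport n (reversepath \<beta>) x) = x)"
    by (simp add: transport_join_loops[of _ t])
  also have "\<dots> \<longleftrightarrow> (\<forall>n. \<forall>x\<in>fib n t. transport n \<alpha> x = transport n \<beta> x)"
    using transport_reversepath_loop[OF assms(2)] transport_loop_in_fiber[of _ t] assms loops_at_reversepath by metis
  finally show ?thesis .
qed

end

section \<open>Completely invariant parts\<close>

text \<open>An embedding \<open>\<iota>\<close> with inverse \<open>\<kappa>\<close> onto a completely invariant set, on which \<open>p\<close> acts as \<open>q\<close>.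
  Lifts for \<open>q\<close> are the lifts for \<open>p\<close> of paths in the image of \<open>\<iota>\<close>.\<close>

locale invariant_part = path_lifting p M1 M
  for p :: "'a::topological_space \<Rightarrow> 'a" and M1 M :: "'a set" +
  fixes q :: "'b::topological_space \<Rightarrow> 'b" and \<iota> :: "'b \<Rightarrow> 'a" and \<kappa> :: "'a \<Rightarrow> 'b"
  assumes homeo: "homeomorphism UNIV (range \<iota>) \<iota> \<kappa>"
    and semiconj: "p (\<iota> z) = \<iota> (q z)"
    and backward_invariant: "p x \<in> range \<iota> \<Longrightarrow> x \<in> range \<iota>"
begin

abbreviation "N \<equiv> \<iota> -` M"
abbreviation "N1 \<equiv> \<iota> -` M1"

lemma \<kappa>_\<iota> [simp]: "\<kappa> (\<iota> z) = z"
  using homeo by (simp add: homeomorphism_def)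

lemma \<iota>_eq_iff [simp]: "\<iota> z = \<iota> w \<longleftrightarrow> z = w"
  by (metis \<kappa>_\<iota>)

lemma continuous_\<iota>: "continuous_on A \<iota>"
  using homeo continuous_on_subset unfolding homeomorphism_def by blast

lemma semiconj_iterate: "(p ^^ n) (\<iota> z) = \<iota> ((q ^^ n) z)"
  by (induction n) (simp_all add: semiconj)

lemma backward_invariant_iterate: "(p ^^ n) x \<in> range \<iota> \<Longrightarrow> x \<in> range \<iota>"
proof (induction n)
  case (Suc n)
  then show ?case
    using backward_invariant[of "(p ^^ n) x"] by simp
qed simp

lemma iter_dom_part: "iter_dom q N1 N n = \<iota> -` iter_dom p M1 M n"
  by (induction n) (auto simp: semiconj)

lemma iter_fiber_part: "x \<in> iter_fiber q N1 N n t \<longleftrightarrow> \<iota> x \<in> fib n (\<iota> t)"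
  by (auto simp: iter_fiber_def iter_dom_part semiconj_iterate)

lemma fiber_in_part: "x \<in> fib n (\<iota> t) \<Longrightarrow> x = \<iota> (\<kappa> x)"
  using backward_invariant_iterate[of n x] by (auto simp: iter_fiber_def)

lemma lift_part:
  assumes "is_iter_lift q N1 N n \<gamma> g"
  shows "lift n (\<iota> \<circ> \<gamma>) (\<iota> \<circ> g)"
  using assms unfolding is_iter_lift_def iter_dom_part
  by (auto simp: semiconj_iterate path_image_compose intro!: path_continuous_image continuous_\<iota>)

lemma lift_part_obtain:
  assumes "lift n (\<iota> \<circ> \<gamma>) g"
  shows "is_iter_lift q N1 N n \<gamma> (\<kappa> \<circ> g)" "\<And>s. s \<in> {0..1} \<Longrightarrow> g s = \<iota> (\<kappa> (g s))"
proof -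
  have g: "path g" "path_image g \<subseteq> iter_dom p M1 M n" "\<And>s. s \<in> {0..1} \<Longrightarrow> (p ^^ n) (g s) = \<iota> (\<gamma> s)"
    using assms by (auto simp: is_iter_lift_def)
  show in_part: "g s = \<iota> (\<kappa> (g s))" if "s \<in> {0..1}" for s
    using g(3)[OF that] backward_invariant_iterate[of n "g s"] by auto
  then have "path_image g \<subseteq> range \<iota>"
    unfolding path_image_def by (metis image_subsetI rangeI)
  then have "path (\<kappa> \<circ> g)"
    using g(1) homeo continuous_on_subset unfolding homeomorphism_def
    by (intro path_continuous_image) blast+
  moreover have "(q ^^ n) (\<kappa> (g s)) = \<gamma> s" if "s \<in> {0..1}" for s
    using g(3)[OF that] in_part[OF that] by (metis \<kappa>_\<iota> semiconj_iterate)
  moreover have "\<iota> (\<kappa> (g s)) \<in> iter_dom p M1 M n" if "s \<in> {0..1}" for s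
    using g(2) in_part[OF that] that by (auto simp: path_image_def)
  ultimately show "is_iter_lift q N1 N n \<gamma> (\<kappa> \<circ> g)"
    by (auto simp: is_iter_lift_def iter_dom_part path_image_def)
qed

lemma path_part: "path \<gamma> \<Longrightarrow> path (\<iota> \<circ> \<gamma>)"
  by (intro path_continuous_image continuous_\<iota>)

lemma path_image_part: "path_image \<gamma> \<subseteq> N \<Longrightarrow> path_image (\<iota> \<circ> \<gamma>) \<subseteq> M"
  by (auto simp: path_image_compose)

lemma homotopic_part:
  assumes "homotopic_paths N \<gamma> \<delta>"
  shows "homotopic_paths M (\<iota> \<circ> \<gamma>) (\<iota> \<circ> \<delta>)"
  using assms by (rule homotopic_paths_continuous_image) (auto intro: continuous_\<iota>)

sublocale part: path_lifting q N1 N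
proof
  fix \<gamma> :: "real \<Rightarrow> 'b" and n x
  assume \<gamma>: "path \<gamma>" "path_image \<gamma> \<subseteq> N" and x: "x \<in> iter_fiber q N1 N n (pathstart \<gamma>)"
  have "\<iota> x \<in> fib n (pathstart (\<iota> \<circ> \<gamma>))"
    using x by (simp add: iter_fiber_part pathstart_compose)
  then obtain g where g: "lift n (\<iota> \<circ> \<gamma>) g" "pathstart g = \<iota> x"
    using lift_exists[OF path_part[OF \<gamma>(1)] path_image_part[OF \<gamma>(2)]] by blast
  then have "pathstart (\<kappa> \<circ> g) = x"
    by (simp add: pathstart_compose)
  then show "\<exists>g. is_iter_lift q N1 N n \<gamma> g \<and> pathstart g = x"
    using lift_part_obtain[OF g(1)] by blast
next
  fix \<gamma> \<gamma>' :: "real \<Rightarrow> 'b" and n g g'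
  assume "homotopic_paths N \<gamma> \<gamma>'" "is_iter_lift q N1 N n \<gamma> g" "is_iter_lift q N1 N n \<gamma>' g'"
    "pathstart g = pathstart g'"
  then show "pathfinish g = pathfinish g'"
    using lift_end_unique[OF homotopic_part lift_part lift_part, of \<gamma> \<gamma>' n g g']
    by (simp add: pathstart_compose pathfinish_compose)
qed

lemma transport_part:
  assumes "path \<gamma>" "path_image \<gamma> \<subseteq> N" "x \<in> iter_fiber q N1 N n (pathstart \<gamma>)"
  shows "transport n (\<iota> \<circ> \<gamma>) (\<iota> x) = \<iota> (part.transport n \<gamma> x)"
proof -
  obtain g where g: "is_iter_lift q N1 N n \<gamma> g" "pathstart g = x" "pathfinish g = part.transport n \<gamma> x"
    using part.transport_lift[OF assms] by blast
  show ?thesis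
    using path_part[OF assms(1)] path_image_part[OF assms(2)] lift_part[OF g(1)] g(2,3)
    by (intro transport_eqI[where g = "\<iota> \<circ> g"]) (auto simp: pathstart_compose pathfinish_compose)
qed

text \<open>The image of a loop \<open>\<gamma>\<close> at \<open>s\<close>, moved by a path \<open>\<beta>\<close> that ends at \<open>\<iota> s\<close> to the initial point of \<open>\<beta>\<close>.\<close>

definition conj_loop :: "(real \<Rightarrow> 'a) \<Rightarrow> (real \<Rightarrow> 'b) \<Rightarrow> real \<Rightarrow> 'a" where
  "conj_loop \<beta> \<gamma> = \<beta> +++ ((\<iota> \<circ> \<gamma>) +++ reversepath \<beta>)"

context
  fixes \<beta> t s
  assumes \<beta>: "path \<beta>" "path_image \<beta> \<subseteq> M" "pathstart \<beta> = t" "pathfinish \<beta> = \<iota> s"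
begin

lemma conj_loop_in:
  assumes "\<gamma> \<in> loops_at N s"
  shows "conj_loop \<beta> \<gamma> \<in> loops_at M t"
  using \<beta> loops_atD[OF assms] path_part[of \<gamma>] path_image_part[of \<gamma>]
  by (auto simp: loops_at_def conj_loop_def path_image_join pathstart_compose pathfinish_compose)

lemma transport_conj_loop:
  assumes "\<gamma> \<in> loops_at N s" "x \<in> fib n t"
  shows "transport n (conj_loop \<beta> \<gamma>) x
    = transport n (reversepath \<beta>) (\<iota> (part.transport n \<gamma> (\<kappa> (transport n \<beta> x))))"
proof -
  note \<gamma> = loops_atD[OF assms(1)]
  let ?y = "transport n \<beta> x"
  have y: "?y \<in> fib n (\<iota> s)"
    using transport_in_fiber[of \<beta> x n] \<beta> assms by simp
  then have ky: "?y = \<iota> (\<kappa> ?y)"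
    by (rule fiber_in_part)
  then have "\<kappa> ?y \<in> iter_fiber q N1 N n s"
    using y by (simp add: iter_fiber_part)
  then have z: "transport n (\<iota> \<circ> \<gamma>) ?y = \<iota> (part.transport n \<gamma> (\<kappa> ?y))"
    using transport_part[of \<gamma> "\<kappa> ?y" n] \<gamma> ky by simp
  have "transport n (conj_loop \<beta> \<gamma>) x = transport n ((\<iota> \<circ> \<gamma>) +++ reversepath \<beta>) ?y"
    unfolding conj_loop_def
    using \<beta> \<gamma> path_part[of \<gamma>] path_image_part[of \<gamma>] assms
    by (intro transport_join) (auto simp: path_image_join pathstart_compose pathfinish_compose)
  also have "\<dots> = transport n (reversepath \<beta>) (transport n (\<iota> \<circ> \<gamma>) ?y)"
    using \<beta> \<gamma> path_part[of \<gamma>] path_image_part[of \<gamma>] y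
    by (intro transport_join) (auto simp: pathstart_compose pathfinish_compose)
  finally show ?thesis
    by (simp add: z)
qed

text \<open>Transport along \<open>\<beta>\<close> is a bijection from the fibre of \<open>p\<close> over \<open>t\<close> onto the fibre of \<open>q\<close> over \<open>s\<close>.\<close>

lemma fiber_correspondence:
  shows "x \<in> fib n t \<Longrightarrow> \<kappa> (transport n \<beta> x) \<in> iter_fiber q N1 N n s"
    and "x \<in> fib n t \<Longrightarrow> \<iota> (\<kappa> (transport n \<beta> x)) = transport n \<beta> x"
    and "y \<in> iter_fiber q N1 N n s \<Longrightarrow> transport n (reversepath \<beta>) (\<iota> y) \<in> fib n t"
    and "y \<in> iter_fiber q N1 N n s \<Longrightarrow> transport n \<beta> (transport n (reversepath \<beta>) (\<iota> y)) = \<iota> y"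
    and "x \<in> fib n t \<Longrightarrow> transport n (reversepath \<beta>) (transport n \<beta> x) = x"
proof -
  show *: "\<iota> (\<kappa> (transport n \<beta> x)) = transport n \<beta> x" if "x \<in> fib n t"
    using transport_in_fiber[of \<beta> x n] \<beta> that fiber_in_part[of _ n s] by auto
  show "\<kappa> (transport n \<beta> x) \<in> iter_fiber q N1 N n s" if "x \<in> fib n t"
    using transport_in_fiber[of \<beta> x n] \<beta> that *[OF that] by (simp add: iter_fiber_part)
  show "transport n (reversepath \<beta>) (transport n \<beta> x) = x" if "x \<in> fib n t"
    using transport_reversepath[of \<beta> x n] \<beta> that by simp
  assume "y \<in> iter_fiber q N1 N n s"
  then show "transport n (reversepath \<beta>) (\<iota> y) \<in> fib n t"
    "transport n \<beta> (transport n (reversepath \<beta>) (\<iota> y)) = \<iota> y"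
    using transport_in_fiber[of "reversepath \<beta>" "\<iota> y" n] \<beta>
      transport_reversepath[of "reversepath \<beta>" "\<iota> y" n] by (simp_all add: iter_fiber_part)
qed

text \<open>The map induced on iterated monodromy groups is well defined and injective.\<close>

lemma img_class_conj_loop_eq_iff:
  assumes "\<gamma> \<in> loops_at N s" "\<delta> \<in> loops_at N s"
  shows "img_class t (conj_loop \<beta> \<gamma>) = img_class t (conj_loop \<beta> \<delta>)
    \<longleftrightarrow> part.img_class s \<gamma> = part.img_class s \<delta>"
proof -
  note fc = fiber_correspondence
  have "img_class t (conj_loop \<beta> \<gamma>) = img_class t (conj_loop \<beta> \<delta>)
      \<longleftrightarrow> (\<forall>n. \<forall>x\<in>fib n t. transport n (conj_loop \<beta> \<gamma>) x = transport n (conj_loop \<beta> \<delta>) x)"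
    using conj_loop_in assms by (intro img_class_eq_iff)
  also have "\<dots> \<longleftrightarrow> (\<forall>n. \<forall>y\<in>iter_fiber q N1 N n s. part.transport n \<gamma> y = part.transport n \<delta> y)"
  proof (intro iff_allI iffI ballI)
    fix n y
    assume eq: "\<forall>x\<in>fib n t. transport n (conj_loop \<beta> \<gamma>) x = transport n (conj_loop \<beta> \<delta>) x"
      and y: "y \<in> iter_fiber q N1 N n s"
    let ?x = "transport n (reversepath \<beta>) (\<iota> y)"
    have x: "?x \<in> fib n t" "\<kappa> (transport n \<beta> ?x) = y"
      using fc y by auto
    then have "transport n (reversepath \<beta>) (\<iota> (part.transport n \<gamma> y))
        = transport n (reversepath \<beta>) (\<iota> (part.transport n \<delta> y))"
      using bspec[OF eq x(1)] by (simp add: transport_conj_loop assms)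
    moreover have "part.transport n \<gamma> y \<in> iter_fiber q N1 N n s" "part.transport n \<delta> y \<in> iter_fiber q N1 N n s"
      using part.transport_loop_in_fiber assms y by auto
    ultimately show "part.transport n \<gamma> y = part.transport n \<delta> y"
      using fc(4) by (metis \<iota>_eq_iff)
  next
    fix n x
    assume "\<forall>y\<in>iter_fiber q N1 N n s. part.transport n \<gamma> y = part.transport n \<delta> y" "x \<in> fib n t"
    then show "transport n (conj_loop \<beta> \<gamma>) x = transport n (conj_loop \<beta> \<delta>) x"
      using fc(1) assms by (simp add: transport_conj_loop)
  qed
  also have "\<dots> \<longleftrightarrow> part.img_class s \<gamma> = part.img_class s \<delta>"
    using part.img_class_eq_iff[OF assms] by simp
  finally show ?thesis .
qed

lemma img_class_conj_loop_join:
  assumes "\<gamma> \<in> loops_at N s" "\<delta> \<in> loops_at N s"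
  shows "img_class t (conj_loop \<beta> (\<gamma> +++ \<delta>)) = img_class t (conj_loop \<beta> \<gamma> +++ conj_loop \<beta> \<delta>)"
proof (subst img_class_eq_iff)
  show "conj_loop \<beta> (\<gamma> +++ \<delta>) \<in> loops_at M t" "conj_loop \<beta> \<gamma> +++ conj_loop \<beta> \<delta> \<in> loops_at M t"
    using assms by (simp_all add: conj_loop_in loops_at_join)
  show "\<forall>n. \<forall>x\<in>fib n t. transport n (conj_loop \<beta> (\<gamma> +++ \<delta>)) x = transport n (conj_loop \<beta> \<gamma> +++ conj_loop \<beta> \<delta>) x"
  proof (intro allI ballI)
    fix n x assume x: "x \<in> fib n t"
    let ?y = "\<kappa> (transport n \<beta> x)"
    let ?z = "part.transport n \<gamma> ?y"
    have y: "?y \<in> iter_fiber q N1 N n s"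
      using fiber_correspondence x by blast
    then have z: "?z \<in> iter_fiber q N1 N n s"
      using part.transport_loop_in_fiber assms by blast
    have "transport n (conj_loop \<beta> \<gamma> +++ conj_loop \<beta> \<delta>) x
        = transport n (conj_loop \<beta> \<delta>) (transport n (reversepath \<beta>) (\<iota> ?z))"
      using x assms by (simp add: transport_join_loops[of _ t] conj_loop_in transport_conj_loop)
    also have "\<dots> = transport n (reversepath \<beta>) (\<iota> (part.transport n \<delta> ?z))"
      using z assms fiber_correspondence(3,4) by (simp add: transport_conj_loop)
    finally show "transport n (conj_loop \<beta> (\<gamma> +++ \<delta>)) x = transport n (conj_loop \<beta> \<gamma> +++ conj_loop \<beta> \<delta>) x"
      using x y assms by (simp add: transport_conj_loop loops_at_join part.transport_join_loops[of _ s])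
  qed
qed

theorem IMG_part_embeds:
  defines "H \<equiv> (\<lambda>\<gamma>. img_class t (conj_loop \<beta> \<gamma>)) ` loops_at N s"
  shows "subgroup H (IMG p M1 M t)"
    and "(IMG p M1 M t)\<lparr>carrier := H\<rparr> \<cong> IMG q N1 N s"
proof -
  have tM: "t \<in> M" and sN: "s \<in> N"
    using \<beta> pathstart_in_path_image[of \<beta>] pathfinish_in_path_image[of \<beta>] by auto
  interpret G: group "IMG p M1 M t"
    using tM by (rule group_IMG)
  interpret Q: group "IMG q N1 N s"
    using sN by (rule part.group_IMG)
  define \<phi> where "\<phi> X = img_class t (conj_loop \<beta> (SOME \<gamma>. \<gamma> \<in> loops_at N s \<and> X = part.img_class s \<gamma>))" for X
  have \<phi>: "\<phi> (part.img_class s \<gamma>) = img_class t (conj_loop \<beta> \<gamma>)" if "\<gamma> \<in> loops_at N s" for \<gamma>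
  proof -
    define \<delta> where "\<delta> = (SOME \<delta>. \<delta> \<in> loops_at N s \<and> part.img_class s \<gamma> = part.img_class s \<delta>)"
    have \<delta>: "\<delta> \<in> loops_at N s \<and> part.img_class s \<gamma> = part.img_class s \<delta>"
      unfolding \<delta>_def by (rule someI[of "\<lambda>\<delta>. \<delta> \<in> loops_at N s \<and> part.img_class s \<gamma> = part.img_class s \<delta>" \<gamma>])
         (simp add: that)
    then show ?thesis
      unfolding \<phi>_def \<delta>_def[symmetric] using img_class_conj_loop_eq_iff[OF that, of \<delta>] by simp
  qed
  have hom: "\<phi> \<in> hom (IMG q N1 N s) (IMG p M1 M t)"
  proof (rule homI)
    fix X assume "X \<in> carrier (IMG q N1 N s)"
    then obtain \<gamma> where "\<gamma> \<in> loops_at N s" "X = part.img_class s \<gamma>"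
      unfolding part.carrier_IMG by blast
    then show "\<phi> X \<in> carrier (IMG p M1 M t)"
      using \<phi>[of \<gamma>] conj_loop_in[of \<gamma>] unfolding carrier_IMG by simp
  next
    fix X Y assume "X \<in> carrier (IMG q N1 N s)" "Y \<in> carrier (IMG q N1 N s)"
    then obtain \<gamma> \<delta> where \<gamma>: "\<gamma> \<in> loops_at N s" "X = part.img_class s \<gamma>"
      and \<delta>: "\<delta> \<in> loops_at N s" "Y = part.img_class s \<delta>"
      unfolding part.carrier_IMG by blast
    have "\<phi> (X \<otimes>\<^bsub>IMG q N1 N s\<^esub> Y) = img_class t (conj_loop \<beta> (\<delta> +++ \<gamma>))"
      using \<phi>[OF loops_at_join[OF \<delta>(1) \<gamma>(1)]] part.mult_img_class[OF \<gamma>(1) \<delta>(1)] \<gamma>(2) \<delta>(2) by simp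
    also have "\<dots> = \<phi> X \<otimes>\<^bsub>IMG p M1 M t\<^esub> \<phi> Y"
      using img_class_conj_loop_join[OF \<delta>(1) \<gamma>(1)]
        mult_img_class[OF conj_loop_in[OF \<gamma>(1)] conj_loop_in[OF \<delta>(1)]]
        \<phi>[OF \<gamma>(1)] \<phi>[OF \<delta>(1)] \<gamma>(2) \<delta>(2) by simp
    finally show "\<phi> (X \<otimes>\<^bsub>IMG q N1 N s\<^esub> Y) = \<phi> X \<otimes>\<^bsub>IMG p M1 M t\<^esub> \<phi> Y" .
  qed
  interpret group_hom "IMG q N1 N s" "IMG p M1 M t" \<phi>
    by unfold_locales (rule hom)
  have img: "\<phi> ` carrier (IMG q N1 N s) = H"
    unfolding H_def part.carrier_IMG image_image using \<phi> by (rule image_cong[OF refl])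
  show sub: "subgroup H (IMG p M1 M t)"
    using img_is_subgroup img by simp
  have inj: "inj_on \<phi> (carrier (IMG q N1 N s))"
    unfolding part.carrier_IMG
    by (rule inj_onI) (auto simp: \<phi> img_class_conj_loop_eq_iff)
  have "\<phi> \<in> iso (IMG q N1 N s) ((IMG p M1 M t)\<lparr>carrier := H\<rparr>)"
    using hom inj img by (auto simp: iso_def hom_def bij_betw_def)
  then have "IMG q N1 N s \<cong> (IMG p M1 M t)\<lparr>carrier := H\<rparr>"
    by (rule is_isoI)
  then show "(IMG p M1 M t)\<lparr>carrier := H\<rparr> \<cong> IMG q N1 N s"
    by (rule Q.iso_sym)
qed

end

end

section \<open>Generation by two open sets\<close>

lemma path_image_comp_linepath:
  "a \<le> b \<Longrightarrow> path_image (\<gamma> \<circ> linepath a (b::real)) = \<gamma> ` {a..b}"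
  by (simp add: path_image_compose closed_segment_eq_real_ivl)

lemma path_comp_linepath:
  assumes "path \<gamma>" "{a..b} \<subseteq> {0..1}" "a \<le> b"
  shows "path (\<gamma> \<circ> linepath a (b::real))"
  using assms
  by (intro path_continuous_image)
     (auto simp: path_def closed_segment_eq_real_ivl intro: continuous_on_subset)

lemma homotopic_comp_linepath_join:
  assumes "path \<gamma>" "path_image \<gamma> \<subseteq> M" "0 \<le> a" "a \<le> b" "b \<le> c" "c \<le> 1"
  shows "homotopic_paths M ((\<gamma> \<circ> linepath a b) +++ (\<gamma> \<circ> linepath b c)) (\<gamma> \<circ> linepath a c)"
proof -
  have "homotopic_paths {0..1} (linepath a b +++ linepath b c) (linepath a c)"
  proof (rule homotopic_paths_linear)
    fix s :: real assume s: "s \<in> {0..1}"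
    have "(linepath a b +++ linepath b c) s \<in> path_image (linepath a b +++ linepath b c)"
      using s by (auto simp: path_image_def)
    also have "\<dots> \<subseteq> {0..1}"
      using assms by (simp add: path_image_join closed_segment_eq_real_ivl)
    finally have 1: "(linepath a b +++ linepath b c) s \<in> {0..1}" .
    have "linepath a c s \<in> path_image (linepath a c)"
      using s unfolding path_image_def by blast
    also have "\<dots> \<subseteq> {0..1}"
      using assms by (simp add: closed_segment_eq_real_ivl)
    finally show "closed_segment ((linepath a b +++ linepath b c) s) (linepath a c s) \<subseteq> {0..1}"
      using 1 by (intro closed_segment_subset) auto
  qed simp_all
  then have "homotopic_paths M (\<gamma> \<circ> (linepath a b +++ linepath b c)) (\<gamma> \<circ> linepath a c)"
    by (rule homotopic_paths_continuous_image) (use assms in \<open>auto simp: path_def path_image_def\<close>)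
  then show ?thesis
    by (simp add: path_compose_join)
qed

context path_lifting
begin

lemma transport_in_fiber_eq:
  "\<lbrakk>path \<gamma>; path_image \<gamma> \<subseteq> M; x \<in> fib n (pathstart \<gamma>); pathfinish \<gamma> = y\<rbrakk> \<Longrightarrow> transport n \<gamma> x \<in> fib n y"
  using transport_in_fiber by blast

lemma transport_reversepath2:
  "\<lbrakk>path \<gamma>; path_image \<gamma> \<subseteq> M; x \<in> fib n (pathfinish \<gamma>)\<rbrakk>
    \<Longrightarrow> transport n \<gamma> (transport n (reversepath \<gamma>) x) = x"
  using transport_reversepath[of "reversepath \<gamma>" x n] by simp

lemmas transport_simps = transport_join transport_in_fiber_eq transport_reversepath
  transport_reversepath2 subset_path_image_join

text \<open>The easy half of the theorem of Seifert and van Kampen: if two open path connected sets with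
  path connected intersection cover the space, then a subgroup that contains the classes of
  all loops lying inside one of them is everything. The path \<open>\<beta>\<close> moves the base point from \<open>t0\<close> to \<open>t\<close>.\<close>

lemma subgroup_IMG_eq_carrier:
  assumes cover: "M = V1 \<union> V2" and "open V1" "open V2"
    and pc: "path_connected V1" "path_connected V2" "path_connected (V1 \<inter> V2)"
    and t0: "t0 \<in> V1 \<inter> V2"
    and \<beta>: "path \<beta>" "path_image \<beta> \<subseteq> M" "pathstart \<beta> = t" "pathfinish \<beta> = t0"
    and K: "subgroup K (IMG p M1 M t)"
    and K1: "\<And>\<eta>. \<eta> \<in> loops_at V1 t0 \<Longrightarrow> img_class t (\<beta> +++ (\<eta> +++ reversepath \<beta>)) \<in> K"
    and K2: "\<And>\<eta>. \<eta> \<in> loops_at V2 t0 \<Longrightarrow> img_class t (\<beta> +++ (\<eta> +++ reversepath \<beta>)) \<in> K"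
  shows "K = carrier (IMG p M1 M t)"
proof
  show "K \<subseteq> carrier (IMG p M1 M t)"
    using K by (rule subgroup.subset)
  have "\<exists>c. path c \<and> path_image c \<subseteq> M \<and> pathstart c = t0 \<and> pathfinish c = x
      \<and> (x \<in> V1 \<longrightarrow> path_image c \<subseteq> V1) \<and> (x \<in> V2 \<longrightarrow> path_image c \<subseteq> V2)" if "x \<in> M" for x
  proof -
    have "\<exists>c. path c \<and> path_image c \<subseteq> W \<and> pathstart c = t0 \<and> pathfinish c = x"
      if "path_connected W" "t0 \<in> W" "x \<in> W" for W
      using that by (auto simp: path_connected_def)
    from this[of V1] this[of V2] this[of "V1 \<inter> V2"] show ?thesis
      using pc t0 that cover by blast
  qed
  \<comment> \<open>The path to \<open>x\<close> stays inside each of the two sets that contains \<open>x\<close>.\<close>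
  then have "\<forall>x\<in>M. \<exists>c. path c \<and> path_image c \<subseteq> M \<and> pathstart c = t0 \<and> pathfinish c = x
      \<and> (x \<in> V1 \<longrightarrow> path_image c \<subseteq> V1) \<and> (x \<in> V2 \<longrightarrow> path_image c \<subseteq> V2)"
    by blast
  then obtain c where "\<forall>x\<in>M. path (c x) \<and> path_image (c x) \<subseteq> M \<and> pathstart (c x) = t0 \<and> pathfinish (c x) = x
      \<and> (x \<in> V1 \<longrightarrow> path_image (c x) \<subseteq> V1) \<and> (x \<in> V2 \<longrightarrow> path_image (c x) \<subseteq> V2)"
    by (rule bchoice[THEN exE])
  then have c: "\<And>x. x \<in> M \<Longrightarrow> path (c x)" "\<And>x. x \<in> M \<Longrightarrow> path_image (c x) \<subseteq> M"
    "\<And>x. x \<in> M \<Longrightarrow> pathstart (c x) = t0" "\<And>x. x \<in> M \<Longrightarrow> pathfinish (c x) = x"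
    "\<And>x. x \<in> V1 \<Longrightarrow> path_image (c x) \<subseteq> V1" "\<And>x. x \<in> V2 \<Longrightarrow> path_image (c x) \<subseteq> V2"
    using cover by blast+
  note [simp] = transport_simps
  have main: "img_class t (\<beta> +++ (\<gamma> +++ reversepath \<beta>)) \<in> K" if "\<gamma> \<in> loops_at M t0" for \<gamma>
  proof -
    note \<gamma> = loops_atD[OF that]
    have \<gamma>M: "\<gamma> a \<in> M" if "0 \<le> a" "a \<le> 1" for a
      using \<gamma>(2) that by (auto simp: path_image_def)
    \<comment> \<open>Each piece of \<open>\<gamma>\<close> is closed up to a loop at \<open>t0\<close> by the chosen paths; short pieces give
      loops inside \<open>V1\<close> or \<open>V2\<close>, and adjacent pieces multiply.\<close>
    define L where "L a b = c (\<gamma> a) +++ ((\<gamma> \<circ> linepath a b) +++ reversepath (c (\<gamma> b)))" for a b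
    have seg: "path (\<gamma> \<circ> linepath a b)" "path_image (\<gamma> \<circ> linepath a b) \<subseteq> M"
      "pathstart (\<gamma> \<circ> linepath a b) = \<gamma> a" "pathfinish (\<gamma> \<circ> linepath a b) = \<gamma> b"
      if "0 \<le> a" "a \<le> b" "b \<le> 1" for a b
      using that \<gamma> path_comp_linepath[of \<gamma> a b] \<gamma>M
      by (auto simp: path_image_comp_linepath pathstart_compose pathfinish_compose)
    have L: "L a b \<in> loops_at M t0" if "0 \<le> a" "a \<le> b" "b \<le> 1" for a b
      using that seg[OF that] c \<gamma>M by (simp add: L_def loops_at_def)
    have conj: "\<beta> +++ (\<eta> +++ reversepath \<beta>) \<in> loops_at M t" if "\<eta> \<in> loops_at M t0" for \<eta>
      using loops_atD[OF that] \<beta> by (simp add: loops_at_def)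
    have join: "img_class t (\<beta> +++ (L a d +++ reversepath \<beta>))
        = img_class t (\<beta> +++ (L b d +++ reversepath \<beta>))
          \<otimes>\<^bsub>IMG p M1 M t\<^esub> img_class t (\<beta> +++ (L a b +++ reversepath \<beta>))"
      if abd: "0 \<le> a" "a \<le> b" "b \<le> d" "d \<le> 1" for a b d
    proof -
      have "img_class t (\<beta> +++ (L a d +++ reversepath \<beta>))
          = img_class t ((\<beta> +++ (L a b +++ reversepath \<beta>)) +++ (\<beta> +++ (L b d +++ reversepath \<beta>)))"
      proof (subst img_class_eq_iff)
        show "\<beta> +++ (L a d +++ reversepath \<beta>) \<in> loops_at M t"
          "(\<beta> +++ (L a b +++ reversepath \<beta>)) +++ (\<beta> +++ (L b d +++ reversepath \<beta>)) \<in> loops_at M t"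
          using abd by (intro conj L loops_at_join; simp)+
        show "\<forall>n. \<forall>x\<in>fib n t. transport n (\<beta> +++ (L a d +++ reversepath \<beta>)) x
          = transport n ((\<beta> +++ (L a b +++ reversepath \<beta>)) +++ (\<beta> +++ (L b d +++ reversepath \<beta>))) x"
        proof (intro allI ballI)
          fix n x assume x: "x \<in> fib n t"
          have seg_join: "transport n (\<gamma> \<circ> linepath b d) (transport n (\<gamma> \<circ> linepath a b) y)
              = transport n (\<gamma> \<circ> linepath a d) y" if "y \<in> fib n (\<gamma> a)" for y
            using transport_homotopic[OF homotopic_comp_linepath_join[OF \<gamma>(1,2) abd], of y n] that
              seg[of a b] seg[of b d] abd by simp
          note S = seg[of a b] seg[of b d] seg[of a d]
          have M: "\<gamma> a \<in> M" "\<gamma> b \<in> M" "\<gamma> d \<in> M"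
            using abd \<gamma>M by auto
          show "transport n (\<beta> +++ (L a d +++ reversepath \<beta>)) x
            = transport n ((\<beta> +++ (L a b +++ reversepath \<beta>)) +++ (\<beta> +++ (L b d +++ reversepath \<beta>))) x"
            using x abd S \<beta> c(1-4)[OF M(1)] c(1-4)[OF M(2)] c(1-4)[OF M(3)]
            by (simp add: L_def seg_join)
        qed
      qed
      then show ?thesis
        using mult_img_class conj L abd by simp
    qed
    have "0 \<le> (0::real) \<longrightarrow> (1::real) \<le> 1 \<longrightarrow> img_class t (\<beta> +++ (L 0 1 +++ reversepath \<beta>)) \<in> K"
    proof (rule Bolzano[where a = 0 and b = 1 and P = "\<lambda>a b. 0 \<le> a \<longrightarrow> b \<le> 1 \<longrightarrow> img_class t (\<beta> +++ (L a b +++ reversepath \<beta>)) \<in> K"])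
      fix a b d :: real
      assume trans: "0 \<le> a \<longrightarrow> b \<le> 1 \<longrightarrow> img_class t (\<beta> +++ (L a b +++ reversepath \<beta>)) \<in> K"
        "0 \<le> b \<longrightarrow> d \<le> 1 \<longrightarrow> img_class t (\<beta> +++ (L b d +++ reversepath \<beta>)) \<in> K" "a \<le> b" "b \<le> d"
      show "0 \<le> a \<longrightarrow> d \<le> 1 \<longrightarrow> img_class t (\<beta> +++ (L a d +++ reversepath \<beta>)) \<in> K"
      proof (intro impI)
        assume "0 \<le> a" "d \<le> 1"
        then show "img_class t (\<beta> +++ (L a d +++ reversepath \<beta>)) \<in> K"
          using trans by (simp add: join[of a b d] subgroup.m_closed[OF K])
      qed
    next
      fix x :: real
      assume local: "0 \<le> x" "x \<le> 1"
      have "\<exists>e>0. \<forall>y\<in>{0..1}. \<bar>y - x\<bar> < e \<longrightarrow> \<gamma> y \<in> W" if "open W" "\<gamma> x \<in> W" for W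
      proof -
        have "openin (top_of_set {0..1}) ({0..1} \<inter> \<gamma> -` W)"
          using \<gamma>(1) \<open>open W\<close> by (auto simp: path_def intro: continuous_openin_preimage_gen)
        then show ?thesis
          using local that unfolding openin_euclidean_subtopology_iff
          by (auto simp: dist_real_def)
      qed
      moreover have "\<gamma> x \<in> V1 \<or> \<gamma> x \<in> V2"
        using \<gamma>M local cover by auto
      ultimately obtain W e where W: "W = V1 \<or> W = V2" "e > 0"
        "\<And>y. y \<in> {0..1} \<Longrightarrow> \<bar>y - x\<bar> < e \<Longrightarrow> \<gamma> y \<in> W"
        using \<open>open V1\<close> \<open>open V2\<close> by metis
      show "\<exists>e>0. \<forall>a b. a \<le> x \<and> x \<le> b \<and> b - a < e \<longrightarrow>
          0 \<le> a \<longrightarrow> b \<le> 1 \<longrightarrow> img_class t (\<beta> +++ (L a b +++ reversepath \<beta>)) \<in> K"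
      proof (intro exI[of _ e] conjI W allI impI)
        fix a b assume ab: "a \<le> x \<and> x \<le> b \<and> b - a < e" "0 \<le> a" "b \<le> 1"
        have sub: "\<gamma> ` {a..b} \<subseteq> W"
          using ab by (auto intro!: W(3))
        have "\<gamma> a \<in> W" "\<gamma> b \<in> W"
          using ab by (auto intro!: W(3))
        then have "path_image (c (\<gamma> a)) \<subseteq> W" "path_image (c (\<gamma> b)) \<subseteq> W"
          using W(1) c(5,6) by blast+
        moreover have "path_image (\<gamma> \<circ> linepath a b) \<subseteq> W"
          using sub ab by (simp add: path_image_comp_linepath)
        ultimately have "L a b \<in> loops_at W t0"
          using L[of a b] ab by (simp add: L_def loops_at_def)
        then show "img_class t (\<beta> +++ (L a b +++ reversepath \<beta>)) \<in> K"
          using K1 K2 W(1) by blast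
      qed
    qed simp
    then have "img_class t (\<beta> +++ (L 0 1 +++ reversepath \<beta>)) \<in> K"
      by simp
    moreover
    have c0: "c t0 \<in> loops_at V1 t0"
      using c[of t0] t0 cover by (simp add: loops_at_def)
    have ends: "\<gamma> 0 = t0" "\<gamma> 1 = t0" and \<gamma>01: "\<gamma> \<circ> linepath 0 1 = \<gamma>"
      using \<gamma> by (simp_all add: pathstart_def pathfinish_def comp_linepath_0_1)
    \<comment> \<open>The chosen path from \<open>t0\<close> to itself need not be constant, so it has to be cancelled.\<close>
    let ?e = "\<beta> +++ (c t0 +++ reversepath \<beta>)"
    have c0M: "c t0 \<in> loops_at M t0"
      using c[of t0] t0 cover by (simp add: loops_at_def)
    have e: "img_class t ?e \<in> K"
      using K1[OF c0] .
    have re: "img_class t (\<beta> +++ (reversepath (c t0) +++ reversepath \<beta>)) \<in> K"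
      using K1[OF loops_at_reversepath[OF c0]] .
    have "img_class t (\<beta> +++ (\<gamma> +++ reversepath \<beta>))
        = img_class t (((\<beta> +++ (reversepath (c t0) +++ reversepath \<beta>)) +++ (\<beta> +++ (L 0 1 +++ reversepath \<beta>))) +++ ?e)"
    proof (subst img_class_eq_iff)
      show "\<beta> +++ (\<gamma> +++ reversepath \<beta>) \<in> loops_at M t"
        "((\<beta> +++ (reversepath (c t0) +++ reversepath \<beta>)) +++ (\<beta> +++ (L 0 1 +++ reversepath \<beta>))) +++ ?e \<in> loops_at M t"
        using that c0M by (intro conj L loops_at_join loops_at_reversepath; simp)+
      show "\<forall>n. \<forall>x\<in>fib n t. transport n (\<beta> +++ (\<gamma> +++ reversepath \<beta>)) x =
        transport n (((\<beta> +++ (reversepath (c t0) +++ reversepath \<beta>)) +++ (\<beta> +++ (L 0 1 +++ reversepath \<beta>))) +++ ?e) x"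
        using \<gamma> \<beta> loops_atD[OF c0M] by (simp add: L_def ends \<gamma>01)
    qed
    moreover have "\<dots> = img_class t ?e \<otimes>\<^bsub>IMG p M1 M t\<^esub> (img_class t (\<beta> +++ (L 0 1 +++ reversepath \<beta>))
        \<otimes>\<^bsub>IMG p M1 M t\<^esub> img_class t (\<beta> +++ (reversepath (c t0) +++ reversepath \<beta>)))"
      using c0M L[of 0 1] by (simp add: mult_img_class conj loops_at_join loops_at_reversepath)
    ultimately show ?thesis
      using e re subgroup.m_closed[OF K] by simp
  qed
  show "carrier (IMG p M1 M t) \<subseteq> K"
  proof
    fix X assume "X \<in> carrier (IMG p M1 M t)"
    then obtain \<delta> where \<delta>: "\<delta> \<in> loops_at M t" "X = img_class t \<delta>"
      unfolding carrier_IMG by blast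
    let ?\<gamma> = "reversepath \<beta> +++ (\<delta> +++ \<beta>)"
    have \<gamma>: "?\<gamma> \<in> loops_at M t0"
      using loops_atD[OF \<delta>(1)] \<beta> by (simp add: loops_at_def)
    have "img_class t \<delta> = img_class t (\<beta> +++ (?\<gamma> +++ reversepath \<beta>))"
    proof (subst img_class_eq_iff)
      show "\<beta> +++ (?\<gamma> +++ reversepath \<beta>) \<in> loops_at M t"
        using loops_atD[OF \<gamma>] \<beta> by (simp add: loops_at_def)
      show "\<forall>n. \<forall>x\<in>fib n t. transport n \<delta> x = transport n (\<beta> +++ (?\<gamma> +++ reversepath \<beta>)) x"
        using loops_atD[OF \<delta>(1)] \<beta> by simp
    qed (rule \<delta>(1))
    then show "X \<in> K"
      using main[OF \<gamma>] \<delta>(2) by simp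
  qed
qed

end

text \<open>The paths \<open>\<beta>\<close> from \<open>t\<close> to \<open>t0\<close> and \<open>\<alpha>\<close> from \<open>t0\<close> to \<open>\<iota> s\<close> together move a loop at \<open>s\<close> to \<open>t\<close>.
  A loop at \<open>t0\<close> that becomes homotopic to a loop of the invariant part when moved along \<open>\<alpha>\<close>
  represents an element of the embedded subgroup.\<close>

lemma (in invariant_part) img_class_conj_through:
  assumes \<beta>: "path \<beta>" "path_image \<beta> \<subseteq> M" "pathstart \<beta> = t" "pathfinish \<beta> = t0"
    and \<alpha>: "path \<alpha>" "path_image \<alpha> \<subseteq> M" "pathstart \<alpha> = t0" "pathfinish \<alpha> = \<iota> s"
    and \<eta>: "\<eta> \<in> loops_at M t0" and \<gamma>: "\<gamma> \<in> loops_at N s"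
    and hom: "homotopic_paths M (reversepath \<alpha> +++ (\<eta> +++ \<alpha>)) (\<iota> \<circ> \<gamma>)"
  shows "img_class t (\<beta> +++ (\<eta> +++ reversepath \<beta>)) = img_class t (conj_loop (\<beta> +++ \<alpha>) \<gamma>)"
proof (subst img_class_eq_iff)
  note [simp] = transport_simps
  note \<eta> = loops_atD[OF \<eta>] and \<gamma> = loops_atD[OF \<gamma>]
  have \<iota>\<gamma>: "path (\<iota> \<circ> \<gamma>)" "path_image (\<iota> \<circ> \<gamma>) \<subseteq> M" "pathstart (\<iota> \<circ> \<gamma>) = \<iota> s" "pathfinish (\<iota> \<circ> \<gamma>) = \<iota> s"
    using \<gamma> path_part path_image_part by (simp_all add: pathstart_compose pathfinish_compose)
  show "\<beta> +++ (\<eta> +++ reversepath \<beta>) \<in> loops_at M t"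
    using \<beta> \<eta> by (simp add: loops_at_def)
  show "conj_loop (\<beta> +++ \<alpha>) \<gamma> \<in> loops_at M t"
    using \<beta> \<alpha> assms(10) by (intro conj_loop_in[where s = s]) simp_all
  show "\<forall>n. \<forall>x\<in>fib n t. transport n (\<beta> +++ (\<eta> +++ reversepath \<beta>)) x = transport n (conj_loop (\<beta> +++ \<alpha>) \<gamma>) x"
  proof (intro allI ballI)
    fix n x assume x: "x \<in> fib n t"
    have "transport n (\<iota> \<circ> \<gamma>) y = transport n (reversepath \<alpha> +++ (\<eta> +++ \<alpha>)) y" if "y \<in> fib n (\<iota> s)" for y
      using transport_homotopic[OF hom, of y n] that \<alpha> by simp
    then show "transport n (\<beta> +++ (\<eta> +++ reversepath \<beta>)) x = transport n (conj_loop (\<beta> +++ \<alpha>) \<gamma>) x"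
      using x \<beta> \<alpha> \<eta> \<iota>\<gamma> by (simp add: conj_loop_def reversepath_joinpaths)
  qed
qed

section \<open>Covering maps\<close>

text \<open>Over an open set above which it is a local homeomorphism, a closed map with compact domain is a
  covering. Fibres are finite, being compact
  and discrete; over \<open>y\<close> one takes disjoint neighbourhoods \<open>B x\<close> of the points \<open>x\<close> of the fibre on
  which \<open>p\<close> is a homeomorphism, and removes from the intersection of their images the closed
  image of the complement of their union.\<close>

lemma local_homeomorphism_imp_covering_space:
  fixes p :: "'a::metric_space \<Rightarrow> 'b::t1_space"
  assumes "compact X" and contp: "continuous_on X p" and pXY: "p \<in> X \<rightarrow> Y"
    and closed_map: "\<And>T. compact T \<Longrightarrow> T \<subseteq> X \<Longrightarrow> closed (p ` T)"
    and M: "openin (top_of_set Y) M"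
    and surj: "M \<subseteq> p ` X"
    and loc: "\<And>x. x \<in> X \<Longrightarrow> p x \<in> M \<Longrightarrow> \<exists>U V g. openin (top_of_set X) U \<and> x \<in> U
        \<and> openin (top_of_set Y) V \<and> homeomorphism U V p g"
  shows "covering_space (X \<inter> p -` M) p M"
proof
  define C where "C = X \<inter> p -` M"
  have CX: "openin (top_of_set X) C"
    unfolding C_def using continuous_openin_preimage[OF contp pXY M] .
  show "continuous_on (X \<inter> p -` M) p"
    using contp by (rule continuous_on_subset) auto
  show "p ` (X \<inter> p -` M) = M"
    using surj by auto
  have "\<exists>T. openin (top_of_set X) (fst T) \<and> x \<in> fst T \<and> openin (top_of_set Y) (fst (snd T))
      \<and> homeomorphism (fst T) (fst (snd T)) p (snd (snd T))" if "x \<in> C" for x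
    using loc[of x] that by (auto simp: C_def)
  then obtain T where T: "\<And>x. x \<in> C \<Longrightarrow> openin (top_of_set X) (fst (T x)) \<and> x \<in> fst (T x)
      \<and> openin (top_of_set Y) (fst (snd (T x)))
      \<and> homeomorphism (fst (T x)) (fst (snd (T x))) p (snd (snd (T x)))"
    using bchoice[of C] by metis
  define U V g where "U x = fst (T x)" and "V x = fst (snd (T x))" and "g x = snd (snd (T x))" for x
  have U: "\<And>x. x \<in> C \<Longrightarrow> openin (top_of_set X) (U x)" "\<And>x. x \<in> C \<Longrightarrow> x \<in> U x"
    and V: "\<And>x. x \<in> C \<Longrightarrow> openin (top_of_set Y) (V x)"
    and h: "\<And>x. x \<in> C \<Longrightarrow> homeomorphism (U x) (V x) p (g x)"
    using T by (auto simp: U_def V_def g_def)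
  fix y assume y: "y \<in> M"
  define Q where "Q = X \<inter> p -` {y}"
  have QC: "Q \<subseteq> C"
    using y by (auto simp: Q_def C_def)
  have "closed X"
    using \<open>compact X\<close> by (rule compact_imp_closed)
  then have "closed Q"
    unfolding Q_def using contp by (intro continuous_closed_preimage) auto
  then have "compact Q"
    using \<open>compact X\<close> compact_Int_closed[of X Q] by (simp add: Q_def Int_absorb1 Int_left_absorb)
  have "finite Q"
  proof (rule ccontr)
    assume "infinite Q"
    then obtain x where x: "x \<in> Q" "x islimpt Q"
      using \<open>compact Q\<close> compact_eq_Bolzano_Weierstrass by blast
    obtain Ob where O: "open Ob" "U x = X \<inter> Ob"
      using U(1) x(1) QC by (meson openin_open subsetD)
    then obtain z where z: "z \<in> Q" "z \<in> Ob" "z \<noteq> x"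
      using x(2) U(2)[of x] x(1) QC unfolding islimpt_def by (metis IntD2 subsetD)
    have "z \<in> U x" "x \<in> U x" "p z = p x"
      using z x(1) O(2) U(2) QC by (auto simp: Q_def)
    then show False
      using h[of x] x(1) QC z(3) unfolding homeomorphism_def by (metis subsetD)
  qed
  have "\<exists>d>0. \<forall>x\<in>Q. x \<noteq> a \<longrightarrow> d \<le> dist a x" for a
    using finite_set_avoid[OF \<open>finite Q\<close>] by blast
  then obtain d where d: "\<And>a. d a > 0" "\<And>a x. x \<in> Q \<Longrightarrow> x \<noteq> a \<Longrightarrow> d a \<le> dist a x"
    by metis
  define B where "B x = U x \<inter> C \<inter> ball x (d x / 2)" for x
  have B: "openin (top_of_set X) (B x)" "x \<in> B x" "B x \<subseteq> C" "B x \<subseteq> U x" if "x \<in> Q" for x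
  proof -
    have "x \<in> C"
      using that QC by blast
    then show "openin (top_of_set X) (B x)" "x \<in> B x" "B x \<subseteq> C" "B x \<subseteq> U x"
      using U[of x] CX d(1)[of x] unfolding B_def by (auto intro: openin_Int_open openin_Int)
  qed
  have Bdisj: "disjnt (B x) (B x')" if "x \<in> Q" "x' \<in> Q" "x \<noteq> x'" for x x'
  proof -
    have False if "z \<in> B x" "z \<in> B x'" for z
    proof -
      have "dist x z < d x / 2" "dist x' z < d x' / 2"
        using that by (auto simp: B_def)
      moreover have "d x \<le> dist x x'" "d x' \<le> dist x x'"
        using d(2)[of x' x] d(2)[of x x'] \<open>x \<in> Q\<close> \<open>x' \<in> Q\<close> \<open>x \<noteq> x'\<close> by (simp_all add: dist_commute)
      moreover have "dist x x' \<le> dist x z + dist x' z"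
        by (metis dist_commute dist_triangle2)
      ultimately show False
        by linarith
    qed
    then show ?thesis
      by (auto simp: disjnt_def)
  qed
  have pB: "openin (top_of_set Y) (p ` B x)" if "x \<in> Q" for x
  proof -
    have "openin (top_of_set (U x)) (B x)"
      using B[OF that] U(1) QC that openin_subset_trans openin_imp_subset by (metis subsetD)
    then have "openin (top_of_set (V x)) (p ` B x)"
      using h homeomorphism_imp_open_map QC that by blast
    then show ?thesis
      using V QC that openin_trans by blast
  qed
  have "Q \<noteq> {}"
    using y surj by (auto simp: Q_def)
  define W where "W = (M \<inter> (\<Inter>x\<in>Q. p ` B x)) \<inter> - p ` (X - (\<Union>x\<in>Q. B x))"
  have W: "openin (top_of_set Y) W"
  proof -
    have "openin (top_of_set X) (\<Union>x\<in>Q. B x)"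
      using B by blast
    then obtain Ob where "open Ob" "(\<Union>x\<in>Q. B x) = X \<inter> Ob"
      by (meson openin_open)
    then have "compact (X - (\<Union>x\<in>Q. B x))"
      using \<open>compact X\<close> compact_diff[of X Ob] by (simp add: Diff_Int)
    then have "closed (p ` (X - (\<Union>x\<in>Q. B x)))"
      by (rule closed_map) auto
    moreover have "openin (top_of_set Y) (M \<inter> (\<Inter>x\<in>Q. p ` B x))"
      using \<open>finite Q\<close> \<open>Q \<noteq> {}\<close> pB M by (intro openin_Int openin_Inter) auto
    ultimately show ?thesis
      unfolding W_def using openin_Int_open open_Compl by blast
  qed
  have yW: "y \<in> W"
    unfolding W_def using y B(2) by (auto simp: Q_def)
  have WM: "W \<subseteq> M"
    by (auto simp: W_def)
  have 1: "\<Union>((\<lambda>x. B x \<inter> p -` W) ` Q) = C \<inter> p -` W"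
    using B(3) by (auto simp: W_def C_def)
  have 2: "openin (top_of_set C) (B x \<inter> p -` W)" if "x \<in> Q" for x
  proof -
    have "openin (top_of_set X) (X \<inter> p -` W)"
      using continuous_openin_preimage[OF contp pXY W] .
    then have "openin (top_of_set X) (B x \<inter> (X \<inter> p -` W))"
      using B(1)[OF that] by blast
    moreover have "B x \<inter> (X \<inter> p -` W) = B x \<inter> p -` W"
      using B(3)[OF that] by (auto simp: C_def)
    ultimately show ?thesis
      using B(3)[OF that] CX openin_subset_trans openin_imp_subset by (metis inf.coboundedI1)
  qed
  have 3: "homeomorphism (B x \<inter> p -` W) W p (g x)" if "x \<in> Q" for x
  proof (rule homeomorphism_of_subsets[OF h[of x], where T'' = "{}"])
    have "W \<subseteq> p ` B x"
      using that by (auto simp: W_def)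
    then show "p ` (B x \<inter> p -` W) = W"
      by auto
  qed (use that QC B(4)[OF that] in auto)
  show "\<exists>T. y \<in> T \<and> openin (top_of_set M) T \<and>
      (\<exists>v. \<Union>v = X \<inter> p -` M \<inter> p -` T \<and> (\<forall>u\<in>v. openin (top_of_set (X \<inter> p -` M)) u)
        \<and> pairwise disjnt v \<and> (\<forall>u\<in>v. \<exists>q. homeomorphism u T p q))"
  proof (intro exI[of _ W] conjI exI[of _ "(\<lambda>x. B x \<inter> p -` W) ` Q"])
    show "openin (top_of_set M) W"
      using W WM M openin_subset_trans openin_imp_subset by metis
    show "pairwise disjnt ((\<lambda>x. B x \<inter> p -` W) ` Q)"
      using Bdisj by (fastforce simp: pairwise_def disjnt_def)
    show "\<forall>u\<in>(\<lambda>x. B x \<inter> p -` W) ` Q. \<exists>q. homeomorphism u W p q"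
      using 3 by blast
  qed (use yW 1 2 in \<open>auto simp: C_def\<close>)
qed

text \<open>Lifting through one step suffices: lifts through iterates are constructed step by step, and
  homotopic paths have lifts that are homotopic in \<open>M\<close>, which allows to continue.\<close>

lemma path_liftingI:
  fixes p :: "'a::topological_space \<Rightarrow> 'a"
  assumes "M1 \<subseteq> M"
    and ex: "\<And>\<gamma> x. \<lbrakk>path \<gamma>; path_image \<gamma> \<subseteq> M; x \<in> M1; p x = pathstart \<gamma>\<rbrakk>
        \<Longrightarrow> \<exists>g. path g \<and> path_image g \<subseteq> M1 \<and> pathstart g = x \<and> (\<forall>s\<in>{0..1}. p (g s) = \<gamma> s)"
    and hom: "\<And>\<gamma> \<gamma>' g g'. \<lbrakk>homotopic_paths M \<gamma> \<gamma>'; path g; path_image g \<subseteq> M1; path g'; path_image g' \<subseteq> M1;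
        \<forall>s\<in>{0..1}. p (g s) = \<gamma> s; \<forall>s\<in>{0..1}. p (g' s) = \<gamma>' s; pathstart g = pathstart g'\<rbrakk>
        \<Longrightarrow> homotopic_paths M1 g g'"
    and contp: "continuous_on M1 p"
  shows "path_lifting p M1 M"
proof -
  have dom_sub: "iter_dom p M1 M n \<subseteq> M" for n
    using \<open>M1 \<subseteq> M\<close> by (cases n) auto
  have exn: "\<exists>g. is_iter_lift p M1 M n \<gamma> g \<and> pathstart g = x"
    if "path \<gamma>" "path_image \<gamma> \<subseteq> M" "x \<in> iter_fiber p M1 M n (pathstart \<gamma>)" for n x \<gamma>
    using that(3)
  proof (induction n arbitrary: x)
    case 0
    then show ?case
      using that(1,2) by (auto simp: is_iter_lift_def iter_fiber_def)
  next
    case (Suc n)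
    then have "p x \<in> iter_fiber p M1 M n (pathstart \<gamma>)" "x \<in> M1"
      by (auto simp: iter_fiber_def funpow_swap1)
    then obtain g where g: "is_iter_lift p M1 M n \<gamma> g" "pathstart g = p x"
      using Suc.IH by blast
    have "path g" "path_image g \<subseteq> M"
      using g(1) dom_sub[of n] by (auto simp: is_iter_lift_def)
    then obtain h where h: "path h" "path_image h \<subseteq> M1" "pathstart h = x" "\<forall>s\<in>{0..1}. p (h s) = g s"
      using ex[of g x] g(2) \<open>x \<in> M1\<close> by auto
    have "path_image h \<subseteq> iter_dom p M1 M (Suc n)"
      using h(2,4) g(1) unfolding is_iter_lift_def path_image_def by auto
    then have "is_iter_lift p M1 M (Suc n) \<gamma> h"
      using h g(1) by (simp add: is_iter_lift_def funpow_swap1)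
    then show ?case
      using h(3) by blast
  qed
  have homn: "homotopic_paths M g g'"
    if "homotopic_paths M \<gamma> \<gamma>'" "is_iter_lift p M1 M n \<gamma> g" "is_iter_lift p M1 M n \<gamma>' g'" "pathstart g = pathstart g'"
    for n \<gamma> \<gamma>' g g'
    using that(2-)
  proof (induction n arbitrary: g g')
    case 0
    then have "homotopic_paths M g \<gamma>" "homotopic_paths M g' \<gamma>'"
      by (auto simp: is_iter_lift_def intro!: homotopic_paths_eq)
    then show ?case
      using that(1) homotopic_paths_sym homotopic_paths_trans by blast
  next
    case (Suc n)
    have gM: "path g" "path g'" "path_image g \<subseteq> M1" "path_image g' \<subseteq> M1"
      using Suc.prems by (auto simp: is_iter_lift_def)
    then have "path (p \<circ> g)" "path (p \<circ> g')"
      using contp continuous_on_subset by (blast intro: path_continuous_image)+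
    then have "is_iter_lift p M1 M n \<gamma> (p \<circ> g)" "is_iter_lift p M1 M n \<gamma>' (p \<circ> g')"
      using Suc.prems by (auto simp: is_iter_lift_def funpow_swap1 path_image_compose)
    then have "homotopic_paths M (p \<circ> g) (p \<circ> g')"
      by (rule Suc.IH) (use Suc.prems(3) in \<open>simp only: pathstart_compose\<close>)
    then have "homotopic_paths M1 g g'"
      using hom[of "p \<circ> g" "p \<circ> g'" g g'] gM Suc.prems(3) by simp
    then show ?case
      using \<open>M1 \<subseteq> M\<close> homotopic_paths_subset by blast
  qed
  show ?thesis
    by unfold_locales (use exn homn homotopic_paths_imp_pathfinish in blast)+
qed

text \<open>The embedding \<open>e\<close> into a normed space makes lifting theorems for coverings of subsets of
  normed spaces applicable.\<close>

lemma covering_space_imp_path_lifting: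
  fixes p :: "'a::topological_space \<Rightarrow> 'a" and e :: "'a \<Rightarrow> 'c::real_normed_vector"
  assumes e: "homeomorphism UNIV \<Sigma> e e'"
    and cov: "covering_space (e ` M1) (e \<circ> p \<circ> e') (e ` M)"
    and "M1 \<subseteq> M" and contp: "continuous_on M1 p"
  shows "path_lifting p M1 M"
proof (rule path_liftingI)
  have e'e [simp]: "e' (e x) = x" for x
    using e by (simp add: homeomorphism_def)
  have cont_e: "continuous_on A e" for A
    using e continuous_on_subset unfolding homeomorphism_def by blast
  have cont_e': "continuous_on (e ` A) e'" for A
    using e continuous_on_subset[of \<Sigma> e' "e ` A"] unfolding homeomorphism_def by blast
  fix \<gamma> :: "real \<Rightarrow> 'a" and x
  assume \<gamma>: "path \<gamma>" "path_image \<gamma> \<subseteq> M" and x: "x \<in> M1" "p x = pathstart \<gamma>"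
  obtain h where h: "path h" "path_image h \<subseteq> e ` M1" "pathstart h = e x"
    "\<And>s. s \<in> {0..1} \<Longrightarrow> (e \<circ> p \<circ> e') (h s) = (e \<circ> \<gamma>) s"
  proof (rule covering_space_lift_path_strong[OF cov, of "e x" "e \<circ> \<gamma>"])
    show "path (e \<circ> \<gamma>)"
      using \<gamma>(1) cont_e by (rule path_continuous_image)
  qed (use x \<gamma> in \<open>auto simp: path_image_compose pathstart_compose\<close>)
  have "path (e' \<circ> h)"
    using h(1,2) cont_e' continuous_on_subset by (blast intro: path_continuous_image)
  moreover have "path_image (e' \<circ> h) \<subseteq> M1"
    using h(2) by (auto simp: path_image_compose)
  moreover have "p ((e' \<circ> h) s) = \<gamma> s" if "s \<in> {0..1}" for s
    using h(4)[OF that] by (metis comp_apply e'e)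
  ultimately show "\<exists>g. path g \<and> path_image g \<subseteq> M1 \<and> pathstart g = x \<and> (\<forall>s\<in>{0..1}. p (g s) = \<gamma> s)"
    using h(3) by (intro exI[of _ "e' \<circ> h"]) (simp add: pathstart_compose)
next
  have e'e [simp]: "e' (e x) = x" for x
    using e by (simp add: homeomorphism_def)
  have cont_e: "continuous_on A e" for A
    using e continuous_on_subset unfolding homeomorphism_def by blast
  have cont_e': "continuous_on (e ` A) e'" for A
    using e continuous_on_subset[of \<Sigma> e' "e ` A"] unfolding homeomorphism_def by blast
  fix \<gamma> \<gamma>' g g' :: "real \<Rightarrow> 'a"
  assume hom: "homotopic_paths M \<gamma> \<gamma>'"
    and g: "path g" "path_image g \<subseteq> M1" and g': "path g'" "path_image g' \<subseteq> M1"
    and l: "\<forall>s\<in>{0..1}. p (g s) = \<gamma> s" "\<forall>s\<in>{0..1}. p (g' s) = \<gamma>' s" "pathstart g = pathstart g'"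
  have paths: "path (e \<circ> \<eta>)" if "path \<eta>" for \<eta>
    using that cont_e by (rule path_continuous_image)
  have eh: "homotopic_paths (e ` M) (e \<circ> \<gamma>) (e \<circ> \<gamma>')"
    using hom cont_e by (rule homotopic_paths_continuous_image) auto
  have "homotopic_paths (e ` M1) (e \<circ> g) (e \<circ> g')"
  proof (rule covering_space_lift_homotopic_paths[OF cov _ _ _ _ eh])
    show "path (e \<circ> \<gamma>)" "path (e \<circ> \<gamma>')" "path_image (e \<circ> \<gamma>) \<subseteq> e ` M" "path_image (e \<circ> \<gamma>') \<subseteq> e ` M"
      using homotopic_paths_imp_path[OF eh] homotopic_paths_imp_subset[OF eh] by auto
  qed (use paths g g' l in \<open>auto simp: path_image_compose pathstart_compose\<close>)
  then have "homotopic_paths M1 (e' \<circ> (e \<circ> g)) (e' \<circ> (e \<circ> g'))"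
    using cont_e' by (rule homotopic_paths_continuous_image) auto
  moreover have "e' \<circ> (e \<circ> g) = g" "e' \<circ> (e \<circ> g') = g'"
    by auto
  ultimately show "homotopic_paths M1 g g'"
    by simp
qed (use assms in auto)

section \<open>Polynomials near infinity\<close>

text \<open>The homogeneous form in two variables that restricts to \<open>f\<close> at \<open>\<eta> = 1\<close>. It is continuous at
  \<open>\<eta> = 0\<close>, the circle at infinity, and so replaces limits there.\<close>

definition homogenize :: "complex poly \<Rightarrow> complex \<Rightarrow> complex \<Rightarrow> complex" where
  "homogenize f w \<eta> = (\<Sum>k\<le>degree f. coeff f k * w ^ k * \<eta> ^ (degree f - k))"

lemma homogenize_eq: "\<eta> \<noteq> 0 \<Longrightarrow> homogenize f w \<eta> = \<eta> ^ degree f * poly f (w / \<eta>)"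
  unfolding homogenize_def poly_altdef sum_distrib_left
  by (intro sum.cong refl) (simp add: power_divide power_diff)

lemma homogenize_0: "homogenize f w 0 = lead_coeff f * w ^ degree f"
proof -
  have "homogenize f w 0 = (\<Sum>k\<le>degree f. if k = degree f then lead_coeff f * w ^ degree f else 0)"
    unfolding homogenize_def by (intro sum.cong refl) (auto simp: power_0_left)
  then show ?thesis
    by simp
qed

lemma continuous_on_homogenize [continuous_intros]:
  "continuous_on A g \<Longrightarrow> continuous_on A h \<Longrightarrow> continuous_on A (\<lambda>x. homogenize f (g x) (h x))"
  unfolding homogenize_def by (intro continuous_intros)

text \<open>The radial homeomorphism of the plane onto the open unit disk, and its inverse.\<close>

definition disk :: "complex \<Rightarrow> complex" where
  "disk z = z / of_real (1 + norm z)"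

definition undisk :: "complex \<Rightarrow> complex" where
  "undisk w = w / of_real (1 - norm w)"

lemma norm_disk: "norm (disk z) = norm z / (1 + norm z)"
  unfolding disk_def norm_divide norm_of_real by (simp add: abs_of_nonneg)

lemma norm_disk_less_1: "norm (disk z) < 1"
  by (simp add: norm_disk divide_less_eq add_pos_nonneg)

lemma one_minus_norm_disk: "1 - norm (disk z) = 1 / (1 + norm z)"
proof -
  have "1 + norm z > 0"
    by (simp add: add_pos_nonneg)
  then show ?thesis
    by (simp add: norm_disk field_simps)
qed

lemma undisk_disk [simp]: "undisk (disk z) = z"
proof -
  have "1 + norm z > 0"
    by (simp add: add_pos_nonneg)
  then have "complex_of_real (1 + norm z) \<noteq> 0"
    by (metis less_irrefl of_real_eq_0_iff)
  then show ?thesis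
    unfolding undisk_def one_minus_norm_disk by (simp add: disk_def)
qed

lemma disk_undisk: "norm w < 1 \<Longrightarrow> disk (undisk w) = w"
proof -
  assume w: "norm w < 1"
  then have n: "norm (undisk w) = norm w / (1 - norm w)"
    unfolding undisk_def norm_divide norm_of_real by (simp add: abs_of_pos)
  then have "1 + norm (undisk w) = 1 / (1 - norm w)"
    using w by (simp add: field_simps)
  moreover have "complex_of_real (1 - norm w) \<noteq> 0"
    using w unfolding of_real_eq_0_iff by simp
  ultimately show ?thesis
    unfolding disk_def by (simp add: undisk_def)
qed

lemma continuous_on_disk: "continuous_on A disk"
proof -
  have "complex_of_real (1 + norm z) \<noteq> 0" for z :: complex
    by (smt (verit) norm_ge_zero of_real_eq_0_iff)
  then show ?thesis
    unfolding disk_def by (intro continuous_intros) auto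
qed

lemma continuous_on_undisk: "continuous_on (ball 0 1) undisk"
  unfolding undisk_def by (intro continuous_intros) (auto simp only: of_real_eq_0_iff mem_ball dist_0_norm)

text \<open>The polynomial read in the closed unit disk: \<open>disk \<circ> f \<circ> undisk\<close>, written with the homogeneous
  form so that the same formula makes sense on the unit circle, where it is a power map if \<open>f\<close> is
  monic of positive degree.\<close>

definition disk_map :: "complex poly \<Rightarrow> complex \<Rightarrow> complex" where
  "disk_map f w = homogenize f w (of_real (1 - norm w))
     / of_real ((1 - norm w) ^ degree f + norm (homogenize f w (of_real (1 - norm w))))"

lemma disk_map_disk: "disk_map f (disk z) = disk (poly f z)"
proof -
  define r where "r = 1 - norm (disk z)"
  have r: "r > 0"
    using norm_disk_less_1[of z] by (simp add: r_def)
  have "disk z / of_real r = z"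
    unfolding r_def using undisk_disk[of z] by (simp add: undisk_def)
  then have h: "homogenize f (disk z) (of_real r) = of_real (r ^ degree f) * poly f z"
    using r by (simp add: homogenize_eq)
  have "disk_map f (disk z) = of_real (r ^ degree f) * poly f z / of_real (r ^ degree f * (1 + norm (poly f z)))"
    unfolding disk_map_def r_def[symmetric] h using r by (simp add: norm_mult norm_power algebra_simps)
  also have "\<dots> = disk (poly f z)"
    using r by (simp add: disk_def)
  finally show ?thesis .
qed

lemma disk_map_circle:
  assumes "norm w = 1" "lead_coeff f = 1" "degree f > 0"
  shows "disk_map f w = w ^ degree f"
  using assms by (simp add: disk_map_def homogenize_0 norm_power zero_power)

lemma continuous_on_disk_map:
  assumes "lead_coeff f = 1"
  shows "continuous_on (cball 0 1) (disk_map f)"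
proof -
  have "complex_of_real ((1 - norm w) ^ degree f + norm (homogenize f w (of_real (1 - norm w)))) \<noteq> 0"
    if "w \<in> cball 0 1" for w :: complex
  proof (cases "norm w = 1")
    case True
    then have "norm (homogenize f w (of_real (1 - norm w))) = 1"
      using assms by (simp add: homogenize_0 norm_power)
    then have "(1 - norm w) ^ degree f + norm (homogenize f w (of_real (1 - norm w))) > 0"
      using True by (simp add: add_nonneg_pos)
    then show ?thesis
      by (metis less_irrefl of_real_eq_0_iff)
  next
    case False
    then have "(1 - norm w) ^ degree f > 0"
      using that by simp
    then have "(1 - norm w) ^ degree f + norm (homogenize f w (of_real (1 - norm w))) > 0"
      by (simp add: add_pos_nonneg)
    then show ?thesis
      by (metis less_irrefl of_real_eq_0_iff)
  qed
  then show ?thesis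
    unfolding disk_map_def by (intro continuous_intros) auto
qed

text \<open>The set \<open>\<Omega>\<close> of the quotients \<open>w / \<eta>\<close> with \<open>w\<close> close to \<open>u\<close> and \<open>\<eta> > 0\<close> small is convex and contains
  all points of the plane whose disk coordinate is close to \<open>u\<close>. By homogeneity the derivative,
  multiplied by the conjugate of \<open>u ^ (d - 1)\<close>, has positive real part on \<open>\<Omega>\<close>, since its
  homogeneous form has the value \<open>d * u ^ (d - 1)\<close> at \<open>(u, 0)\<close>. By the mean value theorem \<open>f\<close> is injective
  on \<open>\<Omega>\<close>.\<close>

lemma monic_poly_injective_near_infinity:
  fixes f :: "complex poly"
  assumes monic: "lead_coeff f = 1" and deg: "degree f > 0" and u: "norm u = 1"
  obtains \<delta> where "\<delta> > 0"
    "\<And>z z'. \<lbrakk>norm (disk z - u) < \<delta>; norm (disk z' - u) < \<delta>; poly f z = poly f z'\<rbrakk> \<Longrightarrow> z = z'"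
proof -
  define g where "g = pderiv f"
  define m where "m = degree g"
  have m: "degree f = Suc m"
    using deg by (simp add: m_def g_def degree_pderiv)
  have lg: "lead_coeff g = of_nat (degree f)"
    using monic m by (simp add: m_def[symmetric]) (simp add: g_def coeff_pderiv)
  have cu: "u * cnj u = 1"
    using u by (simp add: complex_norm_square[symmetric])
  define \<Phi> where "\<Phi> x = Re (homogenize g (fst x) (of_real (snd x)) * cnj u ^ m)" for x :: "complex \<times> real"
  have "\<Phi> (u, 0) = real (degree f)"
    using lg cu by (simp add: \<Phi>_def homogenize_0 mult.assoc m_def[symmetric] flip: power_mult_distrib)
  then have "\<Phi> (u, 0) > 0"
    using deg by simp
  moreover have "continuous_on UNIV \<Phi>"
    unfolding \<Phi>_def by (intro continuous_intros)
  ultimately have "open (\<Phi> -` {0<..})" "(u, 0) \<in> \<Phi> -` {0<..}"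
    by (auto intro: open_vimage)
  then obtain e where e: "e > 0" "ball (u, 0) e \<subseteq> \<Phi> -` {0<..}"
    using openE by blast
  define \<delta> where "\<delta> = e / 2"
  have pos: "\<Phi> (w, \<eta>) > 0" if "norm (w - u) < \<delta>" "0 < \<eta>" "\<eta> < \<delta>" for w \<eta>
  proof -
    have "dist (u, 0) (w, \<eta>) \<le> dist u w + dist 0 \<eta>"
      unfolding dist_Pair_Pair by (rule sqrt_sum_squares_le_sum) auto
    also have "\<dots> < e"
      using that by (simp add: \<delta>_def dist_norm norm_minus_commute)
    finally show ?thesis
      using e(2) by auto
  qed
  define \<Omega> where "\<Omega> = {w / of_real \<eta> | w \<eta>. norm (w - u) < \<delta> \<and> 0 < \<eta> \<and> \<eta> < \<delta>}"
  have dpos: "Re (poly g z * cnj u ^ m) > 0" if z\<Omega>: "z \<in> \<Omega>" for z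
  proof -
    obtain w \<eta> where z: "z = w / of_real \<eta>" "norm (w - u) < \<delta>" "0 < \<eta>" "\<eta> < \<delta>"
      using z\<Omega> by (auto simp: \<Omega>_def)
    have "\<Phi> (w, \<eta>) = Re (of_real (\<eta> ^ m) * (poly g z * cnj u ^ m))"
      using z(1,3) by (simp add: \<Phi>_def homogenize_eq m_def mult_ac)
    also have "\<dots> = \<eta> ^ m * Re (poly g z * cnj u ^ m)"
      by simp
    finally show ?thesis
      using pos[OF z(2-4)] z(3) by (simp add: zero_less_mult_iff)
  qed
  have "convex \<Omega>"
    unfolding convex_alt
  proof (intro ballI allI impI)
    fix z z' and s :: real
    assume "z \<in> \<Omega>" "z' \<in> \<Omega>" and s: "0 \<le> s \<and> s \<le> 1"
    then obtain w \<eta> w' \<eta>' where z: "z = w / of_real \<eta>" "norm (w - u) < \<delta>" "0 < \<eta>" "\<eta> < \<delta>"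
      and z': "z' = w' / of_real \<eta>'" "norm (w' - u) < \<delta>" "0 < \<eta>'" "\<eta>' < \<delta>"
      by (auto simp: \<Omega>_def)
    \<comment> \<open>A convex combination of \<open>w / \<eta>\<close> and \<open>w' / \<eta>'\<close> is \<open>L W\<close>, where \<open>W\<close> is a convex combination of
      \<open>w\<close> and \<open>w'\<close>.\<close>
    define L where "L = (1 - s) / \<eta> + s / \<eta>'"
    define W where "W = ((1 - s) / \<eta> / L) *\<^sub>R w + (s / \<eta>' / L) *\<^sub>R w'"
    have \<delta>: "\<delta> > 0"
      using e(1) by (simp add: \<delta>_def)
    have L: "L > 1 / \<delta>"
    proof -
      have "1 / \<eta> > 1 / \<delta>" "1 / \<eta>' > 1 / \<delta>"
        using z z' \<delta> by (simp_all add: frac_less2)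
      then have "(1 - s) * (1 / \<eta>) + s * (1 / \<eta>') > 1 / \<delta>"
        using s convex_bound_lt[of "- (1 / \<eta>)" "- (1 / \<delta>)" "- (1 / \<eta>')" "1 - s" s] by simp
      then show ?thesis
        by (simp add: L_def)
    qed
    then have L0: "L > 0"
      using \<delta> by (meson less_trans zero_less_divide_1_iff)
    have "W \<in> ball u \<delta>"
      unfolding W_def using convex_ball[of u \<delta>]
    proof (rule convexD)
      show "(1 - s) / \<eta> / L + s / \<eta>' / L = 1"
        unfolding add_divide_distrib[symmetric] L_def[symmetric] using L0 by simp
    qed (use z z' s L0 in \<open>auto simp: dist_norm norm_minus_commute\<close>)
    then have "norm (W - u) < \<delta>"
      by (simp add: dist_norm norm_minus_commute)
    moreover have "1 / L < \<delta>" "1 / L > 0"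
      using L L0 \<delta> by (simp_all add: field_simps)
    moreover have "(1 - s) *\<^sub>R z + s *\<^sub>R z' = W / of_real (1 / L)"
    proof -
      have "W / of_real (1 / L) = L *\<^sub>R W"
        by (simp add: scaleR_conv_of_real)
      also have "\<dots> = ((1 - s) / \<eta>) *\<^sub>R w + (s / \<eta>') *\<^sub>R w'"
        using L0 by (simp add: W_def scaleR_right_distrib)
      also have "\<dots> = (1 - s) *\<^sub>R z + s *\<^sub>R z'"
        by (simp add: z z' scaleR_conv_of_real)
      finally show ?thesis
        by simp
    qed
    ultimately show "(1 - s) *\<^sub>R z + s *\<^sub>R z' \<in> \<Omega>"
      unfolding \<Omega>_def by blast
  qed
  have inj: "z = z'" if zz: "z \<in> \<Omega>" "z' \<in> \<Omega>" "poly f z = poly f z'" for z z'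
  proof (rule ccontr)
    assume "z \<noteq> z'"
    \<comment> \<open>This factor turns the increment along the segment into a positive multiple of the quantity
      that is positive on \<open>\<Omega>\<close>.\<close>
    define c where "c = cnj u ^ m * cnj (z - z')"
    have "\<exists>\<xi>. \<xi> \<in> closed_segment z' z \<and> Re (c * poly f z) - Re (c * poly f z') = Re (c * poly g \<xi> * (z - z'))"
      by (rule complex_mvt_line) (auto simp: g_def intro!: derivative_eq_intros)
    then obtain \<xi> where \<xi>: "\<xi> \<in> closed_segment z' z" "Re (c * poly g \<xi> * (z - z')) = 0"
      using zz(3) by auto
    have "\<xi> \<in> \<Omega>"
      using \<xi>(1) \<open>convex \<Omega>\<close> zz(1,2) closed_segment_subset by blast
    have "c * poly g \<xi> * (z - z') = (poly g \<xi> * cnj u ^ m) * ((z - z') * cnj (z - z'))"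
      by (simp add: c_def mult_ac)
    also have "(z - z') * cnj (z - z') = of_real ((norm (z - z'))\<^sup>2)"
      by (simp only: complex_norm_square)
    also have "Re ((poly g \<xi> * cnj u ^ m) * of_real ((norm (z - z'))\<^sup>2))
        = Re (poly g \<xi> * cnj u ^ m) * (norm (z - z'))\<^sup>2"
      by (simp only: times_complex.sel Re_complex_of_real Im_complex_of_real)
    finally have "Re (c * poly g \<xi> * (z - z')) = Re (poly g \<xi> * cnj u ^ m) * (norm (z - z'))\<^sup>2" .
    then show False
      using \<xi>(2) dpos[OF \<open>\<xi> \<in> \<Omega>\<close>] \<open>z \<noteq> z'\<close> by simp
  qed
  have mem: "z \<in> \<Omega>" if "norm (disk z - u) < \<delta>" for z
  proof -
    have "z = disk z / of_real (1 - norm (disk z))"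
      using undisk_disk[of z] by (simp add: undisk_def)
    moreover have "1 - norm (disk z) < \<delta>"
      using that u norm_triangle_ineq2[of u "disk z"] by (simp add: norm_minus_commute)
    ultimately show ?thesis
      unfolding \<Omega>_def using that norm_disk_less_1[of z] by (smt (verit) mem_Collect_eq)
  qed
  show ?thesis
  proof (rule that)
    show "\<delta> > 0"
      using e(1) by (simp add: \<delta>_def)
  qed (use inj mem in blast)
qed

lemma holomorphic_on_poly: "poly f holomorphic_on A"
  unfolding holomorphic_on_def field_differentiable_def
  by (meson has_field_derivative_at_within poly_DERIV)

lemma deriv_poly: "deriv (poly f) z = poly (pderiv f) (z::complex)"
  by (intro DERIV_imp_deriv poly_DERIV)

lemma poly_locally_injective:
  assumes "poly (pderiv f) z \<noteq> 0"
  obtains r where "r > 0" "inj_on (poly f) (ball (z::complex) r)"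
  using has_complex_derivative_locally_injective[OF holomorphic_on_poly, of z UNIV f] assms
  by (auto simp: deriv_poly)

lemma poly_injective_imp_regular:
  assumes "inj_on (poly f) U" "open U" "z \<in> U"
  shows "poly (pderiv f) (z::complex) \<noteq> 0"
  using holomorphic_injective_imp_regular[OF holomorphic_on_poly, of U f z] assms
  by (simp add: deriv_poly)

lemma power_locally_injective:
  assumes "z \<noteq> 0" "n > 0"
  obtains r where "r > 0" "inj_on (\<lambda>w. w ^ n) (ball (z::complex) r)"
proof -
  have "poly (monom 1 n) = (\<lambda>w::complex. w ^ n)"
    by (rule ext) (simp add: poly_monom)
  moreover have "poly (pderiv (monom 1 n)) z \<noteq> 0"
    using assms by (simp add: pderiv_monom poly_monom)
  ultimately show ?thesis
    using poly_locally_injective[of "monom 1 n" z] that by metis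
qed

section \<open>The mating sphere as a double cone\<close>

text \<open>The point of the closed plane with given coordinate in the closed unit disk.\<close>

definition plane_point :: "complex \<Rightarrow> closed_plane" where
  "plane_point w = (if norm w < 1 then Pt (undisk w) else AtInfty (Abs_circle w))"

lemma disk_coord_Pt: "disk_coord (Pt z) = disk z"
  by (simp add: disk_def)

lemma disk_coord_plane_point: "norm w \<le> 1 \<Longrightarrow> disk_coord (plane_point w) = w"
  by (auto simp: plane_point_def disk_coord_Pt disk_undisk Abs_circle_inverse simp del: disk_coord.simps(1))

lemma norm_disk_coord: "norm (disk_coord p) \<le> 1"
  using Rep_circle norm_disk_less_1 less_imp_le
  by (cases p) (auto simp: disk_coord_Pt simp del: disk_coord.simps(1))

lemma plane_point_disk_coord [simp]: "plane_point (disk_coord p) = p"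
proof (cases p)
  case (AtInfty u)
  then show ?thesis
    using Rep_circle[of u] by (simp add: plane_point_def Rep_circle_inverse)
qed (simp add: plane_point_def disk_coord_Pt norm_disk_less_1 del: disk_coord.simps(1))

lemma open_disk_coord_preimage:
  assumes "continuous_on (cball 0 1) k" "open B"
  shows "open {x. k (disk_coord x) \<in> B}"
proof -
  have "openin (top_of_set (cball 0 1)) (cball 0 1 \<inter> k -` B)"
    using assms by (rule continuous_openin_preimage_gen)
  then obtain T where T: "open T" "cball 0 1 \<inter> k -` B = cball 0 1 \<inter> T"
    by (meson openin_open)
  have "{x. k (disk_coord x) \<in> B} = disk_coord -` T"
    using T(2) norm_disk_coord by (auto simp: set_eq_iff)
  then show ?thesis
    using T(1) by (auto simp: open_closed_plane_def)
qed

text \<open>The two closed hemispheres, parametrized by the closed unit disk. They are glued along the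
  circle by complex conjugation (\<open>hemi_circle\<close>). Values off the closed disk are irrelevant.\<close>

definition hemi1 :: "complex \<Rightarrow> mating_sphere" where
  "hemi1 w = abs_mating_sphere (Inl (plane_point w))"

definition hemi2 :: "complex \<Rightarrow> mating_sphere" where
  "hemi2 w = abs_mating_sphere (Inr (plane_point w))"

lemma hemi_cases:
  obtains w where "norm w \<le> 1" "s = hemi1 w" | w where "norm w \<le> 1" "s = hemi2 w"
proof -
  have "\<exists>y. s = abs_mating_sphere y"
    by (induct s rule: mating_sphere.abs_induct) blast
  then obtain y where 1: "s = abs_mating_sphere y"
    by blast
  show thesis
  proof (cases y)
    case (Inl p)
    then show thesis
      using that(1)[of "disk_coord p"] 1 norm_disk_coord by (simp add: hemi1_def)
  next
    case (Inr p)
    then show thesis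
      using that(2)[of "disk_coord p"] 1 norm_disk_coord by (simp add: hemi2_def)
  qed
qed

lemma hemi_circle:
  assumes "norm w = 1"
  shows "hemi1 w = hemi2 (cnj w)"
proof -
  have "circle_cnj (Abs_circle w) = Abs_circle (cnj w)"
    using assms by (simp add: circle_cnj.abs_eq eq_onp_def)
  then show ?thesis
    using assms
    by (simp add: hemi1_def hemi2_def plane_point_def mating_sphere.abs_eq_iff glued_def)
qed

lemma continuous_from_mating_sphere:
  assumes "continuous_on (cball 0 1) (h \<circ> hemi1)" "continuous_on (cball 0 1) (h \<circ> hemi2)"
  shows "continuous_on UNIV h"
proof (subst continuous_on_open_vimage[OF open_UNIV], intro allI impI)
  fix B :: "'a set" assume "open B"
  show "open (h -` B \<inter> UNIV)"
    using open_disk_coord_preimage[OF assms(1) \<open>open B\<close>] open_disk_coord_preimage[OF assms(2) \<open>open B\<close>]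
    by (simp add: open_mating_sphere_def hemi1_def hemi2_def)
qed

lemma continuous_on_hemi1: "continuous_on (cball 0 1) hemi1"
  unfolding continuous_on_open_invariant
proof (intro allI impI)
  fix U :: "mating_sphere set" assume "open U"
  then obtain V where V: "open V" "{x. abs_mating_sphere (Inl x) \<in> U} = disk_coord -` V"
    by (auto simp: open_mating_sphere_def open_closed_plane_def)
  have "hemi1 w \<in> U \<longleftrightarrow> w \<in> V" if "w \<in> cball 0 1" for w
  proof -
    have "hemi1 w \<in> U \<longleftrightarrow> plane_point w \<in> disk_coord -` V"
      unfolding V(2)[symmetric] by (simp add: hemi1_def)
    then show ?thesis
      using that by (simp add: disk_coord_plane_point)
  qed
  then show "\<exists>A. open A \<and> A \<inter> cball 0 1 = hemi1 -` U \<inter> cball 0 1"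
    using V(1) by (intro exI[of _ V]) auto
qed

lemma continuous_on_hemi2: "continuous_on (cball 0 1) hemi2"
  unfolding continuous_on_open_invariant
proof (intro allI impI)
  fix U :: "mating_sphere set" assume "open U"
  then obtain V where V: "open V" "{x. abs_mating_sphere (Inr x) \<in> U} = disk_coord -` V"
    by (auto simp: open_mating_sphere_def open_closed_plane_def)
  have "hemi2 w \<in> U \<longleftrightarrow> w \<in> V" if "w \<in> cball 0 1" for w
  proof -
    have "hemi2 w \<in> U \<longleftrightarrow> plane_point w \<in> disk_coord -` V"
      unfolding V(2)[symmetric] by (simp add: hemi2_def)
    then show ?thesis
      using that by (simp add: disk_coord_plane_point)
  qed
  then show "\<exists>A. open A \<and> A \<inter> cball 0 1 = hemi2 -` U \<inter> cball 0 1"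
    using V(1) by (intro exI[of _ V]) auto
qed

text \<open>An embedding of the mating sphere into the product of \<open>\<complex>\<close> and \<open>\<real>\<close>. The second coordinate is the
  height above the equator: positive on the first hemisphere, negative on the second.\<close>

lift_definition sphere_coord :: "mating_sphere \<Rightarrow> complex \<times> real" is
  "\<lambda>x. case x of Inl p \<Rightarrow> (disk_coord p, 1 - norm (disk_coord p))
    | Inr p \<Rightarrow> (cnj (disk_coord p), norm (disk_coord p) - 1)"
proof -
  have "norm (Rep_circle u) = 1" for u
    using Rep_circle[of u] by simp
  then show "(case x of Inl p \<Rightarrow> (disk_coord p, 1 - norm (disk_coord p))
      | Inr p \<Rightarrow> (cnj (disk_coord p), norm (disk_coord p) - 1))
    = (case y of Inl p \<Rightarrow> (disk_coord p, 1 - norm (disk_coord p))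
      | Inr p \<Rightarrow> (cnj (disk_coord p), norm (disk_coord p) - 1))" if "glued x y" for x y
    using that by (auto simp: glued_def circle_cnj.rep_eq)
qed

lemma sphere_coord_hemi [simp]:
  "norm w \<le> 1 \<Longrightarrow> sphere_coord (hemi1 w) = (w, 1 - norm w)"
  "norm w \<le> 1 \<Longrightarrow> sphere_coord (hemi2 w) = (cnj w, norm w - 1)"
  by (simp_all add: hemi1_def hemi2_def sphere_coord.abs_eq disk_coord_plane_point)

text \<open>The image of the embedding, and its inverse.\<close>

definition double_cone :: "(complex \<times> real) set" where
  "double_cone = {x. norm (fst x) + \<bar>snd x\<bar> = 1}"

definition sphere_point :: "complex \<times> real \<Rightarrow> mating_sphere" where
  "sphere_point x = (if snd x \<ge> 0 then hemi1 (fst x) else hemi2 (cnj (fst x)))"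

lemma sphere_coord_in: "sphere_coord s \<in> double_cone"
  by (cases s rule: hemi_cases) (auto simp: double_cone_def)

lemma sphere_point_coord [simp]: "sphere_point (sphere_coord s) = s"
  by (cases s rule: hemi_cases) (auto simp: sphere_point_def hemi_circle)

lemma sphere_coord_point: "x \<in> double_cone \<Longrightarrow> sphere_coord (sphere_point x) = x"
  by (auto simp: sphere_point_def double_cone_def prod_eq_iff)

lemma sphere_coord_inject [simp]: "sphere_coord s = sphere_coord s' \<longleftrightarrow> s = s'"
  by (metis sphere_point_coord)

lemma continuous_on_sphere_coord: "continuous_on A sphere_coord"
proof -
  have "continuous_on (cball 0 1) (sphere_coord \<circ> hemi1)"
    by (rule continuous_on_eq[where f = "\<lambda>w. (w, 1 - norm w)"]) (auto intro!: continuous_intros)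
  moreover have "continuous_on (cball 0 1) (sphere_coord \<circ> hemi2)"
    by (rule continuous_on_eq[where f = "\<lambda>w. (cnj w, norm w - 1)"]) (auto intro!: continuous_intros)
  ultimately have "continuous_on UNIV sphere_coord"
    by (rule continuous_from_mating_sphere)
  then show ?thesis
    by (rule continuous_on_subset) simp
qed

lemma continuous_on_sphere_point: "continuous_on double_cone sphere_point"
proof -
  have 1: "continuous_on (double_cone \<inter> {x. snd x \<ge> 0}) (\<lambda>x. hemi1 (fst x))"
    by (rule continuous_on_compose2[OF continuous_on_hemi1])
       (auto simp: double_cone_def intro: continuous_intros)
  have 2: "continuous_on (double_cone \<inter> {x. snd x \<le> 0}) (\<lambda>x. hemi2 (cnj (fst x)))"
    by (rule continuous_on_compose2[OF continuous_on_hemi2])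
       (auto simp: double_cone_def intro!: continuous_intros)
  have cl: "closedin (top_of_set double_cone) (double_cone \<inter> {x. snd x \<ge> 0})"
      "closedin (top_of_set double_cone) (double_cone \<inter> {x. snd x \<le> 0})"
    by (intro closedin_closed_Int closed_Collect_le continuous_intros)+
  have eq: "double_cone = (double_cone \<inter> {x. snd x \<ge> 0}) \<union> (double_cone \<inter> {x. snd x \<le> 0})"
    by auto
  have "continuous_on ((double_cone \<inter> {x. snd x \<ge> 0}) \<union> (double_cone \<inter> {x. snd x \<le> 0}))
      (\<lambda>x. if snd x \<ge> 0 then hemi1 (fst x) else hemi2 (cnj (fst x)))"
  proof (rule continuous_on_cases_local[OF _ _ 1 2])
    show "hemi1 (fst x) = hemi2 (cnj (fst x))"
      if "x \<in> double_cone \<inter> {x. 0 \<le> snd x} \<and> \<not> 0 \<le> snd x \<or> x \<in> double_cone \<inter> {x. snd x \<le> 0} \<and> 0 \<le> snd x" for x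
      using that by (auto simp: double_cone_def intro: hemi_circle)
  qed (use cl in \<open>unfold eq[symmetric], auto\<close>)
  then show ?thesis
    unfolding eq[symmetric] sphere_point_def[abs_def] .
qed

lemma homeomorphism_double_cone: "homeomorphism UNIV double_cone sphere_coord sphere_point"
  unfolding homeomorphism_def
  by (auto simp: sphere_coord_in sphere_coord_point image_iff continuous_on_sphere_coord
      continuous_on_sphere_point intro: exI[of _ "sphere_point _"] exI[of _ "sphere_coord _"])
     (metis sphere_coord_point sphere_point_coord sphere_coord_in)+

lemma compact_double_cone: "compact double_cone"
proof -
  have "closed double_cone"
    unfolding double_cone_def by (intro closed_Collect_eq continuous_intros)
  moreover have "bounded double_cone"
  proof (rule boundedI)
    fix x assume "x \<in> double_cone"
    then have "norm (fst x) + norm (snd x) = 1"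
      by (simp add: double_cone_def)
    moreover have "norm x \<le> norm (fst x) + norm (snd x)"
      using sqrt_sum_squares_le_sum[of "norm (fst x)" "norm (snd x)"] by (simp add: norm_prod_def)
    ultimately show "norm x \<le> 1"
      by simp
  qed
  ultimately show ?thesis
    by (simp add: compact_eq_bounded_closed)
qed

section \<open>Charts of the mating sphere\<close>

text \<open>For \<open>\<sigma> = 1\<close> the unit disk is mapped to the first hemisphere as by \<open>hemi1\<close>, and the annulus
  \<open>1 < norm x < 2\<close> to the second hemisphere without its centre, at height \<open>1 - norm x\<close>. For
  \<open>\<sigma> = -1\<close> the heights are reversed. Each chart omits the centre of one hemisphere.\<close>

definition chart :: "real \<Rightarrow> complex \<Rightarrow> mating_sphere" where
  "chart \<sigma> x = sphere_point
     (((1 - max 0 (norm x - 1)) / (1 + max 0 (norm x - 1))) *\<^sub>R x, \<sigma> * (1 - norm x))"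

definition unchart :: "real \<Rightarrow> mating_sphere \<Rightarrow> complex" where
  "unchart \<sigma> s = ((1 + max 0 (- \<sigma> * snd (sphere_coord s))) / (1 - max 0 (- \<sigma> * snd (sphere_coord s))))
     *\<^sub>R fst (sphere_coord s)"

lemma sphere_coord_chart:
  assumes "\<bar>\<sigma>\<bar> = 1" "norm x < 2"
  shows "sphere_coord (chart \<sigma> x)
    = (((1 - max 0 (norm x - 1)) / (1 + max 0 (norm x - 1))) *\<^sub>R x, \<sigma> * (1 - norm x))"
  unfolding chart_def
proof (rule sphere_coord_point)
  define m where "m = max 0 (norm x - 1)"
  have m: "0 \<le> m" "m < 1"
    using assms by (auto simp: m_def)
  have "(1 - m) / (1 + m) * norm x + \<bar>1 - norm x\<bar> = 1"
  proof (cases "norm x \<le> 1")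
    case False
    then have "norm x = 1 + m"
      by (simp add: m_def)
    then show ?thesis
      using m by simp
  qed (simp add: m_def)
  then show "(((1 - max 0 (norm x - 1)) / (1 + max 0 (norm x - 1))) *\<^sub>R x, \<sigma> * (1 - norm x)) \<in> double_cone"
    unfolding m_def[symmetric] double_cone_def using m assms(1) by (simp add: abs_mult)
qed

lemma unchart_chart:
  assumes "\<bar>\<sigma>\<bar> = 1" "norm x < 2"
  shows "unchart \<sigma> (chart \<sigma> x) = x"
proof -
  have "\<sigma> * \<sigma> = 1"
    using assms(1) by (metis abs_mult_self_eq mult_1)
  then have "- \<sigma> * (\<sigma> * (1 - norm x)) = norm x - 1"
    by (simp add: algebra_simps flip: mult.assoc)
  moreover define m where "m = max 0 (norm x - 1)"
  ultimately have "unchart \<sigma> (chart \<sigma> x) = ((1 + m) / (1 - m)) *\<^sub>R ((1 - m) / (1 + m)) *\<^sub>R x"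
    unfolding unchart_def sphere_coord_chart[OF assms] by simp
  moreover have "0 \<le> m" "m < 1"
    using assms by (auto simp: m_def)
  ultimately show ?thesis
    by simp
qed

lemma norm_unchart:
  assumes "\<bar>\<sigma>\<bar> = 1" "sphere_coord s \<noteq> (0, - \<sigma>)"
  shows "norm (unchart \<sigma> s) = 1 - \<sigma> * snd (sphere_coord s)" "- 1 < \<sigma> * snd (sphere_coord s)"
proof -
  obtain w h where wh: "sphere_coord s = (w, h)"
    by fastforce
  then have n: "norm w + \<bar>h\<bar> = 1"
    using sphere_coord_in[of s] by (simp add: double_cone_def)
  have \<sigma>h: "\<bar>\<sigma> * h\<bar> = \<bar>h\<bar>" and \<sigma>: "\<sigma> = 1 \<or> \<sigma> = -1"
    using assms(1) by (auto simp: abs_mult)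
  show gt: "- 1 < \<sigma> * snd (sphere_coord s)"
  proof (rule ccontr)
    assume "\<not> - 1 < \<sigma> * snd (sphere_coord s)"
    then have "\<sigma> * h \<le> -1"
      by (simp add: wh)
    then have "\<bar>h\<bar> \<ge> 1"
      using \<sigma>h by linarith
    then have "norm w \<le> 0"
      using n by linarith
    then have "w = 0" "\<sigma> * h = -1"
      using n \<sigma>h \<open>\<sigma> * h \<le> -1\<close> by simp_all
    then show False
      using assms(2) \<sigma> by (auto simp: wh)
  qed
  show "norm (unchart \<sigma> s) = 1 - \<sigma> * snd (sphere_coord s)"
  proof (cases "\<sigma> * h \<ge> 0")
    case True
    then show ?thesis
      using n \<sigma>h by (simp add: unchart_def wh)
  next
    case False
    then have "norm w = 1 - (- (\<sigma> * h))" "max 0 (- \<sigma> * h) = - (\<sigma> * h)"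
      using n \<sigma>h by auto
    then show ?thesis
      using gt False by (simp add: unchart_def wh)
  qed
qed

lemma chart_unchart:
  assumes "\<bar>\<sigma>\<bar> = 1" "sphere_coord s \<noteq> (0, - \<sigma>)"
  shows "chart \<sigma> (unchart \<sigma> s) = s"
proof -
  obtain w h where wh: "sphere_coord s = (w, h)"
    by fastforce
  note n = norm_unchart[OF assms, unfolded wh]
  define m where "m = max 0 (- \<sigma> * h)"
  have m: "0 \<le> m" "m < 1"
    using n by (auto simp: m_def)
  have "max 0 (norm (unchart \<sigma> s) - 1) = m"
    using n by (simp add: m_def)
  moreover have "unchart \<sigma> s = ((1 + m) / (1 - m)) *\<^sub>R w"
    by (simp add: unchart_def wh m_def)
  moreover have "\<sigma> * (1 - norm (unchart \<sigma> s)) = h"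
    using n(1) assms(1) by (metis abs_mult_self_eq add_diff_cancel_left' diff_add_cancel mult.assoc mult_1 snd_conv)
  ultimately have "chart \<sigma> (unchart \<sigma> s) = sphere_point (w, h)"
    using m by (simp add: chart_def)
  then show ?thesis
    by (simp flip: wh)
qed

lemma homeomorphism_chart:
  assumes "\<bar>\<sigma>\<bar> = 1"
  shows "homeomorphism (ball 0 2) {s. sphere_coord s \<noteq> (0, - \<sigma>)} (chart \<sigma>) (unchart \<sigma>)"
proof (rule homeomorphismI)
  show "continuous_on (ball 0 2) (chart \<sigma>)"
    unfolding chart_def
  proof (rule continuous_on_compose2[OF continuous_on_sphere_point])
    show "continuous_on (ball 0 2) (\<lambda>x::complex. (((1 - max 0 (norm x - 1)) / (1 + max 0 (norm x - 1))) *\<^sub>R x, \<sigma> * (1 - norm x)))"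
      by (intro continuous_intros) (auto simp: max_def add_nonneg_eq_0_iff)
    show "(\<lambda>x. (((1 - max 0 (norm x - 1)) / (1 + max 0 (norm x - 1))) *\<^sub>R x, \<sigma> * (1 - norm x))) ` ball 0 2 \<subseteq> double_cone"
      using sphere_coord_chart[OF assms] sphere_coord_in by (metis (no_types, lifting) dist_0_norm image_subsetI mem_ball)
  qed
  show "continuous_on {s. sphere_coord s \<noteq> (0, - \<sigma>)} (unchart \<sigma>)"
    unfolding unchart_def
  proof (intro continuous_intros continuous_on_sphere_coord ballI)
    fix s assume "s \<in> {s. sphere_coord s \<noteq> (0, - \<sigma>)}"
    then show "1 - max 0 (- \<sigma> * snd (sphere_coord s)) \<noteq> 0"
      using norm_unchart(2)[OF assms, of s] by (simp add: max_def)
  qed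
  show "chart \<sigma> ` ball 0 2 \<subseteq> {s. sphere_coord s \<noteq> (0, - \<sigma>)}"
    using assms by (auto simp: sphere_coord_chart)
  show "unchart \<sigma> ` {s. sphere_coord s \<noteq> (0, - \<sigma>)} \<subseteq> ball 0 2"
    using norm_unchart[OF assms] by (fastforce simp: dist_norm)
qed (use assms unchart_chart chart_unchart in auto)

lemma open_sphere_coord_preimage: "open B \<Longrightarrow> open {s. sphere_coord s \<in> B}"
  using continuous_on_sphere_coord[of UNIV] by (simp add: continuous_on_open_vimage vimage_def)

lemma open_chart_domain: "open {s. sphere_coord s \<noteq> (0, - \<sigma>)}"
proof -
  have "open {s. sphere_coord s \<in> - {(0, - \<sigma>)}}"
    by (intro open_sphere_coord_preimage open_Compl closed_singleton)
  then show ?thesis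
    by simp
qed

lemma homeomorphism_open_image:
  assumes "homeomorphism S T f g" "open S" "open T" "open U" "U \<subseteq> S"
  shows "open (f ` U)"
  using homeomorphism_imp_open_map[OF assms(1), of U] assms(2-5)
  by (simp add: openin_open_eq)

text \<open>Invariance of domain, applied in charts around \<open>x\<close> and around its image.\<close>

lemma locally_injective_imp_local_homeo:
  fixes \<Phi> :: "mating_sphere \<Rightarrow> mating_sphere"
  assumes cont: "continuous_on UNIV \<Phi>" and "open U" "x \<in> U" "inj_on \<Phi> U"
  shows "local_homeo_at \<Phi> x"
proof -
  have ex: "\<exists>\<sigma>::real. \<bar>\<sigma>\<bar> = 1 \<and> sphere_coord y \<noteq> (0, - \<sigma>)" for y
    by (metis abs_1 abs_minus_cancel minus_minus one_neq_neg_one prod.inject)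
  obtain \<sigma> \<tau> :: real where \<sigma>: "\<bar>\<sigma>\<bar> = 1" "sphere_coord x \<noteq> (0, - \<sigma>)"
    and \<tau>: "\<bar>\<tau>\<bar> = 1" "sphere_coord (\<Phi> x) \<noteq> (0, - \<tau>)"
    using ex by metis
  define D where "D \<sigma> = {s. sphere_coord s \<noteq> (0, - \<sigma>)}" for \<sigma> :: real
  note h\<sigma> = homeomorphism_chart[OF \<sigma>(1), folded D_def] and h\<tau> = homeomorphism_chart[OF \<tau>(1), folded D_def]
  have oD: "open (D \<sigma>)" for \<sigma>
    unfolding D_def by (rule open_chart_domain)
  define U' where "U' = U \<inter> D \<sigma> \<inter> \<Phi> -` D \<tau>"
  have "open (\<Phi> -` D \<tau>)"
    using cont oD by (simp add: continuous_on_open_vimage)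
  then have U': "open U'" "x \<in> U'" "U' \<subseteq> D \<sigma>" "\<Phi> ` U' \<subseteq> D \<tau>"
    using assms oD \<sigma> \<tau> by (auto simp: U'_def D_def)
  define A where "A = unchart \<sigma> ` U'"
  have hA: "homeomorphism U' A (unchart \<sigma>) (chart \<sigma>)"
    using homeomorphism_of_subsets[OF homeomorphism_symD[OF h\<sigma>] U'(3), where T'' = "{}"] by (simp add: A_def)
  have "unchart \<sigma> ` D \<sigma> = ball 0 2"
    using h\<sigma> by (simp add: homeomorphism_def)
  then have A: "open A" "A \<subseteq> ball 0 2"
    using homeomorphism_open_image[OF homeomorphism_symD[OF h\<sigma>] oD open_ball U'(1,3)] U'(3)
    unfolding A_def by blast+
  define k where "k = unchart \<tau> \<circ> \<Phi> \<circ> chart \<sigma>"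
  have cA: "chart \<sigma> ` A = U'"
    using hA by (simp add: homeomorphism_def)
  have kA: "k ` A = unchart \<tau> ` (\<Phi> ` U')"
    using cA by (auto simp: k_def image_comp[symmetric])
  have "continuous_on A k"
    unfolding k_def
  proof (intro continuous_on_compose)
    show "continuous_on A (chart \<sigma>)"
      using hA by (simp add: homeomorphism_def)
    show "continuous_on (chart \<sigma> ` A) \<Phi>"
      using cont continuous_on_subset by blast
    show "continuous_on (\<Phi> ` chart \<sigma> ` A) (unchart \<tau>)"
      unfolding cA using homeomorphism_cont2[OF h\<tau>] U'(4) by (rule continuous_on_subset)
  qed
  moreover have "inj_on k A"
  proof (rule inj_onI)
    fix a b assume ab: "a \<in> A" "b \<in> A" "k a = k b"
    then have c: "chart \<sigma> a \<in> U'" "chart \<sigma> b \<in> U'"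
      using cA by auto
    then have "chart \<tau> (unchart \<tau> (\<Phi> (chart \<sigma> a))) = \<Phi> (chart \<sigma> a)"
      "chart \<tau> (unchart \<tau> (\<Phi> (chart \<sigma> b))) = \<Phi> (chart \<sigma> b)"
      using U'(4) chart_unchart[OF \<tau>(1)] by (auto simp: D_def image_subset_iff)
    moreover have "chart \<tau> (k a) = chart \<tau> (k b)"
      using ab(3) by simp
    ultimately have "\<Phi> (chart \<sigma> a) = \<Phi> (chart \<sigma> b)"
      by (simp add: k_def)
    then have "chart \<sigma> a = chart \<sigma> b"
      using c assms(4) by (auto simp: U'_def inj_on_def)
    then show "a = b"
      using hA ab by (metis homeomorphism_apply2)
  qed
  ultimately obtain k' where k': "homeomorphism A (k ` A) k k'"
    using invariance_of_domain_homeomorphism[OF A(1), of k] by auto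
  have okA: "open (k ` A)"
    using invariance_of_domain[OF \<open>continuous_on A k\<close> A(1) \<open>inj_on k A\<close>] .
  have kA2: "k ` A \<subseteq> ball 0 2"
    using h\<tau> U'(4) unfolding kA homeomorphism_def by blast
  define V' where "V' = chart \<tau> ` (k ` A)"
  have V': "open V'"
    unfolding V'_def using homeomorphism_open_image[OF h\<tau> open_ball oD okA kA2] .
  have hV: "homeomorphism (k ` A) V' (chart \<tau>) (unchart \<tau>)"
    using homeomorphism_of_subsets[OF h\<tau> kA2, where T'' = "{}"] by (simp add: V'_def)
  have comp: "homeomorphism U' V' (chart \<tau> \<circ> (k \<circ> unchart \<sigma>)) ((chart \<sigma> \<circ> k') \<circ> unchart \<tau>)"
    using homeomorphism_compose[OF homeomorphism_compose[OF hA k'] hV] .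
  have "homeomorphism U' V' \<Phi> ((chart \<sigma> \<circ> k') \<circ> unchart \<tau>)"
  proof (rule homeomorphism_cong[OF comp])
    fix y assume y: "y \<in> U'"
    then have "chart \<sigma> (unchart \<sigma> y) = y" "chart \<tau> (unchart \<tau> (\<Phi> y)) = \<Phi> y"
      using U'(3,4) chart_unchart[OF \<tau>(1)] chart_unchart[OF \<sigma>(1)] by (auto simp: D_def image_subset_iff)
    then show "\<Phi> y = (chart \<tau> \<circ> (k \<circ> unchart \<sigma>)) y"
      by (simp add: k_def)
  qed simp_all
  then show ?thesis
    using U' V' unfolding local_homeo_at_def by blast
qed

section \<open>The open hemispheres\<close>

lemma norm_disk_map_less_1:
  assumes "norm w < 1"
  shows "norm (disk_map f w) < 1"
  using norm_disk_less_1[of "poly f (undisk w)"] by (simp add: disk_map_disk[symmetric] disk_undisk[OF assms])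

lemma plane_point_disk [simp]: "plane_point (disk z) = Pt z"
  by (simp add: plane_point_def norm_disk_less_1)

lemma extend_poly_plane_point:
  assumes "norm w \<le> 1" "lead_coeff f = 1" "degree f = d" "d > 0"
  shows "extend_poly d f (plane_point w) = plane_point (disk_map f w)"
proof (cases "norm w < 1")
  case True
  then have "w = disk (undisk w)"
    by (simp add: disk_undisk)
  then show ?thesis
    by (metis disk_map_disk extend_poly.simps(1) plane_point_disk)
next
  case False
  then have w: "norm w = 1"
    using assms by simp
  then have "circle_power (Abs_circle w) d = Abs_circle (w ^ d)"
    by (simp add: circle_power.abs_eq eq_onp_def)
  then show ?thesis
    using w assms disk_map_circle[OF w] by (simp add: plane_point_def norm_power)
qed

text \<open>The two open hemispheres, as copies of the plane.\<close>

definition inc1 :: "complex \<Rightarrow> mating_sphere" where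
  "inc1 z = hemi1 (disk z)"

definition inc2 :: "complex \<Rightarrow> mating_sphere" where
  "inc2 z = hemi2 (disk z)"

lemma sphere_coord_inc [simp]:
  "sphere_coord (inc1 z) = (disk z, 1 - norm (disk z))"
  "sphere_coord (inc2 z) = (cnj (disk z), norm (disk z) - 1)"
  using norm_disk_less_1[of z] by (simp_all add: inc1_def inc2_def)

lemma sphere_cases:
  obtains z where "s = inc1 z" | z where "s = inc2 z" | w where "norm w = 1" "s = hemi1 w"
proof (cases s rule: hemi_cases)
  case (1 w)
  then show thesis
    using that(1)[of "undisk w"] that(3)[of w] by (cases "norm w = 1") (auto simp: inc1_def disk_undisk)
next
  case (2 w)
  then show thesis
    using that(2)[of "undisk w"] that(3)[of "cnj w"] hemi_circle[of "cnj w"]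
    by (cases "norm w = 1") (auto simp: inc2_def disk_undisk)
qed

lemma range_inc1: "range inc1 = {s. snd (sphere_coord s) > 0}"
proof -
  have "s \<in> range inc1 \<longleftrightarrow> snd (sphere_coord s) > 0" for s
  proof
    show "s \<in> range inc1" if "snd (sphere_coord s) > 0"
      using that norm_disk_less_1 by (cases s rule: sphere_cases) (auto dest: less_asym)
  qed (auto simp: norm_disk_less_1)
  then show ?thesis
    by blast
qed

lemma range_inc2: "range inc2 = {s. snd (sphere_coord s) < 0}"
proof -
  have "s \<in> range inc2 \<longleftrightarrow> snd (sphere_coord s) < 0" for s
  proof
    show "s \<in> range inc2" if "snd (sphere_coord s) < 0"
      using that norm_disk_less_1 by (cases s rule: sphere_cases) (auto dest: less_asym)
  qed (auto simp: norm_disk_less_1)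
  then show ?thesis
    by blast
qed

lemma homeomorphism_inc1: "homeomorphism UNIV (range inc1) inc1 (\<lambda>s. undisk (fst (sphere_coord s)))"
proof (rule homeomorphismI)
  show "continuous_on UNIV inc1"
    unfolding inc1_def[abs_def]
    by (rule continuous_on_compose2[OF continuous_on_hemi1 continuous_on_disk]) (auto simp: less_imp_le norm_disk_less_1)
  show "continuous_on (range inc1) (\<lambda>s. undisk (fst (sphere_coord s)))"
    by (rule continuous_on_compose2[OF continuous_on_undisk])
       (auto intro!: continuous_intros continuous_on_sphere_coord simp: norm_disk_less_1)
qed auto

lemma homeomorphism_inc2: "homeomorphism UNIV (range inc2) inc2 (\<lambda>s. undisk (cnj (fst (sphere_coord s))))"
proof (rule homeomorphismI)
  show "continuous_on UNIV inc2"
    unfolding inc2_def[abs_def]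
    by (rule continuous_on_compose2[OF continuous_on_hemi2 continuous_on_disk]) (auto simp: less_imp_le norm_disk_less_1)
  show "continuous_on (range inc2) (\<lambda>s. undisk (cnj (fst (sphere_coord s))))"
    by (rule continuous_on_compose2[OF continuous_on_undisk])
       (auto intro!: continuous_intros continuous_on_sphere_coord simp: norm_disk_less_1)
qed auto

lemma open_range_inc: "open (range inc1)" "open (range inc2)"
  unfolding range_inc1 range_inc2
  using open_sphere_coord_preimage[of "{x. snd x > 0}"] open_sphere_coord_preimage[of "{x. snd x < 0}"]
  by (simp_all add: open_Collect_less continuous_on_snd)

lemma inc_eq_iff [simp]: "inc1 z = inc1 z' \<longleftrightarrow> z = z'" "inc2 z = inc2 z' \<longleftrightarrow> z = z'"
  using homeomorphism_apply1[OF homeomorphism_inc1] homeomorphism_apply1[OF homeomorphism_inc2] by (metis UNIV_I)+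

lemma inc1_neq_inc2 [simp]: "inc1 z \<noteq> inc2 z'"
proof
  assume "inc1 z = inc2 z'"
  then have "1 - norm (disk z) = norm (disk z') - 1"
    by (metis snd_conv sphere_coord_inc)
  then show False
    using norm_disk_less_1[of z] norm_disk_less_1[of z'] by simp
qed

section \<open>Critical points of the formal mating\<close>

lemma forward_orbit_image:
  assumes "\<And>z. F (i z) = i (f z)"
  shows "forward_orbit F (i ` C) = i ` forward_orbit f C"
proof -
  have "(F ^^ n) (i z) = i ((f ^^ n) z)" for n z
    by (induction n) (simp_all add: assms)
  then show ?thesis
    unfolding forward_orbit_def image_UN image_image by simp
qed

lemma forward_orbit_Un: "forward_orbit F (A \<union> B) = forward_orbit F A \<union> forward_orbit F B"
  unfolding forward_orbit_def by blast

lemma forward_orbit_invariant: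
  assumes "x \<in> forward_orbit F C"
  shows "F x \<in> forward_orbit F C"
proof -
  obtain n c where "n \<ge> 1" "c \<in> C" "x = (F ^^ n) c"
    using assms by (auto simp: forward_orbit_def)
  then show ?thesis
    unfolding forward_orbit_def by (intro UN_I[of "Suc n"] image_eqI[of _ _ c]) auto
qed

lemma poly_surj_complex:
  assumes "degree f > 0"
  shows "\<exists>z. poly f z = (w::complex)"
proof -
  have "degree (f + [:- w:]) \<noteq> 0"
    using assms degree_add_eq_left[of "[:- w:]" f] by simp
  then have "\<exists>z. poly (f + [:- w:]) z = 0"
    by (intro fundamental_theorem_of_algebra_alt) auto
  then show ?thesis
    by auto
qed

lemma inc2_neq_inc1 [simp]: "inc2 z \<noteq> inc1 z'"
  using inc1_neq_inc2 by metis

text \<open>Two monic polynomials of the same positive degree.\<close>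

locale monic_pair =
  fixes d :: nat and f1 f2 :: "complex poly"
  assumes d: "d > 0" and deg: "degree f1 = d" "degree f2 = d"
    and monic: "lead_coeff f1 = 1" "lead_coeff f2 = 1"
begin

abbreviation "F \<equiv> formal_mating d f1 f2"
abbreviation "P1 \<equiv> poly_post_critical f1"
abbreviation "P2 \<equiv> poly_post_critical f2"
abbreviation "PF \<equiv> branched_post_critical F"

lemma F_hemi:
  assumes "norm w \<le> 1"
  shows "F (hemi1 w) = hemi1 (disk_map f1 w)" "F (hemi2 w) = hemi2 (disk_map f2 w)"
  using assms d deg monic
  by (simp_all add: hemi1_def hemi2_def formal_mating.abs_eq extend_poly_plane_point)

lemma F_inc: "F (inc1 z) = inc1 (poly f1 z)" "F (inc2 z) = inc2 (poly f2 z)"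
  using norm_disk_less_1[of z] by (simp_all add: inc1_def inc2_def F_hemi disk_map_disk)

lemma F_circle: "norm w = 1 \<Longrightarrow> F (hemi1 w) = hemi1 (w ^ d)"
  using d deg monic by (simp add: F_hemi disk_map_circle)

lemma continuous_on_F: "continuous_on A F"
proof -
  have norm_le: "norm (disk_map f w) \<le> 1" if "norm w \<le> 1" "lead_coeff f = 1" "degree f = d" for w f
    using that d norm_disk_map_less_1[of w f] disk_map_circle[of w f]
    by (cases "norm w = 1") (auto simp: norm_power)
  have "continuous_on (cball 0 1) (\<lambda>w. hemi1 (disk_map f1 w))"
    using deg monic norm_le
    by (intro continuous_on_compose2[OF continuous_on_hemi1 continuous_on_disk_map]) auto
  then have "continuous_on (cball 0 1) (F \<circ> hemi1)"
    by (rule continuous_on_eq) (simp add: F_hemi)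
  moreover have "continuous_on (cball 0 1) (\<lambda>w. hemi2 (disk_map f2 w))"
    using deg monic norm_le
    by (intro continuous_on_compose2[OF continuous_on_hemi2 continuous_on_disk_map]) auto
  then have "continuous_on (cball 0 1) (F \<circ> hemi2)"
    by (rule continuous_on_eq) (simp add: F_hemi)
  ultimately have "continuous_on UNIV F"
    by (rule continuous_from_mating_sphere)
  then show ?thesis
    by (rule continuous_on_subset) simp
qed

lemma snd_F:
  "snd (sphere_coord (F s)) > 0 \<longleftrightarrow> snd (sphere_coord s) > 0"
  "snd (sphere_coord (F s)) < 0 \<longleftrightarrow> snd (sphere_coord s) < 0"
proof -
  have "(snd (sphere_coord (F s)) > 0 \<longleftrightarrow> snd (sphere_coord s) > 0)
      \<and> (snd (sphere_coord (F s)) < 0 \<longleftrightarrow> snd (sphere_coord s) < 0)"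
  proof (cases s rule: sphere_cases)
    case (1 z)
    then show ?thesis
      using norm_disk_less_1[of z] norm_disk_less_1[of "poly f1 z"] by (simp add: F_inc)
  next
    case (2 z)
    then show ?thesis
      using norm_disk_less_1[of z] norm_disk_less_1[of "poly f2 z"] by (simp add: F_inc)
  next
    case (3 w)
    then show ?thesis
      by (simp add: F_circle norm_power)
  qed
  then show "snd (sphere_coord (F s)) > 0 \<longleftrightarrow> snd (sphere_coord s) > 0"
    "snd (sphere_coord (F s)) < 0 \<longleftrightarrow> snd (sphere_coord s) < 0"
    by blast+
qed

lemma F_in_range_inc: "F s \<in> range inc1 \<longleftrightarrow> s \<in> range inc1" "F s \<in> range inc2 \<longleftrightarrow> s \<in> range inc2"
  unfolding range_inc1 range_inc2 by (simp_all add: snd_F)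

lemma surj_F: "surj F"
proof -
  have "\<exists>s'. s = F s'" for s
  proof (cases s rule: sphere_cases)
    case (1 z)
    then show ?thesis
      using poly_surj_complex[of f1 z] d deg F_inc by metis
  next
    case (2 z)
    then show ?thesis
      using poly_surj_complex[of f2 z] d deg F_inc by metis
  next
    case (3 w)
    obtain u where "u ^ d = w"
      using poly_surj_complex[of "monom 1 d" w] d by (auto simp: degree_monom_eq poly_monom)
    moreover from this have "norm u ^ d = 1"
      using 3(1) by (simp flip: norm_power)
    then have "norm u = 1"
      using d power_eq_1_iff[of "norm u" d] by simp
    ultimately show ?thesis
      using 3(2) F_circle by metis
  qed
  then show ?thesis
    unfolding surj_def by blast
qed

text \<open>In the open hemispheres the critical points are those of the polynomials, since a holomorphic
  map is locally injective exactly where its derivative does not vanish.\<close>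

lemma local_homeo_inc:
  "local_homeo_at F (inc1 z) \<longleftrightarrow> poly (pderiv f1) z \<noteq> 0"
  "local_homeo_at F (inc2 z) \<longleftrightarrow> poly (pderiv f2) z \<noteq> 0"
proof -
  have main: "local_homeo_at F (i z) \<longleftrightarrow> poly (pderiv f) z \<noteq> 0"
    if i: "homeomorphism UNIV (range i) i j" "open (range i)" "\<And>z. F (i z) = i (poly f z)" for i j f
  proof
    have inj: "i a = i b \<longleftrightarrow> a = b" for a b
      using homeomorphism_apply1[OF i(1)] by (metis UNIV_I)
    assume "local_homeo_at F (i z)"
    then obtain U V g where U: "open U" "i z \<in> U" "homeomorphism U V F g"
      unfolding local_homeo_at_def by blast
    have "inj_on (poly f) (i -` U)"
      using homeomorphism_apply1[OF U(3)] i(3) inj by (intro inj_onI) (metis vimageE)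
    moreover have "open (i -` U)"
      using homeomorphism_cont1[OF i(1)] U(1) by (simp add: continuous_on_open_vimage)
    ultimately show "poly (pderiv f) z \<noteq> 0"
      using U(2) by (intro poly_injective_imp_regular) auto
  next
    assume "poly (pderiv f) z \<noteq> 0"
    then obtain r where r: "r > 0" "inj_on (poly f) (ball z r)"
      using poly_locally_injective by blast
    have inj: "i a = i b \<longleftrightarrow> a = b" for a b
      using homeomorphism_apply1[OF i(1)] by (metis UNIV_I)
    show "local_homeo_at F (i z)"
    proof (rule locally_injective_imp_local_homeo[OF continuous_on_F])
      show "open (i ` ball z r)"
        using homeomorphism_open_image[OF i(1) open_UNIV i(2) open_ball] by simp
      show "inj_on F (i ` ball z r)"
        using r(2) i(3) inj by (auto simp: inj_on_def)
    qed (use r(1) in auto)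
  qed
  show "local_homeo_at F (inc1 z) \<longleftrightarrow> poly (pderiv f1) z \<noteq> 0"
    using homeomorphism_inc1 open_range_inc(1) F_inc(1) by (rule main)
  show "local_homeo_at F (inc2 z) \<longleftrightarrow> poly (pderiv f2) z \<noteq> 0"
    using homeomorphism_inc2 open_range_inc(2) F_inc(2) by (rule main)
qed

text \<open>The two open hemispheres and the equator are preserved, so local injectivity can be checked on
  each of them separately.\<close>

lemma local_homeo_circle:
  assumes u: "norm u = 1"
  shows "local_homeo_at F (hemi1 u)"
proof -
  obtain \<delta>1 where \<delta>1: "\<delta>1 > 0"
    "\<And>z z'. \<lbrakk>norm (disk z - u) < \<delta>1; norm (disk z' - u) < \<delta>1; poly f1 z = poly f1 z'\<rbrakk> \<Longrightarrow> z = z'"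
    using monic_poly_injective_near_infinity[of f1 u] deg monic d u by metis
  obtain \<delta>2 where \<delta>2: "\<delta>2 > 0"
    "\<And>z z'. \<lbrakk>norm (disk z - cnj u) < \<delta>2; norm (disk z' - cnj u) < \<delta>2; poly f2 z = poly f2 z'\<rbrakk> \<Longrightarrow> z = z'"
    using monic_poly_injective_near_infinity[of f2 "cnj u"] deg monic d u by (metis complex_mod_cnj)
  obtain \<delta>3 where \<delta>3: "\<delta>3 > 0" "inj_on (\<lambda>w. w ^ d) (ball u \<delta>3)"
  proof (rule power_locally_injective[of u d])
    show "u \<noteq> 0"
      using u by auto
  qed (use d in auto)
  define \<delta> where "\<delta> = min \<delta>1 (min \<delta>2 \<delta>3)"
  define U where "U = {s. sphere_coord s \<in> ball u \<delta> \<times> UNIV}"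
  have U1: "inc1 z \<in> U \<longleftrightarrow> norm (disk z - u) < \<delta>" for z
    by (simp add: U_def dist_norm norm_minus_commute)
  have U2: "inc2 z \<in> U \<longleftrightarrow> norm (disk z - cnj u) < \<delta>" for z
  proof -
    have "norm (cnj (disk z) - u) = norm (disk z - cnj u)"
      by (metis complex_cnj_cnj complex_cnj_diff complex_mod_cnj)
    then show ?thesis
      by (simp add: U_def dist_norm norm_minus_commute)
  qed
  have "s = s'" if s: "s \<in> U" "s' \<in> U" "F s = F s'" for s s'
  proof (cases s rule: sphere_cases)
    case (1 z)
    then have "F s' \<in> range inc1"
      using s(3) by (metis F_inc(1) rangeI)
    then obtain z' where z': "s' = inc1 z'"
      using F_in_range_inc by blast
    then show ?thesis
      using s 1 \<delta>1(2)[of z z'] U1 by (simp add: F_inc \<delta>_def)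
  next
    case (2 z)
    then have "F s' \<in> range inc2"
      using s(3) by (metis F_inc(2) rangeI)
    then obtain z' where z': "s' = inc2 z'"
      using F_in_range_inc by blast
    then show ?thesis
      using s 2 \<delta>2(2)[of z z'] U2 by (simp add: F_inc \<delta>_def)
  next
    case (3 w)
    then have "snd (sphere_coord (F s')) = 0"
      using s(3) by (metis F_circle cancel_comm_monoid_add_class.diff_cancel norm_power order_refl
          power_one snd_conv sphere_coord_hemi(1))
    then have "snd (sphere_coord s') = 0"
      using snd_F[of s'] by linarith
    then obtain w' where w': "norm w' = 1" "s' = hemi1 w'"
    proof (cases s' rule: sphere_cases)
      case (1 z)
      then show thesis
        using \<open>snd (sphere_coord s') = 0\<close> norm_disk_less_1[of z] by simp
    next
      case (2 z)
      then show thesis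
        using \<open>snd (sphere_coord s') = 0\<close> norm_disk_less_1[of z] by simp
    qed
    have "sphere_coord (F s) = sphere_coord (F s')"
      using s(3) by simp
    then have "w ^ d = w' ^ d"
      using 3 w' by (simp add: F_circle norm_power)
    moreover have "w \<in> ball u \<delta>3" "w' \<in> ball u \<delta>3"
      using s 3 w' by (simp_all add: U_def \<delta>_def)
    ultimately show ?thesis
      using inj_onD[OF \<delta>3(2)] 3 w' by blast
  qed
  then have "inj_on F U"
    by (rule inj_onI)
  moreover have "open U"
    unfolding U_def by (intro open_sphere_coord_preimage open_Times open_ball open_UNIV)
  moreover have "hemi1 u \<in> U"
    using u \<delta>1(1) \<delta>2(1) \<delta>3(1) by (simp add: U_def \<delta>_def)
  ultimately show ?thesis
    using locally_injective_imp_local_homeo[OF continuous_on_F] by blast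
qed

lemma PF_eq: "PF = inc1 ` P1 \<union> inc2 ` P2"
proof -
  have "{x. \<not> local_homeo_at F x} = inc1 ` {z. poly (pderiv f1) z = 0} \<union> inc2 ` {z. poly (pderiv f2) z = 0}"
  proof (rule Set.set_eqI)
    fix x
    show "x \<in> {x. \<not> local_homeo_at F x}
      \<longleftrightarrow> x \<in> inc1 ` {z. poly (pderiv f1) z = 0} \<union> inc2 ` {z. poly (pderiv f2) z = 0}"
    proof (cases x rule: sphere_cases)
      case (3 w)
      then have "snd (sphere_coord x) = 0"
        by simp
      then have "x \<notin> range inc1" "x \<notin> range inc2"
        unfolding range_inc1 range_inc2 by simp_all
      then show ?thesis
        using 3 local_homeo_circle by auto
    qed (auto simp: local_homeo_inc)
  qed
  then show ?thesis
    unfolding branched_post_critical_def poly_post_critical_def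
    by (simp add: forward_orbit_Un forward_orbit_image F_inc)
qed

lemma inc_in_PF: "inc1 z \<in> PF \<longleftrightarrow> z \<in> P1" "inc2 z \<in> PF \<longleftrightarrow> z \<in> P2"
  unfolding PF_eq by auto

lemma F_PF: "x \<in> PF \<Longrightarrow> F x \<in> PF"
  unfolding branched_post_critical_def by (rule forward_orbit_invariant)

lemma critical_value_in_PF: "\<not> local_homeo_at F x \<Longrightarrow> F x \<in> PF"
  unfolding branched_post_critical_def forward_orbit_def
  by (intro UN_I[of 1] image_eqI[of _ _ x]) auto

end

section \<open>The decomposition of the punctured sphere\<close>

lemma finite_positive_bound:
  assumes "finite A" "\<And>a. a \<in> A \<Longrightarrow> 0 < (f a :: real)"
  obtains \<epsilon> where "0 < \<epsilon>" "\<epsilon> < 1" "\<And>a. a \<in> A \<Longrightarrow> \<epsilon> < f a"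
proof -
  have "\<exists>\<epsilon>. 0 < \<epsilon> \<and> \<epsilon> < 1 \<and> (\<forall>a\<in>A. \<epsilon> < f a)"
    using assms
  proof (induction A rule: finite_induct)
    case empty
    then show ?case
      by (intro exI[of _ "1/2"]) simp
  next
    case (insert b A)
    then obtain \<epsilon> where "0 < \<epsilon>" "\<epsilon> < 1" "\<forall>a\<in>A. \<epsilon> < f a"
      by blast
    moreover have "f b > 0"
      using insert.prems by simp
    ultimately show ?case
      by (intro exI[of _ "min \<epsilon> (f b) / 2"]) (auto simp: min_def)
  qed
  then show ?thesis
    using that by blast
qed

lemma path_connected_open_minus_finite:
  fixes S :: "complex set"
  assumes "open S" "connected S" "finite T"
  shows "path_connected (S - T)"
proof -
  have "open (S - T)"
    using assms by (intro open_Diff finite_imp_closed)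
  moreover have "connected (S - T)"
    using assms by (intro connected_open_delete_finite) auto
  ultimately show ?thesis
    by (rule connected_open_path_connected)
qed

text \<open>The nearest point retraction of the plane onto the disk of radius \<open>R\<close>.\<close>

definition radial_retract :: "real \<Rightarrow> complex \<Rightarrow> complex" where
  "radial_retract R x = (R / max R (norm x)) *\<^sub>R x"

lemma radial_retract:
  assumes "R > 0"
  shows "continuous_on A (radial_retract R)" "norm (radial_retract R x) \<le> R" "norm x \<le> R \<Longrightarrow> radial_retract R x = x"
    and "y \<in> closed_segment x (radial_retract R x) \<Longrightarrow> norm y \<le> norm x"
    and "y \<in> closed_segment x (radial_retract R x) \<Longrightarrow> y = x \<or> R \<le> norm y"
proof -
  have m: "max R (norm z) > 0" for z :: complex
    using assms by (simp add: less_max_iff_disj)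
  show "continuous_on A (radial_retract R)"
    unfolding radial_retract_def[abs_def] by (intro continuous_intros) (use m in \<open>metis less_irrefl\<close>)
  have "norm (radial_retract R x) = R * (norm x / max R (norm x))"
    using assms m[of x] by (simp add: radial_retract_def abs_mult)
  also have "\<dots> \<le> R * 1"
    using assms m[of x] by (intro mult_left_mono) (simp_all add: divide_le_eq_1)
  finally show "norm (radial_retract R x) \<le> R"
    by simp
  show id: "radial_retract R x = x" if "norm x \<le> R"
    using that assms by (simp add: radial_retract_def max_def)
  assume "y \<in> closed_segment x (radial_retract R x)"
  then obtain u where u: "0 \<le> u" "u \<le> 1" "y = (1 - u) *\<^sub>R x + u *\<^sub>R radial_retract R x"
    by (auto simp: in_segment)
  define c where "c = (1 - u) + u * (R / max R (norm x))"
  have y: "y = c *\<^sub>R x"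
    unfolding u(3) radial_retract_def[abs_def] c_def by (simp add: scaleR_left_distrib)
  have q: "0 \<le> R / max R (norm x)" "R / max R (norm x) \<le> 1"
    using assms m[of x] by (simp_all add: divide_le_eq_1)
  then have "u * (R / max R (norm x)) \<le> u * 1"
    using u by (intro mult_left_mono) auto
  moreover have "0 \<le> u * (R / max R (norm x))"
    using u q by (intro mult_nonneg_nonneg)
  ultimately have c: "0 \<le> c" "c \<le> 1"
    using u unfolding c_def by linarith+
  then show "norm y \<le> norm x"
    using y by (simp add: mult_left_le_one_le)
  show "y = x \<or> R \<le> norm y"
  proof (cases "norm x \<le> R")
    case True
    then show ?thesis
      using u id[OF True] by (simp add: scaleR_left_distrib[symmetric])
  next
    case False
    have "norm y = c * norm x"
      unfolding y using c(1) by simp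
    also have "\<dots> = (1 - u) * norm x + u * (R / norm x * norm x)"
      using False by (simp add: c_def max_def algebra_simps)
    also have "\<dots> = (1 - u) * norm x + u * R"
      using False assms by auto
    finally have "norm y = (1 - u) * norm x + u * R" .
    moreover have "(1 - u) * R \<le> (1 - u) * norm x"
      using False u by (intro mult_left_mono) auto
    ultimately show ?thesis
      by (simp add: algebra_simps)
  qed
qed

lemma chart_eq_hemi1: "norm x \<le> 1 \<Longrightarrow> chart 1 x = hemi1 x"
  by (simp add: chart_def sphere_point_def)

lemma chart_eq_inc1: "norm x < 1 \<Longrightarrow> chart 1 x = inc1 (undisk x)"
  by (simp add: chart_eq_hemi1 inc1_def disk_undisk)

context monic_pair
begin

abbreviation "M \<equiv> UNIV - PF"
abbreviation "M1 \<equiv> UNIV - F -` PF"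

lemma finite_PF: "finite P1 \<Longrightarrow> finite P2 \<Longrightarrow> finite PF"
  by (simp add: PF_eq)

lemma open_M:
  assumes "finite P1" "finite P2"
  shows "open M"
proof -
  have "open {s. sphere_coord s \<in> - (sphere_coord ` PF)}"
    using finite_PF[OF assms] by (intro open_sphere_coord_preimage open_Compl finite_imp_closed finite_imageI)
  moreover have "{s. sphere_coord s \<in> - (sphere_coord ` PF)} = M"
    by auto
  ultimately show ?thesis
    by simp
qed

lemma path_lifting_F:
  assumes fin: "finite P1" "finite P2"
  shows "path_lifting F M1 M"
proof (rule covering_space_imp_path_lifting[OF homeomorphism_double_cone])
  let ?G = "sphere_coord \<circ> F \<circ> sphere_point"
  note hd = homeomorphism_double_cone
  have open_image: "openin (top_of_set double_cone) (sphere_coord ` U)" if "open U" for U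
    using homeomorphism_imp_open_map[OF hd, of U] that by simp
  have cont: "continuous_on double_cone ?G"
    using homeomorphism_cont2[OF hd] continuous_on_F continuous_on_sphere_coord
    by (intro continuous_on_compose) auto
  have "covering_space (double_cone \<inter> ?G -` (sphere_coord ` M)) ?G (sphere_coord ` M)"
  proof (rule local_homeomorphism_imp_covering_space[OF compact_double_cone cont])
    show "?G \<in> double_cone \<rightarrow> double_cone"
      using sphere_coord_in by auto
    show "closed (?G ` T)" if "compact T" "T \<subseteq> double_cone" for T
      using that cont by (intro compact_imp_closed compact_continuous_image) (auto intro: continuous_on_subset)
    show "openin (top_of_set double_cone) (sphere_coord ` M)"
      using open_image open_M[OF fin] by blast
    show "sphere_coord ` M \<subseteq> ?G ` double_cone"
    proof
      fix x assume "x \<in> sphere_coord ` M"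
      then obtain s where "x = sphere_coord (F s)"
        using surj_F by (metis imageE surjD)
      then show "x \<in> ?G ` double_cone"
        by (intro image_eqI[of _ _ "sphere_coord s"]) (auto simp: sphere_coord_in)
    qed
    fix x assume x: "x \<in> double_cone" "?G x \<in> sphere_coord ` M"
    then have "F (sphere_point x) \<notin> PF"
      by auto
    then have "local_homeo_at F (sphere_point x)"
      using critical_value_in_PF by blast
    then obtain U V g where U: "open U" "sphere_point x \<in> U" "open V" "homeomorphism U V F g"
      unfolding local_homeo_at_def by blast
    have hU: "homeomorphism (sphere_coord ` U) U sphere_point sphere_coord"
      by (rule homeomorphism_symD, rule homeomorphism_of_subsets[OF hd, where T'' = "{}"]) auto
    have hV: "homeomorphism V (sphere_coord ` V) sphere_coord sphere_point"
      by (rule homeomorphism_of_subsets[OF hd, where T'' = "{}"]) auto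
    have "homeomorphism (sphere_coord ` U) (sphere_coord ` V) (sphere_coord \<circ> (F \<circ> sphere_point)) ((sphere_coord \<circ> g) \<circ> sphere_point)"
      using homeomorphism_compose[OF homeomorphism_compose[OF hU U(4)] hV] .
    moreover have "x \<in> sphere_coord ` U"
      using U(2) x(1) by (metis imageI sphere_coord_point)
    ultimately show "\<exists>U V g. openin (top_of_set double_cone) U \<and> x \<in> U
        \<and> openin (top_of_set double_cone) V \<and> homeomorphism U V ?G g"
      using open_image U(1,3) by (metis comp_assoc)
  qed
  moreover have "double_cone \<inter> ?G -` (sphere_coord ` M) = sphere_coord ` M1"
  proof (intro equalityI subsetI)
    fix x assume "x \<in> double_cone \<inter> ?G -` (sphere_coord ` M)"
    then have "sphere_point x \<in> M1" "x = sphere_coord (sphere_point x)"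
      by (auto simp: sphere_coord_point)
    then show "x \<in> sphere_coord ` M1"
      by blast
  qed (auto simp: sphere_coord_in)
  ultimately show "covering_space (sphere_coord ` M1) ?G (sphere_coord ` M)"
    by simp
  show "M1 \<subseteq> M"
    using F_PF by blast
qed (rule continuous_on_F)

lemma invariant_part_inc1:
  assumes "finite P1" "finite P2"
  shows "invariant_part F M1 M (poly f1) inc1 (\<lambda>s. undisk (fst (sphere_coord s)))"
proof -
  interpret path_lifting F M1 M
    using assms by (rule path_lifting_F)
  show ?thesis
    by unfold_locales (use homeomorphism_inc1 F_inc F_in_range_inc in auto)
qed

lemma invariant_part_inc2:
  assumes "finite P1" "finite P2"
  shows "invariant_part F M1 M (poly f2) inc2 (\<lambda>s. undisk (cnj (fst (sphere_coord s))))"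
proof -
  interpret path_lifting F M1 M
    using assms by (rule path_lifting_F)
  show ?thesis
    by unfold_locales (use homeomorphism_inc2 F_inc F_in_range_inc in auto)
qed

lemma vimage_M:
  "inc1 -` M = UNIV - P1" "inc1 -` M1 = UNIV - poly f1 -` P1"
  "inc2 -` M = UNIV - P2" "inc2 -` M1 = UNIV - poly f2 -` P2"
  by (auto simp: F_inc inc_in_PF)

text \<open>The first hemisphere together with a collar of width \<open>\<epsilon>\<close> below the equator, without the
  post-critical set. For small \<open>\<epsilon>\<close> the collar avoids the post-critical points of the second
  polynomial.\<close>

definition collar :: "real \<Rightarrow> mating_sphere set" where
  "collar \<epsilon> = {s. snd (sphere_coord s) > - \<epsilon>} - PF"

lemma collar_eq:
  assumes \<epsilon>: "0 < \<epsilon>" "\<epsilon> < 1" "\<And>p. p \<in> P2 \<Longrightarrow> \<epsilon> < 1 - norm (disk p)"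
  shows "collar \<epsilon> = chart 1 ` (ball 0 (1 + \<epsilon>) - disk ` P1)"
proof (intro equalityI subsetI)
  fix s assume s: "s \<in> collar \<epsilon>"
  then have ne: "sphere_coord s \<noteq> (0, - 1)"
    using \<epsilon> by (auto simp: collar_def)
  define x where "x = unchart 1 s"
  have x: "chart 1 x = s" "norm x = 1 - snd (sphere_coord s)"
    unfolding x_def using chart_unchart[of 1 s] norm_unchart(1)[of 1 s] ne by simp_all
  have "x \<notin> disk ` P1"
    using x(1) s by (auto simp: chart_eq_inc1 norm_disk_less_1 collar_def inc_in_PF)
  then show "s \<in> chart 1 ` (ball 0 (1 + \<epsilon>) - disk ` P1)"
    using x s by (intro image_eqI[of _ _ x]) (auto simp: collar_def)
next
  fix s assume "s \<in> chart 1 ` (ball 0 (1 + \<epsilon>) - disk ` P1)"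
  then obtain x where x: "s = chart 1 x" "norm x < 1 + \<epsilon>" "x \<notin> disk ` P1"
    by auto
  then have h: "snd (sphere_coord s) = 1 - norm x"
    using \<epsilon> sphere_coord_chart[of 1 x] by simp
  have "s \<noteq> inc1 p" if "p \<in> P1" for p
  proof
    assume "s = inc1 p"
    then have "unchart 1 (chart 1 x) = unchart 1 (chart 1 (disk p))"
      using x(1) by (simp add: chart_eq_inc1 norm_disk_less_1)
    moreover have "norm x < 2" "norm (disk p) < 2"
      using x(2) \<epsilon> norm_disk_less_1[of p] by simp_all
    ultimately have "x = disk p"
      by (simp add: unchart_chart)
    then show False
      using x(3) that by blast
  qed
  moreover have "s \<noteq> inc2 p" if "p \<in> P2" for p
    using \<epsilon>(3)[OF that] h x(2) by auto
  ultimately show "s \<in> collar \<epsilon>"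
    using h x(2) by (auto simp: collar_def PF_eq)
qed

lemma open_collar:
  assumes "finite P1" "finite P2"
  shows "open (collar \<epsilon>)"
proof -
  have "open {s. sphere_coord s \<in> {x. snd x > - \<epsilon>}}"
    by (intro open_sphere_coord_preimage open_Collect_less continuous_intros)
  then have "open ({s. snd (sphere_coord s) > - \<epsilon>} \<inter> M)"
    using open_M[OF assms] by auto
  moreover have "{s. snd (sphere_coord s) > - \<epsilon>} \<inter> M = collar \<epsilon>"
    by (auto simp: collar_def)
  ultimately show ?thesis
    by simp
qed

lemma continuous_on_chart: "A \<subseteq> ball 0 2 \<Longrightarrow> continuous_on A (chart 1)"
  using homeomorphism_cont1[OF homeomorphism_chart[of 1]] continuous_on_subset by auto

lemma path_connected_collar:
  assumes "finite P1" "0 < \<epsilon>" "\<epsilon> < 1" "\<And>p. p \<in> P2 \<Longrightarrow> \<epsilon> < 1 - norm (disk p)"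
  shows "path_connected (collar \<epsilon>)"
proof -
  have "collar \<epsilon> = chart 1 ` (ball 0 (1 + \<epsilon>) - disk ` P1)"
    by (rule collar_eq) (use assms in auto)
  then show ?thesis
    using assms
    by (auto intro!: path_connected_continuous_image continuous_on_chart path_connected_open_minus_finite)
qed

lemma second_part_eq: "range inc2 - PF = inc2 ` (UNIV - P2)"
  by (auto simp: inc_in_PF)

lemma path_connected_second_part:
  assumes "finite P2"
  shows "path_connected (range inc2 - PF)"
  unfolding second_part_eq using assms homeomorphism_cont1[OF homeomorphism_inc2] continuous_on_subset
  by (intro path_connected_continuous_image path_connected_open_minus_finite) auto

lemma collar_Int_second_part:
  assumes "0 < \<epsilon>" "\<epsilon> < 1" "\<And>p. p \<in> P2 \<Longrightarrow> \<epsilon> < 1 - norm (disk p)"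
  shows "collar \<epsilon> \<inter> (range inc2 - PF) = chart 1 ` {x. 1 < norm x \<and> norm x < 1 + \<epsilon>}"
proof (intro equalityI subsetI)
  fix s assume "s \<in> collar \<epsilon> \<inter> (range inc2 - PF)"
  then have s: "- \<epsilon> < snd (sphere_coord s)" "snd (sphere_coord s) < 0"
    by (auto simp: collar_def range_inc2)
  then have ne: "sphere_coord s \<noteq> (0, - 1)"
    using assms by auto
  have "s = chart 1 (unchart 1 s)" "norm (unchart 1 s) = 1 - snd (sphere_coord s)"
    using chart_unchart[of 1 s] norm_unchart(1)[of 1 s] ne by simp_all
  then show "s \<in> chart 1 ` {x. 1 < norm x \<and> norm x < 1 + \<epsilon>}"
    using s by (intro image_eqI[of _ _ "unchart 1 s"]) auto
next
  fix s assume "s \<in> chart 1 ` {x. 1 < norm x \<and> norm x < 1 + \<epsilon>}"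
  then obtain x where x: "s = chart 1 x" "1 < norm x" "norm x < 1 + \<epsilon>"
    by auto
  moreover have "x \<notin> disk ` P1"
    using x(2) norm_disk_less_1 less_asym by blast
  moreover have "collar \<epsilon> = chart 1 ` (ball 0 (1 + \<epsilon>) - disk ` P1)"
    by (rule collar_eq) (use assms in auto)
  ultimately have "s \<in> collar \<epsilon>"
    by auto
  moreover have "snd (sphere_coord s) < 0"
    using x assms sphere_coord_chart[of 1 x] by simp
  ultimately show "s \<in> collar \<epsilon> \<inter> (range inc2 - PF)"
    by (auto simp: range_inc2 collar_def)
qed

lemma path_connected_collar_Int:
  assumes "0 < \<epsilon>" "\<epsilon> < 1" "\<And>p. p \<in> P2 \<Longrightarrow> \<epsilon> < 1 - norm (disk p)"
  shows "path_connected (collar \<epsilon> \<inter> (range inc2 - PF))"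
proof -
  have "collar \<epsilon> \<inter> (range inc2 - PF) = chart 1 ` {x. 1 < norm x \<and> norm x < 1 + \<epsilon>}"
    by (rule collar_Int_second_part) (use assms in auto)
  moreover have "path_connected {x::complex. 1 < norm (x - 0) \<and> norm (x - 0) < 1 + \<epsilon>}"
    by (rule path_connected_annulus) simp
  ultimately show ?thesis
    using assms by (auto intro!: path_connected_continuous_image continuous_on_chart)
qed

lemma collar_Un_second_part:
  assumes "0 < \<epsilon>"
  shows "M = collar \<epsilon> \<union> (range inc2 - PF)"
  using assms by (auto simp: collar_def range_inc2)

text \<open>The radius \<open>R < 1\<close> is chosen larger than the norms of the base point and of the punctures, in the
  disk coordinate. The straight line homotopy to the radial retraction then fixes the base point and
  avoids the punctures, and at its end the loop lies in the open first hemisphere.\<close>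

lemma collar_loop_homotopic:
  assumes fin: "finite P1"
    and \<epsilon>: "0 < \<epsilon>" "\<epsilon> < 1" "\<And>p. p \<in> P2 \<Longrightarrow> \<epsilon> < 1 - norm (disk p)"
    and t1: "t1 \<notin> P1" and \<eta>: "\<eta> \<in> loops_at (collar \<epsilon>) (inc1 t1)"
  obtains \<gamma> where "\<gamma> \<in> loops_at (UNIV - P1) t1" "homotopic_paths M \<eta> (inc1 \<circ> \<gamma>)"
proof -
  note \<eta> = loops_atD[OF \<eta>]
  obtain e where e: "0 < e" "e < 1" "\<And>p. p \<in> insert t1 P1 \<Longrightarrow> e < 1 - norm (disk p)"
    using finite_positive_bound[of "insert t1 P1" "\<lambda>p. 1 - norm (disk p)"] fin norm_disk_less_1
    by (metis diff_gt_0_iff_gt finite_insert)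
  define R where "R = 1 - e"
  have R: "0 < R" "R < 1" "\<And>p. p \<in> insert t1 P1 \<Longrightarrow> norm (disk p) < R"
    using e unfolding R_def by (auto simp: less_diff_eq algebra_simps)
  define A where "A = ball 0 (1 + \<epsilon>) - disk ` P1"
  have coll: "collar \<epsilon> = chart 1 ` A"
    unfolding A_def using \<epsilon> by (rule collar_eq)
  have A2: "A \<subseteq> ball 0 2"
    using \<epsilon> by (auto simp: A_def)
  have un: "unchart 1 (\<eta> s) \<in> A" "chart 1 (unchart 1 (\<eta> s)) = \<eta> s" if "s \<in> {0..1}" for s
  proof -
    have "\<eta> s \<in> chart 1 ` A"
      using \<eta>(2) that unfolding coll path_image_def by blast
    then obtain x where x: "x \<in> A" "\<eta> s = chart 1 x"
      by blast
    then have "unchart 1 (\<eta> s) = x"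
      using A2 unchart_chart[of 1 x] by auto
    then show "unchart 1 (\<eta> s) \<in> A" "chart 1 (unchart 1 (\<eta> s)) = \<eta> s"
      using x by simp_all
  qed
  define k where "k = unchart 1 \<circ> \<eta>"
  have "path_image \<eta> \<subseteq> {s. sphere_coord s \<noteq> (0, - 1)}"
    using \<eta>(2) \<epsilon> by (auto simp: collar_def dest!: subsetD)
  then have k: "path k"
    unfolding k_def using \<eta>(1) homeomorphism_cont2[OF homeomorphism_chart[of 1]] continuous_on_subset
    by (intro path_continuous_image) auto
  have k_ends: "pathstart k = disk t1" "pathfinish k = disk t1"
    using \<eta>(3,4) unchart_chart[of 1 "disk t1"] norm_disk_less_1[of t1]
    by (simp_all add: k_def pathstart_compose pathfinish_compose chart_eq_inc1)
  have ck: "path (radial_retract R \<circ> k)"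
    using k radial_retract(1)[OF R(1)] by (rule path_continuous_image)
  have ck_ends: "pathstart (radial_retract R \<circ> k) = disk t1" "pathfinish (radial_retract R \<circ> k) = disk t1"
    using k_ends radial_retract(3)[OF R(1), of "disk t1"] R(3)[of t1]
    by (simp_all add: pathstart_compose pathfinish_compose less_imp_le)
  have hom: "homotopic_paths A k (radial_retract R \<circ> k)"
  proof (rule homotopic_paths_linear[OF k ck])
    fix s :: real assume s: "s \<in> {0..1}"
    show "closed_segment (k s) ((radial_retract R \<circ> k) s) \<subseteq> A"
    proof
      fix y assume y: "y \<in> closed_segment (k s) ((radial_retract R \<circ> k) s)"
      have ks: "k s \<in> A"
        using un(1)[OF s] by (simp add: k_def)
      have "norm y \<le> norm (k s)" and or: "y = k s \<or> R \<le> norm y"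
        using radial_retract(4,5)[OF R(1), of y "k s"] y by simp_all
      then have "y \<in> ball 0 (1 + \<epsilon>)"
        using ks by (simp add: A_def)
      then show "y \<in> A"
        using or ks R(3) by (force simp: A_def)
    qed
  qed (simp_all add: k_ends ck_ends)
  have "homotopic_paths M (chart 1 \<circ> k) (chart 1 \<circ> (radial_retract R \<circ> k))"
    using hom continuous_on_chart[OF A2] by (rule homotopic_paths_continuous_image) (use coll in \<open>auto simp: collar_def\<close>)
  moreover have "homotopic_paths M \<eta> (chart 1 \<circ> k)"
    using \<eta>(1,2) un(2) by (intro homotopic_paths_eq) (auto simp: k_def collar_def)
  moreover define \<gamma> where "\<gamma> = undisk \<circ> (radial_retract R \<circ> k)"
  have "norm (radial_retract R (k s)) < 1" for s
    using radial_retract(2)[OF R(1), of "k s"] R(2) by linarith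
  then have "chart 1 \<circ> (radial_retract R \<circ> k) = inc1 \<circ> \<gamma>"
    by (auto simp: \<gamma>_def chart_eq_inc1)
  ultimately have homM: "homotopic_paths M \<eta> (inc1 \<circ> \<gamma>)"
    using homotopic_paths_trans by metis
  have "path \<gamma>"
    unfolding \<gamma>_def using ck
  proof (rule path_continuous_image)
    show "continuous_on (path_image (radial_retract R \<circ> k)) undisk"
      using \<open>\<And>s. norm (radial_retract R (k s)) < 1\<close>
      by (intro continuous_on_subset[OF continuous_on_undisk]) (auto simp: path_image_def)
  qed
  moreover have "pathstart \<gamma> = t1" "pathfinish \<gamma> = t1"
    using ck_ends by (simp_all add: \<gamma>_def pathstart_compose[of undisk] pathfinish_compose[of undisk] del: o_apply)
  moreover have "path_image \<gamma> \<subseteq> UNIV - P1"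
    using homotopic_paths_imp_subset[OF homM] by (auto simp: path_image_compose inc_in_PF)
  ultimately have "\<gamma> \<in> loops_at (UNIV - P1) t1"
    by (simp add: loops_at_def)
  then show thesis
    using that homM by blast
qed

lemma second_part_loop_homotopic:
  assumes \<eta>: "\<eta> \<in> loops_at (range inc2 - PF) (inc2 t2)"
  obtains \<gamma> where "\<gamma> \<in> loops_at (UNIV - P2) t2" "homotopic_paths M \<eta> (inc2 \<circ> \<gamma>)"
proof -
  note \<eta> = loops_atD[OF \<eta>]
  define \<gamma> where "\<gamma> = (\<lambda>s. undisk (cnj (fst (sphere_coord s)))) \<circ> \<eta>"
  note h = homeomorphism_inc2
  have im: "path_image \<eta> \<subseteq> range inc2"
    using \<eta>(2) by blast
  have eq: "inc2 (\<gamma> s) = \<eta> s" if "s \<in> {0..1}" for s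
  proof -
    have "\<eta> s \<in> range inc2"
      using im that unfolding path_image_def by blast
    then show ?thesis
      using homeomorphism_apply2[OF h, of "\<eta> s"] by (simp add: \<gamma>_def)
  qed
  have "path \<gamma>"
    unfolding \<gamma>_def using \<eta>(1) continuous_on_subset[OF homeomorphism_cont2[OF h] im]
    by (rule path_continuous_image)
  moreover have "pathstart \<gamma> = t2" "pathfinish \<gamma> = t2"
    using \<eta>(3,4) by (simp_all add: \<gamma>_def pathstart_def pathfinish_def)
  moreover have hom: "homotopic_paths M \<eta> (inc2 \<circ> \<gamma>)"
    using \<eta>(1,2) eq by (intro homotopic_paths_eq) auto
  moreover have "path_image \<gamma> \<subseteq> UNIV - P2"
    using homotopic_paths_imp_subset[OF hom] by (auto simp: path_image_compose inc_in_PF)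
  ultimately show thesis
    using that by (simp add: loops_at_def)
qed

end

section \<open>Generation by the two polynomial groups\<close>

theorem proposition5:
  fixes f1 f2 :: "complex poly" and d :: nat
    and t :: mating_sphere and t1 t2 :: complex
  defines "F \<equiv> formal_mating d f1 f2"
  assumes "d \<ge> 2"
    and "degree f1 = d" and "degree f2 = d"
    and "lead_coeff f1 = 1" and "lead_coeff f2 = 1"
    and "finite (poly_post_critical f1)" and "finite (poly_post_critical f2)"
    and "t \<notin> branched_post_critical F"
    and "t1 \<notin> poly_post_critical f1" and "t2 \<notin> poly_post_critical f2"
  shows "\<exists>H1 H2. subgroup H1 (IMG_branched F t) \<and> subgroup H2 (IMG_branched F t)
    \<and> generate (IMG_branched F t) (H1 \<union> H2) = carrier (IMG_branched F t)
    \<and> (IMG_branched F t)\<lparr>carrier := H1\<rparr> \<cong> IMG_poly f1 t1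
    \<and> (IMG_branched F t)\<lparr>carrier := H2\<rparr> \<cong> IMG_poly f2 t2"
proof -
  interpret P: monic_pair d f1 f2
    using assms by unfold_locales auto
  note fin = \<open>finite (poly_post_critical f1)\<close> \<open>finite (poly_post_critical f2)\<close>
  interpret I1: invariant_part P.F P.M1 P.M "poly f1" inc1 "\<lambda>s. undisk (fst (sphere_coord s))"
    using fin by (rule P.invariant_part_inc1)
  interpret I2: invariant_part P.F P.M1 P.M "poly f2" inc2 "\<lambda>s. undisk (cnj (fst (sphere_coord s)))"
    using fin by (rule P.invariant_part_inc2)
  define G where "G = IMG P.F P.M1 P.M t"
  have G: "IMG_branched F t = G"
    by (simp add: G_def IMG_branched_def F_def)
  have tM: "t \<in> P.M"
    using assms by (simp add: F_def)
  obtain \<epsilon> where \<epsilon>: "0 < \<epsilon>" "\<epsilon> < 1" "\<And>p. p \<in> P.P2 \<Longrightarrow> \<epsilon> < 1 - norm (disk p)"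
    using finite_positive_bound[OF fin(2), of "\<lambda>p. 1 - norm (disk p)"] norm_disk_less_1 by auto
  define V1 where "V1 = P.collar \<epsilon>"
  define V2 where "V2 = range inc2 - P.PF"
  have cover: "P.M = V1 \<union> V2"
    unfolding V1_def V2_def using \<epsilon>(1) by (rule P.collar_Un_second_part)
  have op: "open V1" "open V2"
    using P.open_collar[OF fin] open_Int[OF open_range_inc(2) P.open_M[OF fin]]
    by (simp_all add: V1_def V2_def Diff_eq)
  have pc: "path_connected V1" "path_connected V2" "path_connected (V1 \<inter> V2)"
    unfolding V1_def V2_def using P.path_connected_collar[OF fin(1)] P.path_connected_second_part[OF fin(2)]
      P.path_connected_collar_Int \<epsilon> by blast+
  obtain t0 where t0: "t0 \<in> V1 \<inter> V2"
  proof
    define x where "x = complex_of_real (1 + \<epsilon> / 2)"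
    have "norm x = 1 + \<epsilon> / 2"
      unfolding x_def norm_of_real using \<epsilon> by simp
    then have "chart 1 x \<in> chart 1 ` {x. 1 < norm x \<and> norm x < 1 + \<epsilon>}"
      using \<epsilon> by simp
    then show "chart 1 x \<in> V1 \<inter> V2"
      unfolding V1_def V2_def using P.collar_Int_second_part \<epsilon> by blast
  qed
  have in1: "inc1 t1 \<in> V1"
    using assms \<epsilon>(1) norm_disk_less_1[of t1] by (simp add: V1_def P.collar_def P.inc_in_PF)
  have in2: "inc2 t2 \<in> V2"
    using assms by (simp add: V2_def P.inc_in_PF)
  have pcM: "path_connected P.M"
    unfolding cover using pc t0 by (intro path_connected_Un) auto
  obtain \<beta> where \<beta>: "path \<beta>" "path_image \<beta> \<subseteq> P.M" "pathstart \<beta> = t" "pathfinish \<beta> = t0"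
    using pcM tM t0 cover unfolding path_connected_def by blast
  obtain \<alpha>1 where \<alpha>1: "path \<alpha>1" "path_image \<alpha>1 \<subseteq> V1" "pathstart \<alpha>1 = t0" "pathfinish \<alpha>1 = inc1 t1"
    using pc(1) t0 in1 unfolding path_connected_def by blast
  obtain \<alpha>2 where \<alpha>2: "path \<alpha>2" "path_image \<alpha>2 \<subseteq> V2" "pathstart \<alpha>2 = t0" "pathfinish \<alpha>2 = inc2 t2"
    using pc(2) t0 in2 unfolding path_connected_def by blast
  have VM: "V1 \<subseteq> P.M" "V2 \<subseteq> P.M"
    using cover by blast+
  have \<alpha>M: "path_image \<alpha>1 \<subseteq> P.M" "path_image \<alpha>2 \<subseteq> P.M"
    using \<alpha>1(2) \<alpha>2(2) VM by blast+
  \<comment> \<open>Both subgroups are formed with connecting paths that pass through \<open>t0\<close> and then stay in \<open>V1\<close>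
    or \<open>V2\<close>, so that each loop at \<open>t0\<close> inside \<open>V1\<close> or \<open>V2\<close> gives an element of one of them.\<close>
  define H1 where "H1 = (\<lambda>\<gamma>. I1.img_class t (I1.conj_loop (\<beta> +++ \<alpha>1) \<gamma>)) ` loops_at (inc1 -` P.M) t1"
  define H2 where "H2 = (\<lambda>\<gamma>. I1.img_class t (I2.conj_loop (\<beta> +++ \<alpha>2) \<gamma>)) ` loops_at (inc2 -` P.M) t2"
  have b1: "path (\<beta> +++ \<alpha>1)" "path_image (\<beta> +++ \<alpha>1) \<subseteq> P.M" "pathstart (\<beta> +++ \<alpha>1) = t"
      "pathfinish (\<beta> +++ \<alpha>1) = inc1 t1"
    and b2: "path (\<beta> +++ \<alpha>2)" "path_image (\<beta> +++ \<alpha>2) \<subseteq> P.M" "pathstart (\<beta> +++ \<alpha>2) = t"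
      "pathfinish (\<beta> +++ \<alpha>2) = inc2 t2"
    using \<beta> \<alpha>1 \<alpha>2 \<alpha>M by (simp_all add: subset_path_image_join)
  have H1: "subgroup H1 G" "G\<lparr>carrier := H1\<rparr> \<cong> IMG_poly f1 t1"
    unfolding H1_def G_def IMG_poly_def using I1.IMG_part_embeds[OF b1] by (simp_all only: P.vimage_M)
  have H2: "subgroup H2 G" "G\<lparr>carrier := H2\<rparr> \<cong> IMG_poly f2 t2"
    unfolding H2_def G_def IMG_poly_def using I2.IMG_part_embeds[OF b2] by (simp_all only: P.vimage_M)
  interpret G: group G
    unfolding G_def using tM by (rule I1.group_IMG)
  define K where "K = generate G (H1 \<union> H2)"
  have HG: "H1 \<union> H2 \<subseteq> carrier G"
    using H1(1) H2(1) subgroup.subset by blast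
  have HK: "H1 \<subseteq> K" "H2 \<subseteq> K"
    unfolding K_def by (auto intro: generate.incl)
  have "K = carrier G"
    unfolding G_def
  proof (rule I1.subgroup_IMG_eq_carrier[OF cover op pc t0 \<beta>])
    show "subgroup K (IMG P.F P.M1 P.M t)"
      unfolding K_def G_def[symmetric] using HG by (rule G.generate_is_subgroup)
    show "I1.img_class t (\<beta> +++ (\<eta> +++ reversepath \<beta>)) \<in> K" if \<eta>: "\<eta> \<in> loops_at V1 t0" for \<eta>
    proof -
      note \<eta>' = loops_atD[OF \<eta>]
      have "reversepath \<alpha>1 +++ (\<eta> +++ \<alpha>1) \<in> loops_at V1 (inc1 t1)"
        using \<alpha>1 \<eta>' by (simp add: loops_at_def subset_path_image_join)
      then obtain \<gamma> where \<gamma>: "\<gamma> \<in> loops_at (UNIV - P.P1) t1"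
        "homotopic_paths P.M (reversepath \<alpha>1 +++ (\<eta> +++ \<alpha>1)) (inc1 \<circ> \<gamma>)"
        using P.collar_loop_homotopic[OF fin(1) \<epsilon> \<open>t1 \<notin> poly_post_critical f1\<close>] unfolding V1_def by metis
      have "\<gamma> \<in> loops_at (inc1 -` P.M) t1"
        using \<gamma>(1) by (simp only: P.vimage_M)
      moreover have "\<eta> \<in> loops_at P.M t0"
        using \<eta>' VM by (auto simp: loops_at_def)
      ultimately have "I1.img_class t (\<beta> +++ (\<eta> +++ reversepath \<beta>)) \<in> H1"
        unfolding H1_def using I1.img_class_conj_through[OF \<beta> \<alpha>1(1) \<alpha>M(1) \<alpha>1(3,4) _ _ \<gamma>(2)] by blast
      then show ?thesis
        using HK by blast
    qed
    show "I1.img_class t (\<beta> +++ (\<eta> +++ reversepath \<beta>)) \<in> K" if \<eta>: "\<eta> \<in> loops_at V2 t0" for \<eta>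
    proof -
      note \<eta>' = loops_atD[OF \<eta>]
      have "reversepath \<alpha>2 +++ (\<eta> +++ \<alpha>2) \<in> loops_at V2 (inc2 t2)"
        using \<alpha>2 \<eta>' by (simp add: loops_at_def subset_path_image_join)
      then obtain \<gamma> where \<gamma>: "\<gamma> \<in> loops_at (UNIV - P.P2) t2"
        "homotopic_paths P.M (reversepath \<alpha>2 +++ (\<eta> +++ \<alpha>2)) (inc2 \<circ> \<gamma>)"
        using P.second_part_loop_homotopic unfolding V2_def by metis
      have "\<gamma> \<in> loops_at (inc2 -` P.M) t2"
        using \<gamma>(1) by (simp only: P.vimage_M)
      moreover have "\<eta> \<in> loops_at P.M t0"
        using \<eta>' VM by (auto simp: loops_at_def)
      ultimately have "I1.img_class t (\<beta> +++ (\<eta> +++ reversepath \<beta>)) \<in> H2"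
        unfolding H2_def using I2.img_class_conj_through[OF \<beta> \<alpha>2(1) \<alpha>M(2) \<alpha>2(3,4) _ _ \<gamma>(2)] by blast
      then show ?thesis
        using HK by blast
    qed
  qed
  then show ?thesis
    unfolding G using H1 H2 unfolding K_def by blast
qed

end
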